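(* Consider the CSWig model (with $\tau=1$) or the CSWish model (with $n/m\to\tau$), let $(U,V)$ be sampled from $\mathbb P_\rho$, and let $\kappa=\left(\frac{(1-\tau\alpha^2)(1-\tau\beta^2)}{\tau^2\alpha^2\beta^2}\right)^{1/4}$. Assume that for some $\varepsilon>0$ one has $\rho>\kappa+\varepsilon$ and $\alpha,\beta\in(\varepsilon\tau^{-1/2},\tau^{-1/2}]$. Then there exist estimators $\hat\alpha,\hat\beta$ depending only on $U,V$ and $\varepsilon$ (not on $\alpha,\beta,\rho$) such that with high probability $$\hat\alpha=\alpha+o(1),\qquad\hat\beta=\beta+o(1).$$
   Context: CSWig model with correlation $\rho\in[0,1]$: $U=\alpha aa^\top+Z_a$, $V=\beta bb^\top+Z_b\in\mathbb R^{n\times n}$, with $Z_a,Z_b\sim\mathrm{GOE}(1/n)$ independent (symmetric, independent centered Gaussian entries, variance $1/n$ off the diagonal and $2/n$ on it), independent of the jointly Gaussian pair $(a,b)$, $\sqrt n\,a\sim N(0,I_n)$, $\sqrt n\,b\sim N(0,I_n)$, $n\,\mathbb E[ab^\top]=\rho I_n$. CSWish model with correlation $\rho\in[0,1]$: $n,m\to\infty$, $n/m\to\tau>0$; $U=\sqrt{\alpha/m}\,ua^\top+Z_a$, $V=\sqrt{\beta/m}\,vb^\top+Z_b\in\mathbb R^{n\times m}$, where $Z_a,Z_b$ have independent $N(0,m^{-1})$ entries, $u,v\sim N(0,I_n)$ independent, $(a,b)$ jointly Gaussian with $\sqrt m\,a\sim N(0,I_m)$, $\sqrt m\,b\sim N(0,I_m)$,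 $m\,\mathbb E[ab^\top]=\rho I_m$, all of $Z_a,Z_b,u,v,(a,b)$ independent. $\mathbb P_\rho$ is the law of $(U,V)$. All of $\alpha,\beta,\rho,\tau,\varepsilon$ are fixed as $n\to\infty$. "$\hat\alpha=\alpha+o(1)$ with high probability" means that there is a deterministic $\varepsilon_n\to0$ with $\mathbb P(|\hat\alpha-\alpha|\le\varepsilon_n)\to1$ as $n\to\infty$. *)

theory Defs
  imports "HOL-Probability.Probability"
begin

section \<open>Gaussian arrays\<close>

text \<open>
  Vectors in dimension \<open>n\<close> and \<open>n \<times> m\<close> matrices are (extensional) real functions on the
  finite index sets \<open>{..<n}\<close> and \<open>{..<n} \<times> {..<m}\<close>, with the product Borel sigma-algebra, so
  that the dimensions can vary inside a statement.
\<close>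

type_synonym rvec = "nat \<Rightarrow> real"
type_synonym rmat = "nat \<times> nat \<Rightarrow> real"

definition vec_space :: "nat \<Rightarrow> rvec measure" where
  "vec_space n = (\<Pi>\<^sub>M i\<in>{..<n}. borel)"

definition mat_space :: "nat \<Rightarrow> nat \<Rightarrow> rmat measure" where
  "mat_space n m = (\<Pi>\<^sub>M p\<in>{..<n} \<times> {..<m}. borel)"

definition gaussian_array :: "'i set \<Rightarrow> ('i \<Rightarrow> real) \<Rightarrow> ('i \<Rightarrow> real) measure" where
  \<comment> \<open>\<open>v p\<close> is the variance of entry \<open>p\<close>; \<open>normal_density\<close> takes the standard deviation.\<close>
  "gaussian_array I v = (\<Pi>\<^sub>M p\<in>I. density lborel (normal_density 0 (sqrt (v p))))"

definition gaussian_vec :: "nat \<Rightarrow> real \<Rightarrow> rvec measure" where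
  "gaussian_vec n v = gaussian_array {..<n} (\<lambda>_. v)"

definition gaussian_mat :: "nat \<Rightarrow> nat \<Rightarrow> real \<Rightarrow> rmat measure" where
  "gaussian_mat n m v = gaussian_array ({..<n} \<times> {..<m}) (\<lambda>_. v)"

definition symmetrize :: "nat \<Rightarrow> rmat \<Rightarrow> rmat" where
  "symmetrize n g = (\<lambda>(i, j)\<in>{..<n} \<times> {..<n}. g (min i j, max i j))"

definition goe :: "nat \<Rightarrow> real \<Rightarrow> rmat measure" where
  "goe n v = distr
     (gaussian_array {(i, j). i \<le> j \<and> j < n} (\<lambda>(i, j). if i = j then 2 * v else v))
     (mat_space n n) (symmetrize n)"

text \<open>
  The jointly Gaussian pair \<open>(a, b)\<close> with \<open>a, b \<sim> N(0, I/n)\<close> and \<open>E[a b\<^sup>T] = \<rho> I/n\<close>, as a linear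
  image of a standard Gaussian vector in dimension \<open>2 n\<close>.  Being centred and jointly Gaussian, its
  law is determined by the second moments, which are computed in the lemma
  \<open>correlated_pair_moments\<close> below.  This form also covers the degenerate case \<open>\<rho> = 1\<close>, where
  \<open>a = b\<close> and there is no joint density.
\<close>

definition correlate :: "nat \<Rightarrow> real \<Rightarrow> rvec \<times> rvec \<Rightarrow> rvec \<times> rvec" where
  "correlate n \<rho> = (\<lambda>(g, h).
     (\<lambda>i\<in>{..<n}. g i / sqrt (real n),
      \<lambda>i\<in>{..<n}. (\<rho> * g i + sqrt (1 - \<rho>\<^sup>2) * h i) / sqrt (real n)))"

definition correlated_pair :: "nat \<Rightarrow> real \<Rightarrow> (rvec \<times> rvec) measure" where
  "correlated_pair n \<rho> = distr (gaussian_vec n 1 \<Otimes>\<^sub>M gaussian_vec n 1)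
     (vec_space n \<Otimes>\<^sub>M vec_space n) (correlate n \<rho>)"


section \<open>The two correlated spiked models\<close>

definition spike :: "nat \<Rightarrow> nat \<Rightarrow> real \<Rightarrow> rvec \<Rightarrow> rvec \<Rightarrow> rmat \<Rightarrow> rmat" where
  \<comment> \<open>\<open>c x y\<^sup>T + Z\<close>\<close>
  "spike n m c x y Z = (\<lambda>(i, j)\<in>{..<n} \<times> {..<m}. c * x i * y j + Z (i, j))"

definition cswig :: "nat \<Rightarrow> real \<Rightarrow> real \<Rightarrow> real \<Rightarrow> (rmat \<times> rmat) measure" where
  "cswig n \<alpha> \<beta> \<rho> = distr
     (correlated_pair n \<rho> \<Otimes>\<^sub>M (goe n (1 / real n) \<Otimes>\<^sub>M goe n (1 / real n)))
     (mat_space n n \<Otimes>\<^sub>M mat_space n n)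
     (\<lambda>((a, b), (Z\<^sub>a, Z\<^sub>b)). (spike n n \<alpha> a a Z\<^sub>a, spike n n \<beta> b b Z\<^sub>b))"

definition cswish :: "nat \<Rightarrow> nat \<Rightarrow> real \<Rightarrow> real \<Rightarrow> real \<Rightarrow> (rmat \<times> rmat) measure" where
  "cswish n m \<alpha> \<beta> \<rho> = distr
     (correlated_pair m \<rho> \<Otimes>\<^sub>M
       ((gaussian_vec n 1 \<Otimes>\<^sub>M gaussian_vec n 1) \<Otimes>\<^sub>M
        (gaussian_mat n m (1 / real m) \<Otimes>\<^sub>M gaussian_mat n m (1 / real m))))
     (mat_space n m \<Otimes>\<^sub>M mat_space n m)
     (\<lambda>((a, b), ((u, v), (Z\<^sub>a, Z\<^sub>b))).
        (spike n m (sqrt (\<alpha> / real m)) u a Z\<^sub>a, spike n m (sqrt (\<beta> / real m)) v b Z\<^sub>b))"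


section \<open>Estimation\<close>

definition kappa :: "real \<Rightarrow> real \<Rightarrow> real \<Rightarrow> real" where
  "kappa \<tau> \<alpha> \<beta> =
     ((1 - \<tau> * \<alpha>\<^sup>2) * (1 - \<tau> * \<beta>\<^sup>2) / (\<tau>\<^sup>2 * \<alpha>\<^sup>2 * \<beta>\<^sup>2)) powr (1 / 4)"

definition admissible :: "real \<Rightarrow> real \<Rightarrow> real \<Rightarrow> real \<Rightarrow> real \<Rightarrow> bool" where
  "admissible \<epsilon> \<tau> \<alpha> \<beta> \<rho> \<longleftrightarrow>
     \<rho> \<in> {0..1} \<and> \<rho> > kappa \<tau> \<alpha> \<beta> + \<epsilon> \<and>
     \<alpha> \<in> {\<epsilon> * \<tau> powr (-1/2) <.. \<tau> powr (-1/2)} \<and>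
     \<beta> \<in> {\<epsilon> * \<tau> powr (-1/2) <.. \<tau> powr (-1/2)}"

definition whp_consistent ::
  "(nat \<Rightarrow> 'a measure) \<Rightarrow> (nat \<Rightarrow> 'a \<Rightarrow> real) \<Rightarrow> real \<Rightarrow> bool" where
  "whp_consistent P est \<theta> \<longleftrightarrow>
     (\<exists>\<delta> :: nat \<Rightarrow> real. \<delta> \<longlonglongrightarrow> 0 \<and>
        (\<lambda>n. measure (P n) {x \<in> space (P n). \<bar>est n x - \<theta>\<bar> \<le> \<delta> n}) \<longlonglongrightarrow> 1)"


section \<open>Well-formedness of the models\<close>

lemma sets_gaussian_array:
  "sets (gaussian_array I v) = sets (\<Pi>\<^sub>M p\<in>I. (borel :: real measure))"
  unfolding gaussian_array_def by (intro sets_PiM_cong) auto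

lemma sets_gaussian_vec [measurable_cong]: "sets (gaussian_vec n v) = sets (vec_space n)"
  by (simp add: gaussian_vec_def vec_space_def sets_gaussian_array)

lemma sets_gaussian_mat [measurable_cong]: "sets (gaussian_mat n m v) = sets (mat_space n m)"
  by (simp add: gaussian_mat_def mat_space_def sets_gaussian_array)

lemma sets_goe [measurable_cong]: "sets (goe n v) = sets (mat_space n n)"
  by (simp add: goe_def)

lemma sets_correlated_pair [measurable_cong]:
  "sets (correlated_pair n \<rho>) = sets (vec_space n \<Otimes>\<^sub>M vec_space n)"
  by (simp add: correlated_pair_def)

lemma prob_space_gaussian_array:
  assumes "\<And>p. p \<in> I \<Longrightarrow> v p > 0"
  shows "prob_space (gaussian_array I v)"
  unfolding gaussian_array_def
  by (intro prob_space_PiM prob_space_normal_density) (simp add: assms)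

lemma measurable_vec_entry [measurable (raw)]:
  assumes "f \<in> measurable N (vec_space n)" "i < n"
  shows "(\<lambda>x. f x i) \<in> borel_measurable N"
  using assms unfolding vec_space_def by (auto intro: measurable_PiM_component_rev measurable_compose)

lemma measurable_mat_entry [measurable (raw)]:
  assumes "f \<in> measurable N (mat_space n m)" "i < n" "j < m"
  shows "(\<lambda>x. f x (i, j)) \<in> borel_measurable N"
proof -
  have "(\<lambda>w. w (i, j)) \<in> borel_measurable (mat_space n m)"
    unfolding mat_space_def by (rule measurable_component_singleton) (use assms in auto)
  then show ?thesis using assms(1) by (rule measurable_compose[rotated])
qed

lemma measurable_symmetrize:
  "symmetrize n \<in> measurable (gaussian_array {(i, j). i \<le> j \<and> j < n} v) (mat_space n n)"
proof -
  have "(\<lambda>g. g (min i j, max i j)) \<in> borel_measurable (gaussian_array {(i, j). i \<le> j \<and> j < n} v)"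
    if "i < n" "j < n" for i j
    unfolding measurable_cong_sets[OF sets_gaussian_array refl]
    by (rule measurable_component_singleton) (use that in auto)
  then show ?thesis
    unfolding symmetrize_def mat_space_def
    by (intro measurable_restrict) auto
qed

lemma prob_space_goe: "v > 0 \<Longrightarrow> prob_space (goe n v)"
  unfolding goe_def
  by (intro prob_space.prob_space_distr prob_space_gaussian_array measurable_symmetrize)
     (auto split: if_splits)

lemma measurable_correlate:
  "correlate n \<rho> \<in> measurable (gaussian_vec n 1 \<Otimes>\<^sub>M gaussian_vec n 1)
     (vec_space n \<Otimes>\<^sub>M vec_space n)"
proof -
  let ?N = "gaussian_vec n 1 \<Otimes>\<^sub>M gaussian_vec n 1"
  have [measurable]: "(\<lambda>x. fst x i) \<in> borel_measurable ?N" "(\<lambda>x. snd x i) \<in> borel_measurable ?N"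
    if "i < n" for i
    by (rule measurable_vec_entry[of _ _ n]; use that in measurable)+
  have "(\<lambda>x. \<lambda>i\<in>{..<n}. fst x i / sqrt (real n)) \<in> measurable ?N (vec_space n)"
    unfolding vec_space_def by (rule measurable_restrict) measurable
  moreover have "(\<lambda>x. \<lambda>i\<in>{..<n}. (\<rho> * fst x i + sqrt (1 - \<rho>\<^sup>2) * snd x i) / sqrt (real n))
      \<in> measurable ?N (vec_space n)"
    unfolding vec_space_def by (rule measurable_restrict) measurable
  ultimately show ?thesis
    unfolding correlate_def case_prod_beta by (rule measurable_Pair)
qed

lemma prob_space_gaussian_vec: "v > 0 \<Longrightarrow> prob_space (gaussian_vec n v)"
  by (simp add: gaussian_vec_def prob_space_gaussian_array)

lemma prob_space_gaussian_mat: "v > 0 \<Longrightarrow> prob_space (gaussian_mat n m v)"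
  by (simp add: gaussian_mat_def prob_space_gaussian_array)

lemma prob_space_correlated_pair: "prob_space (correlated_pair n \<rho>)"
  unfolding correlated_pair_def
  by (intro prob_space.prob_space_distr prob_space_pair prob_space_gaussian_vec
        measurable_correlate) auto

lemma measurable_spike:
  assumes "x \<in> measurable N (vec_space n)" "y \<in> measurable N (vec_space m)"
    "Z \<in> measurable N (mat_space n m)"
  shows "(\<lambda>w. spike n m c (x w) (y w) (Z w)) \<in> measurable N (mat_space n m)"
proof -
  have "(\<lambda>w. c * x w i * y w j + Z w (i, j)) \<in> borel_measurable N" if "i < n" "j < m" for i j
    by (intro borel_measurable_add borel_measurable_times borel_measurable_const
          measurable_vec_entry[OF assms(1)] measurable_vec_entry[OF assms(2)]
          measurable_mat_entry[OF assms(3)] that)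
  then show ?thesis
    unfolding spike_def mat_space_def by (intro measurable_restrict) auto
qed

lemma prob_space_cswig: "n > 0 \<Longrightarrow> prob_space (cswig n \<alpha> \<beta> \<rho>)"
  unfolding cswig_def case_prod_beta
  by (intro prob_space.prob_space_distr prob_space_pair prob_space_goe prob_space_correlated_pair
        measurable_Pair measurable_spike) (auto, measurable)

lemma prob_space_cswish: "m > 0 \<Longrightarrow> prob_space (cswish n m \<alpha> \<beta> \<rho>)"
  unfolding cswish_def case_prod_beta
  by (intro prob_space.prob_space_distr prob_space_pair prob_space_gaussian_vec
        prob_space_gaussian_mat prob_space_correlated_pair
        measurable_Pair measurable_spike) (auto, measurable)


subsection \<open>Second moments of the correlated pair\<close>

lemma std_gaussian_moments:
  fixes N :: "real measure"
  defines "N \<equiv> density lborel (normal_density 0 (sqrt 1))"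
  shows "integrable N (\<lambda>x. x)" "integral\<^sup>L N (\<lambda>x. x) = 0"
    "integrable N (\<lambda>x. x * x)" "integral\<^sup>L N (\<lambda>x. x * x) = 1"
  using std_normal_moment_even[of 1] std_normal_moment_odd[of 0]
  unfolding N_def
  by (simp_all add: has_bochner_integral_iff integrable_density integral_density fact_numeral
        power2_eq_square mult.assoc)

lemma gaussian_vec_moments:
  assumes i: "i < n" and j: "j < n"
  shows "integrable (gaussian_vec n 1) (\<lambda>g. g i)"
    "integral\<^sup>L (gaussian_vec n 1) (\<lambda>g. g i) = 0"
    "integrable (gaussian_vec n 1) (\<lambda>g. g i * g j)"
    "integral\<^sup>L (gaussian_vec n 1) (\<lambda>g. g i * g j) = of_bool (i = j)"
proof -
  define N :: "real measure" where "N = density lborel (normal_density 0 (sqrt 1))"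
  note mom = std_gaussian_moments[folded N_def]
  interpret N: prob_space N
    unfolding N_def by (rule prob_space_normal_density) simp
  interpret P: product_prob_space "\<lambda>_::nat. N" by standard
  have G: "gaussian_vec n 1 = (\<Pi>\<^sub>M i\<in>{..<n}. N)"
    by (simp add: gaussian_vec_def gaussian_array_def N_def)
  have e1: "(\<Prod>k\<in>{..<n}. if k = i then g k else 1) = g i" for g :: rvec
    using i by simp
  have e2: "(\<Prod>k\<in>{..<n}. (if k = i then g k else 1) * (if k = j then g k else 1)) = g i * g j"
    for g :: rvec
    using i j by (simp add: prod.distrib)
  have m1: "integrable N (\<lambda>x. if k = i then x else 1)" for k
    using mom by (cases "k = i") auto
  have m2: "integrable N (\<lambda>x. (if k = i then x else 1) * (if k = j then x else 1))" for k
    by (cases "k = i"; cases "k = j") (simp_all add: mom)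
  show "integrable (gaussian_vec n 1) (\<lambda>g. g i)"
    using P.product_integrable_prod[of "{..<n}" "\<lambda>k x. if k = i then x else 1"] m1
    by (simp add: e1 G)
  show "integrable (gaussian_vec n 1) (\<lambda>g. g i * g j)"
    using P.product_integrable_prod[of "{..<n}"
        "\<lambda>k x. (if k = i then x else 1) * (if k = j then x else 1)"] m2
    by (simp add: e2 G)
  have "integral\<^sup>L (gaussian_vec n 1) (\<lambda>g. g i)
      = (\<Prod>k<n. integral\<^sup>L N (\<lambda>x. if k = i then x else 1))"
    using P.product_integral_prod[of "{..<n}" "\<lambda>k x. if k = i then x else 1"] m1
    by (simp add: e1 G)
  also have "\<dots> = 0"
    by (rule prod_zero) (use i in \<open>auto simp: mom intro!: bexI[of _ i]\<close>)
  finally show "integral\<^sup>L (gaussian_vec n 1) (\<lambda>g. g i) = 0" .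
  have *: "integral\<^sup>L (gaussian_vec n 1) (\<lambda>g. g i * g j)
      = (\<Prod>k<n. integral\<^sup>L N (\<lambda>x. (if k = i then x else 1) * (if k = j then x else 1)))"
    using P.product_integral_prod[of "{..<n}"
        "\<lambda>k x. (if k = i then x else 1) * (if k = j then x else 1)"] m2
    by (simp add: e2 G)
  show "integral\<^sup>L (gaussian_vec n 1) (\<lambda>g. g i * g j) = of_bool (i = j)"
  proof (cases "i = j")
    case True
    have "integral\<^sup>L N (\<lambda>x. (if k = i then x else 1) * (if k = j then x else 1)) = 1" for k
      using True by (cases "k = j") (simp_all add: mom N.prob_space)
    then show ?thesis unfolding * using True by simp
  next
    case False
    then have "(\<Prod>k<n. integral\<^sup>L N (\<lambda>x. (if k = i then x else 1) * (if k = j then x else 1))) = 0"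
      by (intro prod_zero bexI[of _ i]) (use i in \<open>auto simp: mom\<close>)
    then show ?thesis unfolding * using False by simp
  qed
qed

lemma integral_pair_product:
  fixes f :: "'a \<Rightarrow> real" and g :: "'b \<Rightarrow> real"
  assumes "prob_space M" "prob_space N" "integrable M f" "integrable N g"
  shows "integrable (M \<Otimes>\<^sub>M N) (\<lambda>x. f (fst x) * g (snd x))"
    "integral\<^sup>L (M \<Otimes>\<^sub>M N) (\<lambda>x. f (fst x) * g (snd x)) = integral\<^sup>L M f * integral\<^sup>L N g"
proof -
  interpret M: prob_space M by fact
  interpret N: prob_space N by fact
  interpret pair_sigma_finite M N ..
  have [measurable]: "f \<in> borel_measurable M" "g \<in> borel_measurable N"
    using assms by auto
  show *: "integrable (M \<Otimes>\<^sub>M N) (\<lambda>x. f (fst x) * g (snd x))"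
    by (rule Fubini_integrable) (use assms in \<open>auto simp: abs_mult\<close>)
  show "integral\<^sup>L (M \<Otimes>\<^sub>M N) (\<lambda>x. f (fst x) * g (snd x)) = integral\<^sup>L M f * integral\<^sup>L N g"
    using integral_fst'[OF *] by simp
qed

lemma correlated_pair_moments:
  assumes "\<rho> \<in> {0..1}" and i: "i < n" and j: "j < n"
  defines "E \<equiv> integral\<^sup>L (correlated_pair n \<rho>)"
  shows "E (\<lambda>(a, b). a i) = 0" "E (\<lambda>(a, b). b i) = 0"
    "E (\<lambda>(a, b). a i * a j) = of_bool (i = j) / real n"
    "E (\<lambda>(a, b). b i * b j) = of_bool (i = j) / real n"
    "E (\<lambda>(a, b). a i * b j) = of_bool (i = j) * \<rho> / real n"
proof -
  let ?G = "gaussian_vec n 1"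
  let ?c = "sqrt (1 - \<rho>\<^sup>2)"
  have c: "?c * ?c = 1 - \<rho> * \<rho>"
    using assms(1) by (simp add: power2_eq_square mult_le_one)
  have n: "sqrt (real n) * sqrt (real n) = real n" "n > 0"
    using i by auto
  have G: "prob_space ?G" by (simp add: prob_space_gaussian_vec)
  interpret G: prob_space ?G by (rule G)
  note pp = integral_pair_product[OF G G]
  have one: "integrable ?G (\<lambda>_. 1)" "integral\<^sup>L ?G (\<lambda>_. 1) = (1::real)"
    by (auto simp: G.prob_space)
  have m: "integrable (?G \<Otimes>\<^sub>M ?G) (\<lambda>x. fst x k)" "integrable (?G \<Otimes>\<^sub>M ?G) (\<lambda>x. snd x k)"
    "integral\<^sup>L (?G \<Otimes>\<^sub>M ?G) (\<lambda>x. fst x k) = 0" "integral\<^sup>L (?G \<Otimes>\<^sub>M ?G) (\<lambda>x. snd x k) = 0"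
    if "k < n" for k
    using pp[OF gaussian_vec_moments(1)[OF that that] one(1)]
      pp[OF one(1) gaussian_vec_moments(1)[OF that that]]
    by (auto simp: gaussian_vec_moments[OF that that])
  have mm: "integrable (?G \<Otimes>\<^sub>M ?G) (\<lambda>x. fst x k * fst x l)"
    "integrable (?G \<Otimes>\<^sub>M ?G) (\<lambda>x. snd x k * snd x l)"
    "integrable (?G \<Otimes>\<^sub>M ?G) (\<lambda>x. fst x k * snd x l)"
    "integral\<^sup>L (?G \<Otimes>\<^sub>M ?G) (\<lambda>x. fst x k * fst x l) = of_bool (k = l)"
    "integral\<^sup>L (?G \<Otimes>\<^sub>M ?G) (\<lambda>x. snd x k * snd x l) = of_bool (k = l)"
    "integral\<^sup>L (?G \<Otimes>\<^sub>M ?G) (\<lambda>x. fst x k * snd x l) = 0"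
    if "k < n" "l < n" for k l
    using pp[OF gaussian_vec_moments(3)[OF that] one(1)]
      pp[OF one(1) gaussian_vec_moments(3)[OF that]]
      pp[OF gaussian_vec_moments(1)[OF that(1) that(1)] gaussian_vec_moments(1)[OF that(2) that(2)]]
    by (auto simp: gaussian_vec_moments[OF that] gaussian_vec_moments[OF that(1) that(1)]
          gaussian_vec_moments[OF that(2) that(2)] G.prob_space)
  have meas: "(\<lambda>x. fst x k) \<in> borel_measurable (vec_space n \<Otimes>\<^sub>M vec_space n)"
    "(\<lambda>x. snd x k) \<in> borel_measurable (vec_space n \<Otimes>\<^sub>M vec_space n)" if "k < n" for k
    using that by (auto intro: measurable_vec_entry[of fst _ n] measurable_vec_entry[of snd _ n])
  have E: "E f = integral\<^sup>L (?G \<Otimes>\<^sub>M ?G) (\<lambda>x. f (correlate n \<rho> x))"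
    if "f \<in> borel_measurable (vec_space n \<Otimes>\<^sub>M vec_space n)" for f
    unfolding E_def correlated_pair_def
    by (rule integral_distr[OF measurable_correlate that])
  show "E (\<lambda>(a, b). a i) = 0" "E (\<lambda>(a, b). b i) = 0"
    unfolding case_prod_beta
    by (subst E; use i in \<open>simp add: meas correlate_def case_prod_beta m\<close>)+
  show "E (\<lambda>(a, b). a i * a j) = of_bool (i = j) / real n"
    unfolding case_prod_beta
    by (subst E) (use i j in \<open>simp_all add: meas correlate_def case_prod_beta mm n\<close>)
  have "E (\<lambda>(a, b). b i * b j) = integral\<^sup>L (?G \<Otimes>\<^sub>M ?G)
     (\<lambda>x. ((\<rho> * \<rho>) * (fst x i * fst x j) + (\<rho> * ?c) * (fst x i * snd x j)
        + (\<rho> * ?c) * (fst x j * snd x i) + (?c * ?c) * (snd x i * snd x j)) / real n)"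
    unfolding case_prod_beta
    by (subst E, use i j in \<open>simp add: meas\<close>,
        intro Bochner_Integration.integral_cong refl,
        use i j n in \<open>simp add: correlate_def case_prod_beta algebra_simps\<close>)
  also have "\<dots> = of_bool (i = j) / real n"
    using i j by (simp add: mm c del: real_sqrt_mult_self real_sqrt_abs2)
  finally show "E (\<lambda>(a, b). b i * b j) = of_bool (i = j) / real n" .
  have "E (\<lambda>(a, b). a i * b j) = integral\<^sup>L (?G \<Otimes>\<^sub>M ?G)
     (\<lambda>x. (\<rho> * (fst x i * fst x j) + ?c * (fst x i * snd x j)) / real n)"
    unfolding case_prod_beta
    by (subst E, use i j in \<open>simp add: meas\<close>,
        intro Bochner_Integration.integral_cong refl,
        use i j n in \<open>simp add: correlate_def case_prod_beta algebra_simps add_divide_distrib\<close>)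
  also have "\<dots> = of_bool (i = j) * \<rho> / real n"
    using i j by (simp add: mm)
  finally show "E (\<lambda>(a, b). a i * b j) = of_bool (i = j) * \<rho> / real n" .
qed

end

theory Submission
  imports Defs
begin

text \<open>
  Take a closed walk through distinct vertices, with every edge labelled by the matrix (\<open>U\<close> or \<open>V\<close>)
  from which its entry is read, and multiply the entries along it.  Under the spiked law the rescaled
  product has mean \<open>\<alpha>\<^sup>#\<^sup>U \<beta>\<^sup>#\<^sup>V \<rho>\<^sup>s\<close>, where \<open>s\<close> counts the label changes.  Walks whose labels are
  concatenations of blocks \<open>V \<dots> V U\<close> have multiplicative means, and the signal-to-noise ratio of a
  sum over \<open>J\<close> such blocks is the \<open>J\<close>-th power of that of one block.  For the best block weights
  the latter has square \<open>\<tau>\<alpha>\<^sup>2 (1 + \<rho>\<^sup>4 \<Sum>k\<ge>1. (\<tau>\<beta>\<^sup>2)\<^sup>k)\<close>, and this exceeds \<open>1\<close> exactly when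
  \<open>\<rho> > \<kappa>\<close>.  Inserting one more letter \<open>U\<close> multiplies the mean by exactly \<open>\<alpha>\<close>, so \<open>\<alpha>\<close> is
  estimated by a ratio of two such sums.  Since the block weights must not depend on the parameters,
  the ratio is formed by least squares over the first \<open>J\<close> integer weight lists; as \<open>J \<rightarrow> \<infinity>\<close>, the signal
  of one good list is exponentially large, while the total noise grows only polynomially.  Finally
  \<open>J\<close> grows with \<open>n\<close> so slowly that second moments may be computed for fixed walk lengths.
\<close>

text \<open>Walks avoid repeated vertices so that every noise variable occurs at most once in a
  product: it drops out of the mean, and in a second moment it survives only on shared edges.
  Vertex-disjoint cycles are exactly uncorrelated, and overlapping cycles with different edges share
  more vertices than edges and are of lower order; to leading order the variance counts pairs with
  equal edges. One letter then costs a factor q in variance (1 for Wigner, m/n for Wishart), and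
  Cauchy-Schwarz over the block weights yields the stated ratio.

  The obstacle is uniformity: the good weights, the gain per block and the dimension from which the
  asymptotics hold all depend on the unknown \<alpha>, \<beta>, \<rho>. Three devices remove this.
  Every weight list is scaled by its own noise, so a useless list adds only O(1) to the residual.
  The level J is the largest number that passes explicit inequalities in n and m alone. In these, J
  itself stands in for an upper bound on the spike strengths, which it eventually exceeds.\<close>

section \<open>Labelled cycles\<close>

text \<open>
  Position \<open>t\<close> carries the vertex \<open>snd (C ! t)\<close> and the label of the edge from it to the next vertex,
  cyclically.
\<close>

type_synonym walk = "(bool \<times> nat) list"

text \<open>The pair is unordered because the entries (i, j) and (j, i) of a GOE matrix coincide.
  The label is kept because the noises of \<open>U\<close> and \<open>V\<close> on the same pair are
  independent.\<close>

definition edge_key :: "walk \<Rightarrow> nat \<Rightarrow> bool \<times> nat set" where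
  "edge_key C t = (fst (C ! t), {snd (C ! t), snd (C ! (Suc t mod length C))})"

definition edges :: "walk \<Rightarrow> (bool \<times> nat set) set" where
  "edges C = edge_key C ` {..<length C}"

definition verts :: "walk \<Rightarrow> nat set" where
  "verts C = snd ` set C"

text \<open>Length at least 3 keeps the edges distinct: in a closed walk of length two both steps
  use the same pair.\<close>

definition is_cycle :: "walk \<Rightarrow> bool" where
  "is_cycle C \<longleftrightarrow> 3 \<le> length C \<and> distinct (map snd C)"

lemma finite_edges [simp]: "finite (edges C)"
  by (simp add: edges_def)

lemma finite_verts [simp]: "finite (verts C)"
  by (simp add: verts_def)

lemma snd_nth_in_verts: "t < length C \<Longrightarrow> snd (C ! t) \<in> verts C"
  by (auto simp: verts_def)

lemma verts_image: "verts C = (\<lambda>t. snd (C ! t)) ` {..<length C}"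
  by (auto simp: verts_def set_conv_nth image_iff Bex_def)

lemma is_cycle_nth_eq:
  assumes "is_cycle C" "s < length C" "t < length C"
  shows "snd (C ! s) = snd (C ! t) \<longleftrightarrow> s = t"
  using assms nth_eq_iff_index_eq[of "map snd C" s t] by (simp add: is_cycle_def)

lemma inj_on_snd_nth: "is_cycle C \<Longrightarrow> inj_on (\<lambda>t. snd (C ! t)) {..<length C}"
  by (auto simp: inj_on_def is_cycle_nth_eq)

lemma card_verts: "is_cycle C \<Longrightarrow> card (verts C) = length C"
  unfolding verts_image by (simp add: card_image inj_on_snd_nth)

lemma Suc_mod_eq: "t < l \<Longrightarrow> Suc t mod l = (if Suc t = l then 0 else Suc t)"
  by auto

text \<open>Positions with the same pair are equal or cyclic successors of each other, and the
  latter forces length two. Pairs are compared without labels so that \<open>cycle_eqI\<close> can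
  deduce the labels from the pairs.\<close>

lemma snd_edge_key_eq:
  assumes "is_cycle C" "s < length C" "t < length C" "snd (edge_key C s) = snd (edge_key C t)"
  shows "s = t"
proof -
  let ?l = "length C"
  have l: "3 \<le> ?l" using assms by (simp add: is_cycle_def)
  have m: "Suc s mod ?l < ?l" "Suc t mod ?l < ?l" using l by (auto intro!: mod_less_divisor)
  have "s = t \<or> (s = Suc t mod ?l \<and> t = Suc s mod ?l)"
    using assms(4) is_cycle_nth_eq[OF assms(1)] assms(2,3) m
    by (auto simp: edge_key_def doubleton_eq_iff)
  then show ?thesis using assms(2,3) l by (auto simp: Suc_mod_eq split: if_splits)
qed

lemma nth_in_edge_key:
  assumes "is_cycle C" "s < length C" "t < length C" "snd (C ! t) \<in> snd (edge_key C s)"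
  shows "t = s \<or> t = Suc s mod length C"
proof -
  have "Suc s mod length C < length C" using assms by (auto intro!: mod_less_divisor)
  then show ?thesis
    using assms is_cycle_nth_eq[OF assms(1)] by (auto simp: edge_key_def)
qed

lemma inj_on_edge_key: "is_cycle C \<Longrightarrow> inj_on (edge_key C) {..<length C}"
  by (auto simp: inj_on_def intro: snd_edge_key_eq)

lemma card_edges: "is_cycle C \<Longrightarrow> card (edges C) = length C"
  unfolding edges_def by (simp add: card_image inj_on_edge_key)

lemma edges_verts: "k \<in> edges C \<Longrightarrow> snd k \<subseteq> verts C"
proof -
  assume "k \<in> edges C"
  then obtain t where t: "t < length C" "k = edge_key C t" by (auto simp: edges_def)
  then have "Suc t mod length C < length C" by (intro mod_less_divisor) auto
  then show ?thesis using t by (simp add: edge_key_def snd_nth_in_verts)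
qed

lemma card_edge_key:
  assumes "is_cycle C" "k \<in> edges C"
  shows "card (snd k) = 2"
proof -
  obtain t where t: "t < length C" "k = edge_key C t" using assms by (auto simp: edges_def)
  then have "snd (C ! t) \<noteq> snd (C ! (Suc t mod length C))"
    using assms(1) by (subst is_cycle_nth_eq) (auto simp: is_cycle_def Suc_mod_eq)
  then show ?thesis using t by (simp add: edge_key_def)
qed

lemma prod_edge_key:
  fixes f :: "bool \<Rightarrow> nat \<Rightarrow> 'c :: comm_monoid_mult"
  assumes "is_cycle C" "t < length C"
  shows "(\<Prod>z\<in>snd (edge_key C t). f (fst (edge_key C t)) z)
    = f (fst (C ! t)) (snd (C ! t)) * f (fst (C ! t)) (snd (C ! (Suc t mod length C)))"
proof -
  have "snd (C ! t) \<noteq> snd (C ! (Suc t mod length C))"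
    using assms by (subst is_cycle_nth_eq) (auto simp: is_cycle_def Suc_mod_eq)
  then show ?thesis by (simp add: edge_key_def)
qed

lemma prod_Suc_mod2:
  fixes f :: "nat \<Rightarrow> nat \<Rightarrow> 'c :: comm_monoid_mult"
  shows "(\<Prod>t<Suc l. f t (Suc t mod Suc l)) = f l 0 * (\<Prod>t<l. f t (Suc t))"
proof -
  have "(\<Prod>t<Suc l. f t (Suc t mod Suc l)) = (\<Prod>t<l. f t (Suc t mod Suc l)) * f l 0"
    by simp
  also have "(\<Prod>t<l. f t (Suc t mod Suc l)) = (\<Prod>t<l. f t (Suc t))"
    by (intro prod.cong) auto
  finally show ?thesis by (simp add: mult.commute)
qed

text \<open>Reindexing by the end vertex of each step: \<open>last w # w\<close> lists the labels of
  the edges entering the successive positions, just as \<open>w\<close> lists those leaving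
  them.\<close>

lemma prod_cyclic_pred:
  fixes f :: "'l \<Rightarrow> nat \<Rightarrow> 'c :: comm_monoid_mult"
  assumes "w \<noteq> []" "length w = l"
  shows "(\<Prod>t<l. f (w ! t) (x (Suc t mod l))) = (\<Prod>t<l. f ((last w # w) ! t) (x t))"
proof -
  obtain l' where l: "l = Suc l'" using assms by (cases l) auto
  have "w ! l' = last w" using assms l by (simp add: last_conv_nth)
  then show ?thesis
    unfolding l prod_Suc_mod2[of "\<lambda>t s. f (w ! t) (x s)"]
    by (simp add: prod.lessThan_Suc_shift del: prod.lessThan_Suc)
qed

lemma prod_verts: "is_cycle C \<Longrightarrow> (\<Prod>t<length C. f (snd (C ! t))) = (\<Prod>z\<in>verts C. f z)"
  unfolding verts_image by (simp add: prod.reindex inj_on_snd_nth)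

lemma prod_edges: "is_cycle C \<Longrightarrow> (\<Prod>k\<in>edges C. f k) = (\<Prod>t<length C. f (edge_key C t))"
  unfolding edges_def by (simp add: prod.reindex inj_on_edge_key)

text \<open>Every vertex of a cycle lies on exactly two edges.\<close>

lemma prod_edges_verts:
  fixes f :: "nat \<Rightarrow> 'c :: comm_semiring_1"
  assumes "is_cycle C"
  shows "(\<Prod>k\<in>edges C. \<Prod>z\<in>snd k. f z) = (\<Prod>z\<in>verts C. (f z)\<^sup>2)"
proof -
  have ne: "map fst C \<noteq> []" using assms by (auto simp: is_cycle_def)
  have "(\<Prod>k\<in>edges C. \<Prod>z\<in>snd k. f z)
      = (\<Prod>t<length C. f (snd (C ! t))) * (\<Prod>t<length C. f (snd (C ! (Suc t mod length C))))"
    using assms by (simp add: prod_edges prod_edge_key[of C _ "\<lambda>_. f"] prod.distrib)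
  also have "(\<Prod>t<length C. f (snd (C ! (Suc t mod length C)))) = (\<Prod>t<length C. f (snd (C ! t)))"
    using prod_cyclic_pred[OF ne, of "length C" "\<lambda>_. f" "\<lambda>t. snd (C ! t)"] by simp
  finally show ?thesis
    by (simp add: prod_verts[OF assms] power2_eq_square prod.distrib)
qed

section \<open>Overlaps of two cycles\<close>

text \<open>
  The positions at which \<open>D\<close> has an edge and the positions with vertex in \<open>S\<close> cannot coincide: they
  would be closed under the cyclic successor, so that \<open>D\<close> would be everything.
\<close>

lemma card_proper_edges:
  assumes C: "is_cycle C" and D: "D \<subseteq> edges C" "D \<noteq> edges C"
    and S: "S \<inter> verts C \<noteq> {}" "\<And>k. k \<in> D \<Longrightarrow> snd k \<subseteq> S"
  shows "card D < card (S \<inter> verts C)"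
proof (rule ccontr)
  assume ge: "\<not> ?thesis"
  define l where "l = length C"
  define J where "J = {t. t < l \<and> edge_key C t \<in> D}"
  define I where "I = {t. t < l \<and> snd (C ! t) \<in> S}"
  have l: "3 \<le> l" using C by (simp add: is_cycle_def l_def)
  have "D = edge_key C ` J" using D by (auto simp: J_def edges_def l_def)
  moreover have "inj_on (edge_key C) J"
    by (rule inj_on_subset[OF inj_on_edge_key[OF C]]) (auto simp: J_def l_def)
  ultimately have cD: "card D = card J" by (simp add: card_image)
  have "S \<inter> verts C = (\<lambda>t. snd (C ! t)) ` I" by (auto simp: I_def l_def verts_image)
  moreover have "inj_on (\<lambda>t. snd (C ! t)) I"
    by (rule inj_on_subset[OF inj_on_snd_nth[OF C]]) (auto simp: I_def l_def)
  ultimately have cI: "card (S \<inter> verts C) = card I" by (simp add: card_image)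
  have JI: "t \<in> I" "Suc t mod l \<in> I" if "t \<in> J" for t
    using that S(2)[of "edge_key C t"] l by (auto simp: J_def I_def edge_key_def l_def intro!: mod_less_divisor)
  have "J = I"
  proof (rule card_seteq)
    show "finite I" by (simp add: I_def)
    show "J \<subseteq> I" using JI by blast
    show "card I \<le> card J" using ge cD cI by simp
  qed
  have closed: "Suc t mod l \<in> J" if "t \<in> J" for t using JI that \<open>J = I\<close> by blast
  obtain t0 where t0: "t0 \<in> J" using S(1) \<open>J = I\<close> by (auto simp: I_def verts_image l_def)
  have orbit: "(t0 + s) mod l \<in> J" for s
  proof (induction s)
    case 0 then show ?case using t0 by (simp add: J_def)
  next
    case (Suc s) then show ?case using closed[OF Suc] by (simp add: mod_Suc_eq)
  qed
  have "t \<in> J" if "t < l" for t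
  proof -
    \<comment> \<open>From \<open>t0\<close>, the first \<open>l - t0\<close> steps lead to position
      0 and the remaining ones to \<open>t\<close>.\<close>
    have "(t0 + (l - t0 + t)) mod l = t" using t0 that by (simp add: J_def)
    then show ?thesis using orbit[of "l - t0 + t"] by simp
  qed
  then have "edges C \<subseteq> D" by (auto simp: edges_def J_def l_def)
  then show False using D by blast
qed

text \<open>\<open>card_proper_edges\<close> is applied to whichever of the two cycles has an edge
  outside the other. This strict inequality is the source of the additional factor
  \<open>1 / N\<close> in the variance.\<close>

lemma card_common_edges:
  assumes "is_cycle C" "is_cycle C'" "edges C \<noteq> edges C'" "verts C \<inter> verts C' \<noteq> {}"
  shows "card (edges C \<inter> edges C') < card (verts C \<inter> verts C')"
proof (cases "edges C \<inter> edges C' = edges C")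
  case False
  show ?thesis
    using card_proper_edges[OF assms(1), of "edges C \<inter> edges C'" "verts C'"] False assms(4)
      edges_verts[of _ C'] by (auto simp: Int_commute)
next
  case True
  then have "edges C \<inter> edges C' \<noteq> edges C'" using assms(3) by blast
  then show ?thesis
    using card_proper_edges[OF assms(2), of "edges C \<inter> edges C'" "verts C"] assms(4)
      edges_verts[of _ C] by auto
qed

text \<open>The first two vertices fix the starting point and the direction; from there on, the
  edges leave no choice for the next vertex.\<close>

lemma cycle_eqI:
  assumes C: "is_cycle C" and C': "is_cycle C'" and e: "edges C = edges C'"
    and s: "snd (C ! 0) = snd (C' ! 0)" "snd (C ! 1) = snd (C' ! 1)"
  shows "C = C'"
proof -
  define l where "l = length C"
  have l': "length C' = l" using card_edges[OF C] card_edges[OF C'] e by (simp add: l_def)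
  have l3: "3 \<le> l" using C by (simp add: is_cycle_def l_def)
  have vert: "snd (C ! t) = snd (C' ! t)" if "t < l" for t
    using that
  proof (induction t rule: less_induct)
    case (less t)
    consider "t = 0" | "t = 1" | u where "t = Suc (Suc u)"
      by (metis One_nat_def old.nat.exhaust)
    then show ?case
    proof cases
      case 3
      \<comment> \<open>The edge of \<open>C'\<close> leaving position \<open>Suc u\<close> is an
        edge of \<open>C\<close> at the same vertex, so in \<open>C\<close> it sits at position
        \<open>Suc u\<close> or at position \<open>u\<close>.\<close>
      have "edge_key C' (Suc u) \<in> edges C"
        using less.prems 3 l' unfolding e by (auto simp: edges_def)
      then obtain v where v: "v < l" "edge_key C v = edge_key C' (Suc u)"
        by (auto simp: edges_def l_def)
      have k': "snd (edge_key C' (Suc u)) = {snd (C' ! Suc u), snd (C' ! t)}"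
        using 3 less.prems by (simp add: edge_key_def l')
      have eq: "snd (C' ! Suc u) = snd (C ! Suc u)" "snd (C' ! u) = snd (C ! u)"
        using less 3 by auto
      have "Suc u = v \<or> Suc u = Suc v mod l"
        using nth_in_edge_key[OF C, of v "Suc u"] v k' eq less.prems 3 by (simp add: l_def)
      then have "v = Suc u \<or> v = u"
        using v(1) by (auto simp: Suc_mod_eq split: if_splits)
      then show ?thesis
      proof
        assume "v = Suc u"
        then have "{snd (C ! Suc u), snd (C ! t)} = {snd (C' ! Suc u), snd (C' ! t)}"
          using v k' 3 less.prems by (simp add: edge_key_def l_def)
        then show ?thesis using eq by (auto simp: doubleton_eq_iff)
      next
        \<comment> \<open>In this case \<open>C'\<close> would step back to its own vertex at
          position \<open>u\<close>.\<close>
        assume "v = u"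
        then have "{snd (C ! u), snd (C ! Suc u)} = {snd (C' ! Suc u), snd (C' ! t)}"
          using v k' 3 less.prems by (simp add: edge_key_def l_def)
        then have "snd (C' ! u) = snd (C' ! t) \<or> snd (C' ! u) = snd (C' ! Suc u)"
          using eq by (auto simp: doubleton_eq_iff)
        then show ?thesis
          using is_cycle_nth_eq[OF C', of u t] is_cycle_nth_eq[OF C', of u "Suc u"] less.prems 3 l'
          by auto
      qed
    qed (use s in auto)
  qed
  have label: "fst (C ! t) = fst (C' ! t)" if "t < l" for t
  proof -
    have "edge_key C' t \<in> edges C" using that l' unfolding e by (auto simp: edges_def)
    then obtain v where v: "v < l" "edge_key C v = edge_key C' t"
      by (auto simp: edges_def l_def)
    have "Suc t mod l < l" using l3 by (auto intro!: mod_less_divisor)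
    then have "snd (edge_key C' t) = snd (edge_key C t)"
      using vert that by (simp add: edge_key_def l' l_def[symmetric])
    then have "v = t" using snd_edge_key_eq[OF C, of v t] v that by (simp add: l_def)
    then show ?thesis using v by (simp add: edge_key_def)
  qed
  show ?thesis
    by (rule nth_equalityI) (use vert label l' in \<open>auto simp: l_def prod_eq_iff\<close>)
qed

text \<open>By \<open>cycle_eqI\<close> such a cycle is determined by its first two vertices, which
  are vertices of \<open>C\<close>. These coincidences therefore cost only a factor polynomial in
  the length, which an exponential gain in J can absorb.\<close>

lemma card_equal_edges:
  assumes C: "is_cycle C" and I: "\<And>C'. C' \<in> I \<Longrightarrow> is_cycle C'"
  shows "card {C' \<in> I. edges C' = edges C} \<le> (length C)\<^sup>2"
proof -
  let ?f = "\<lambda>C' :: walk. (snd (C' ! 0), snd (C' ! 1))"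
  have v: "verts D \<subseteq> verts C" if "D \<in> I" "edges D = edges C" for D
  proof
    fix z assume "z \<in> verts D"
    then obtain t where "t < length D" "z = snd (D ! t)" by (auto simp: verts_image)
    then have "edge_key D t \<in> edges C" "z \<in> snd (edge_key D t)" using that by (auto simp: edges_def edge_key_def)
    then show "z \<in> verts C" using edges_verts by blast
  qed
  have "card {C' \<in> I. edges C' = edges C} \<le> card (verts C \<times> verts C)"
  proof (rule card_inj_on_le)
    show "inj_on ?f {C' \<in> I. edges C' = edges C}"
      by (auto simp: inj_on_def intro: cycle_eqI I)
    show "?f ` {C' \<in> I. edges C' = edges C} \<subseteq> verts C \<times> verts C"
    proof safe
      fix D assume D: "D \<in> I" "edges D = edges C"
      have "3 \<le> length D" using I[OF D(1)] by (simp add: is_cycle_def)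
      then show "snd (D ! 0) \<in> verts C" "snd (D ! 1) \<in> verts C"
        using v[OF D] snd_nth_in_verts[of _ D] by (force simp: subset_iff)+
    qed
  qed simp
  then show ?thesis by (simp add: card_verts[OF C] power2_eq_square card_cartesian_product)
qed

text \<open>Distributivity. It serves twice: it counts weighted walks in
  \<open>sum_walks_le\<close>, and it turns sums over block lists into J-th powers.\<close>

lemma sum_lists_prod:
  fixes f :: "'c \<Rightarrow> 'd :: comm_semiring_1"
  assumes "finite A"
  shows "(\<Sum>xs\<in>{xs. set xs \<subseteq> A \<and> length xs = l}. prod_list (map f xs)) = (\<Sum>a\<in>A. f a) ^ l"
proof (induction l)
  case 0
  have "{xs. set xs \<subseteq> A \<and> length xs = 0} = {[]}" by auto
  then show ?case by simp
next
  case (Suc l)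
  have "{xs. set xs \<subseteq> A \<and> length xs = Suc l}
      = (\<lambda>(a, xs). a # xs) ` (A \<times> {xs. set xs \<subseteq> A \<and> length xs = l})"
    by (auto simp: length_Suc_conv image_iff)
  moreover have "inj_on (\<lambda>(a, xs). a # xs) (A \<times> {xs. set xs \<subseteq> A \<and> length xs = l})"
    by (auto simp: inj_on_def)
  ultimately have "(\<Sum>xs\<in>{xs. set xs \<subseteq> A \<and> length xs = Suc l}. prod_list (map f xs))
      = (\<Sum>(a, xs)\<in>A \<times> {xs. set xs \<subseteq> A \<and> length xs = l}. f a * prod_list (map f xs))"
    by (simp add: sum.reindex case_prod_beta[abs_def])
  also have "\<dots> = (\<Sum>a\<in>A. f a) * (\<Sum>a\<in>A. f a) ^ l"
    unfolding Suc.IH[symmetric] sum_product by (simp add: sum.cartesian_product)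
  finally show ?case by simp
qed

section \<open>Independence\<close>

text \<open>A finite intersection of events of the combined family is a rectangle
  \<open>a \<times> b\<close>, whose product measure factorises; independence within each factor
  does the rest.\<close>

lemma indep_vars_pair_measure:
  assumes P1: "prob_space M1" and P2: "prob_space M2"
    and X: "prob_space.indep_vars M1 M' X I" and Y: "prob_space.indep_vars M2 M' Y J"
    and disj: "I \<inter> J = {}"
  shows "prob_space.indep_vars (M1 \<Otimes>\<^sub>M M2) M'
    (\<lambda>i \<omega>. if i \<in> I then X i (fst \<omega>) else Y i (snd \<omega>)) (I \<union> J)"
proof -
  interpret M1: prob_space M1 by fact
  interpret M2: prob_space M2 by fact
  interpret P: pair_prob_space M1 M2 ..
  let ?W = "\<lambda>i \<omega>. if i \<in> I then X i (fst \<omega>) else Y i (snd \<omega>)"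
  have rvX: "X i \<in> measurable M1 (M' i)" if "i \<in> I" for i
    using X that by (auto simp: M1.indep_vars_def)
  have rvY: "Y i \<in> measurable M2 (M' i)" if "i \<in> J" for i
    using Y that by (auto simp: M2.indep_vars_def)
  have rv: "?W i \<in> measurable (M1 \<Otimes>\<^sub>M M2) (M' i)" if "i \<in> I \<union> J" for i
  proof (cases "i \<in> I")
    case True
    then show ?thesis using measurable_compose[OF measurable_fst rvX] by simp
  next
    case False
    then show ?thesis using measurable_compose[OF measurable_snd rvY] that by simp
  qed
  show ?thesis
    unfolding P.P.indep_vars_def2
  proof (intro conjI ballI rv P.P.indep_setsI)
    fix i assume i: "i \<in> I \<union> J"
    then show "{?W i -` A \<inter> space (M1 \<Otimes>\<^sub>M M2) |A. A \<in> sets (M' i)} \<subseteq> P.P.events"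
      using measurable_sets[OF rv[OF i]] by auto
  next
    fix A K assume K: "K \<noteq> {}" "K \<subseteq> I \<union> J" "finite K"
      and AB: "\<forall>j\<in>K. A j \<in> {?W j -` A \<inter> space (M1 \<Otimes>\<^sub>M M2) |A. A \<in> sets (M' j)}"
    have "\<forall>j\<in>K. \<exists>C. C \<in> sets (M' j) \<and> A j = ?W j -` C \<inter> space (M1 \<Otimes>\<^sub>M M2)"
    proof
      fix j assume "j \<in> K"
      with AB have "A j \<in> {?W j -` A \<inter> space (M1 \<Otimes>\<^sub>M M2) |A. A \<in> sets (M' j)}" by (rule bspec)
      then show "\<exists>C. C \<in> sets (M' j) \<and> A j = ?W j -` C \<inter> space (M1 \<Otimes>\<^sub>M M2)" by blast
    qed
    from bchoice[OF this] obtain B where B': "\<forall>j\<in>K. B j \<in> sets (M' j) \<and> A j = ?W j -` B j \<inter> space (M1 \<Otimes>\<^sub>M M2)" ..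
    have B: "\<And>j. j \<in> K \<Longrightarrow> B j \<in> sets (M' j)"
      "\<And>j. j \<in> K \<Longrightarrow> A j = ?W j -` B j \<inter> space (M1 \<Otimes>\<^sub>M M2)"
      using bspec[OF B'] by simp_all
    \<comment> \<open>The intersection with the whole space matters when no index of
      \<open>K\<close> lies in \<open>I\<close>: the empty intersection alone would be the whole
      type.\<close>
    define a where "a = (\<Inter>j\<in>K \<inter> I. X j -` B j \<inter> space M1) \<inter> space M1"
    define b where "b = (\<Inter>j\<in>K - I. Y j -` B j \<inter> space M2) \<inter> space M2"
    have eX: "X j -` B j \<inter> space M1 \<in> sets M1" if "j \<in> K \<inter> I" for j
      using measurable_sets[OF rvX B(1)] that by auto
    have eY: "Y j -` B j \<inter> space M2 \<in> sets M2" if "j \<in> K - I" for j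
      using measurable_sets[OF rvY B(1)] that K by auto
    have pa: "M1.prob a = (\<Prod>j\<in>K \<inter> I. M1.prob (X j -` B j \<inter> space M1))"
    proof (cases "K \<inter> I = {}")
      case True then show ?thesis unfolding True a_def by (simp add: M1.prob_space)
    next
      case False
      then have "a = (\<Inter>j\<in>K \<inter> I. X j -` B j \<inter> space M1)" by (auto simp: a_def)
      then show ?thesis using M1.indep_varsD[OF X False] B(1) K by auto
    qed
    have pb: "M2.prob b = (\<Prod>j\<in>K - I. M2.prob (Y j -` B j \<inter> space M2))"
    proof (cases "K - I = {}")
      case True then show ?thesis unfolding True b_def by (simp add: M2.prob_space)
    next
      case False
      then have b: "b = (\<Inter>j\<in>K - I. Y j -` B j \<inter> space M2)" by (auto simp: b_def)
      show ?thesis unfolding b by (rule M2.indep_varsD[OF Y False]) (use B(1) K in auto)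
    qed
    have ab: "a \<in> sets M1" "b \<in> sets M2"
    proof -
      show "a \<in> sets M1"
      proof (cases "K \<inter> I = {}")
        case False
        then show ?thesis unfolding a_def using K(3) by (intro sets.Int sets.finite_INT eX) auto
      qed (simp add: a_def)
      show "b \<in> sets M2"
      proof (cases "K - I = {}")
        case True
        then show ?thesis unfolding b_def True by simp
      next
        case False
        then show ?thesis unfolding b_def using K(3) by (intro sets.Int sets.finite_INT eY) auto
      qed
    qed
    have prod: "P.P.prob (c \<times> d) = M1.prob c * M2.prob d" if "c \<in> sets M1" "d \<in> sets M2" for c d
      using that by (simp add: measure_def M2.emeasure_pair_measure_Times enn2real_mult)
    have Aj1: "A j = (X j -` B j \<inter> space M1) \<times> space M2" if "j \<in> K \<inter> I" for j
      using B(2)[of j] that by (auto simp: space_pair_measure)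
    have Aj2: "A j = space M1 \<times> (Y j -` B j \<inter> space M2)" if "j \<in> K - I" for j
      using B(2)[of j] that by (auto simp: space_pair_measure)
    have Asp: "A j \<subseteq> space M1 \<times> space M2" if "j \<in> K" for j
      unfolding B(2)[OF that] space_pair_measure by (rule Int_lower2)
    have "(\<Inter>j\<in>K. A j) = a \<times> b"
    proof (rule set_eqI)
      fix x
      have "x \<in> (\<Inter>j\<in>K. A j) \<longleftrightarrow>
          (\<forall>j\<in>K \<inter> I. x \<in> A j) \<and> (\<forall>j\<in>K - I. x \<in> A j) \<and> x \<in> space M1 \<times> space M2"
        using K(1) Asp by blast
      also have "\<dots> \<longleftrightarrow> (\<forall>j\<in>K \<inter> I. fst x \<in> X j -` B j \<inter> space M1) \<and>
          (\<forall>j\<in>K - I. snd x \<in> Y j -` B j \<inter> space M2) \<and> fst x \<in> space M1 \<and> snd x \<in> space M2"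
        unfolding mem_Times_iff
        by (intro iffI conjI ballI; elim conjE; simp add: Aj1 Aj2 mem_Times_iff)
      also have "\<dots> \<longleftrightarrow> x \<in> a \<times> b"
        unfolding mem_Times_iff a_def b_def by blast
      finally show "x \<in> (\<Inter>j\<in>K. A j) \<longleftrightarrow> x \<in> a \<times> b" .
    qed
    then have "P.P.prob (\<Inter>j\<in>K. A j) = M1.prob a * M2.prob b" using prod ab by simp
    also have "\<dots> = (\<Prod>j\<in>K \<inter> I. P.P.prob (A j)) * (\<Prod>j\<in>K - I. P.P.prob (A j))"
      unfolding pa pb
      by (intro arg_cong2[of _ _ _ _ "(*)"] prod.cong refl)
        (simp_all add: Aj1 Aj2 prod eX eY M1.prob_space M2.prob_space)
    also have "\<dots> = (\<Prod>j\<in>K. P.P.prob (A j))"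
      using prod.Int_Diff[OF K(3)] by metis
    finally show "P.P.prob (\<Inter>j\<in>K. A j) = (\<Prod>j\<in>K. P.P.prob (A j))" .
  qed
qed

lemma indep_vars_distr:
  assumes P: "prob_space M" and T: "T \<in> measurable M N"
    and ind: "prob_space.indep_vars M M' (\<lambda>i \<omega>. X i (T \<omega>)) I"
    and rv: "\<And>i. i \<in> I \<Longrightarrow> X i \<in> measurable N (M' i)"
  shows "prob_space.indep_vars (distr M N T) M' X I"
proof -
  interpret prob_space M by fact
  interpret D: prob_space "distr M N T" by (rule prob_space_distr[OF T])
  show ?thesis
    unfolding D.indep_vars_def2
  proof (intro conjI ballI D.indep_setsI)
    fix i assume i: "i \<in> I"
    show "X i \<in> measurable (distr M N T) (M' i)" using rv[OF i] by simp
    show "{X i -` A \<inter> space (distr M N T) |A. A \<in> sets (M' i)} \<subseteq> D.events"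
      using measurable_sets[OF rv[OF i]] by auto
  next
    fix A K assume K: "K \<noteq> {}" "K \<subseteq> I" "finite K"
      and AB: "\<forall>j\<in>K. A j \<in> {X j -` A \<inter> space (distr M N T) |A. A \<in> sets (M' j)}"
    have "\<forall>j\<in>K. \<exists>C. C \<in> sets (M' j) \<and> A j = X j -` C \<inter> space (distr M N T)"
    proof
      fix j assume "j \<in> K"
      with AB have "A j \<in> {X j -` A \<inter> space (distr M N T) |A. A \<in> sets (M' j)}" by (rule bspec)
      then show "\<exists>C. C \<in> sets (M' j) \<and> A j = X j -` C \<inter> space (distr M N T)" by blast
    qed
    from bchoice[OF this] obtain B where B': "\<forall>j\<in>K. B j \<in> sets (M' j) \<and> A j = X j -` B j \<inter> space (distr M N T)" ..
    have B: "\<And>j. j \<in> K \<Longrightarrow> B j \<in> sets (M' j)"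
      "\<And>j. j \<in> K \<Longrightarrow> A j = X j -` B j \<inter> space N"
      using bspec[OF B'] by simp_all
    have A: "A j \<in> sets N" if "j \<in> K" for j
      using B(2)[OF that] measurable_sets[OF rv B(1)] that K by auto
    have eq: "T -` A j \<inter> space M = (\<lambda>\<omega>. X j (T \<omega>)) -` B j \<inter> space M" if "j \<in> K" for j
      using B(2)[OF that] measurable_space[OF T] by auto
    have "D.prob (\<Inter>j\<in>K. A j) = prob (T -` (\<Inter>j\<in>K. A j) \<inter> space M)"
      using A K by (intro measure_distr T) auto
    also have "T -` (\<Inter>j\<in>K. A j) \<inter> space M = (\<Inter>j\<in>K. (\<lambda>\<omega>. X j (T \<omega>)) -` B j \<inter> space M)"
    proof -
      have "T -` (\<Inter>j\<in>K. A j) \<inter> space M = (\<Inter>j\<in>K. T -` A j \<inter> space M)" using K(1) by auto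
      then show ?thesis using eq by simp
    qed
    also have "prob \<dots> = (\<Prod>j\<in>K. prob ((\<lambda>\<omega>. X j (T \<omega>)) -` B j \<inter> space M))"
      by (rule indep_varsD[OF ind K(1,3,2) B(1)])
    also have "\<dots> = (\<Prod>j\<in>K. D.prob (A j))"
      by (intro prod.cong refl) (simp add: eq[symmetric] measure_distr[OF T A])
    finally show "D.prob (\<Inter>j\<in>K. A j) = (\<Prod>j\<in>K. D.prob (A j))" .
  qed
qed

lemma indep_vars_PiM_components:
  assumes D: "\<And>i. i \<in> I \<Longrightarrow> prob_space (D i)" and M': "\<And>i. i \<in> I \<Longrightarrow> sets (M' i) = sets (D i)"
    and fin: "finite I"
  shows "prob_space.indep_vars (PiM I D) M' (\<lambda>i \<omega>. \<omega> i) I"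
proof -
  \<comment> \<open>\<open>product_prob_space\<close> wants a probability measure at every index, so
    \<open>D\<close> is continued by a point mass outside \<open>I\<close>.\<close>
  define D' where "D' i = (if i \<in> I then D i else return (count_space {undefined}) undefined)" for i
  have PD: "PiM I D = PiM I D'" by (intro PiM_cong) (auto simp: D'_def)
  have D': "prob_space (D' i)" for i
    using D by (auto simp: D'_def intro!: prob_space_return)
  interpret product_prob_space D' I by (rule product_prob_spaceI) (rule D')
  interpret PI: prob_space "PiM I D" by (rule prob_space_PiM[OF D])
  show ?thesis
    unfolding PI.indep_vars_def2
  proof (intro conjI ballI PI.indep_setsI)
    fix i assume i: "i \<in> I"
    have "(\<lambda>\<omega>. \<omega> i) \<in> measurable (PiM I D) (D i)" using i by simp
    then show rv: "(\<lambda>\<omega>. \<omega> i) \<in> measurable (PiM I D) (M' i)"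
      using M'[OF i] by (simp cong: measurable_cong_sets)
    show "{(\<lambda>\<omega>. \<omega> i) -` A \<inter> space (PiM I D) |A. A \<in> sets (M' i)} \<subseteq> PI.events"
      using measurable_sets[OF rv] by auto
  next
    fix A K assume K: "K \<noteq> {}" "K \<subseteq> I" "finite K"
      and AB: "\<forall>j\<in>K. A j \<in> {(\<lambda>\<omega>. \<omega> j) -` A \<inter> space (PiM I D) |A. A \<in> sets (M' j)}"
    have "\<forall>j\<in>K. \<exists>C. C \<in> sets (M' j) \<and> A j = (\<lambda>\<omega>. \<omega> j) -` C \<inter> space (PiM I D)"
    proof
      fix j assume "j \<in> K"
      with AB have "A j \<in> {(\<lambda>\<omega>. \<omega> j) -` A \<inter> space (PiM I D) |A. A \<in> sets (M' j)}" by (rule bspec)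
      then show "\<exists>C. C \<in> sets (M' j) \<and> A j = (\<lambda>\<omega>. \<omega> j) -` C \<inter> space (PiM I D)" by blast
    qed
    from bchoice[OF this] obtain B where B': "\<forall>j\<in>K. B j \<in> sets (M' j) \<and> A j = (\<lambda>\<omega>. \<omega> j) -` B j \<inter> space (PiM I D)" ..
    have B: "\<And>j. j \<in> K \<Longrightarrow> B j \<in> sets (M' j)"
      "\<And>j. j \<in> K \<Longrightarrow> A j = (\<lambda>\<omega>. \<omega> j) -` B j \<inter> space (PiM I D)"
      using bspec[OF B'] by simp_all
    have BD: "B j \<in> sets (D' j)" if "j \<in> K" for j using B(1)[OF that] M' that K by (auto simp: D'_def)
    have one: "PI.prob (A j) = measure (D' j) (B j)" if j: "j \<in> K" for j
    proof -
      have "A j = {\<omega> \<in> space (PiM I D'). \<forall>i\<in>{j}. \<omega> i \<in> B i}"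
        using B(2)[OF j] by (auto simp: PD)
      then show ?thesis using emeasure_PiM_Collect[of "{j}" B] BD j K subsetD[OF K(2) j]
        by (simp add: PD measure_def)
    qed
    have "(\<Inter>j\<in>K. A j) = {\<omega> \<in> space (PiM I D'). \<forall>i\<in>K. \<omega> i \<in> B i}"
      using B(2) K(1) by (auto simp: PD)
    then have "PI.prob (\<Inter>j\<in>K. A j) = (\<Prod>j\<in>K. measure (D' j) (B j))"
      using emeasure_PiM_Collect[of K B] BD K
      by (simp add: PD measure_def[of "PiM I D'"] M.emeasure_eq_measure prod_ennreal prod_nonneg)
    then show "PI.prob (\<Inter>j\<in>K. A j) = (\<Prod>j\<in>K. PI.prob (A j))" using one by simp
  qed
qed

section \<open>Spiked arrays\<close>

definition proj :: "bool \<Rightarrow> real \<times> real \<Rightarrow> real" where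
  "proj l p = (if l then fst p else snd p)"

lemma measurable_proj [measurable]: "proj l \<in> borel_measurable (borel \<Otimes>\<^sub>M borel)"
  by (cases l) (simp_all add: proj_def[abs_def])

text \<open>
  All entries are multiplied by \<open>sqrt N\<close>: with \<open>N = n\<close> (Wigner) or \<open>N = m\<close> (Wishart), the noise \<open>Z\<close> has
  unit variance, the spike coordinates \<open>xi\<close> have unit variance and the signal is
  \<open>gam l \<cdot> xi x \<cdot> xi y / sqrt N\<close>, where \<open>gam\<close> is \<open>\<alpha>\<close> or \<open>sqrt \<alpha>\<close>, respectively.  In the Wishart model
  rows and columns are both vertices, and \<open>r x\<close> is \<open>0\<close> at rows.
\<close>

locale spiked = P: prob_space P + Q: prob_space Q
  for P :: "'a measure" and Q :: "'b measure" +
  fixes xi :: "bool \<Rightarrow> nat \<Rightarrow> 'a \<Rightarrow> real" and Z :: "bool \<times> nat set \<Rightarrow> 'b \<Rightarrow> real"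
    and V :: "nat set" and E0 :: "(bool \<times> nat set) set"
    and gam :: "bool \<Rightarrow> real" and r :: "nat \<Rightarrow> real" and N g K :: real
  assumes finite_V: "finite V"
    and indep_xi: "P.indep_vars (\<lambda>_. borel \<Otimes>\<^sub>M borel) (\<lambda>x \<omega>. (xi True x \<omega>, xi False x \<omega>)) V"
    and indep_Z: "Q.indep_vars (\<lambda>_. borel) Z E0"
    and E0: "\<And>k. k \<in> E0 \<Longrightarrow> snd k \<subseteq> V"
    and xi_square: "\<And>x l. x \<in> V \<Longrightarrow> (\<integral>\<omega>. xi l x \<omega> * xi l x \<omega> \<partial>P) = 1"
    and xi_cross: "\<And>x. x \<in> V \<Longrightarrow> (\<integral>\<omega>. xi True x \<omega> * xi False x \<omega> \<partial>P) = r x"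
    and Phi_integrable: "\<And>x p. x \<in> V \<Longrightarrow>
        integrable P (\<lambda>\<omega>. (1 + (xi True x \<omega>)\<^sup>2 + (xi False x \<omega>)\<^sup>2) ^ p)"
    and Phi_fourth: "\<And>x. x \<in> V \<Longrightarrow> (\<integral>\<omega>. (1 + (xi True x \<omega>)\<^sup>2 + (xi False x \<omega>)\<^sup>2) ^ 4 \<partial>P) \<le> K"
    and Z_integrable: "\<And>k. k \<in> E0 \<Longrightarrow> integrable Q (Z k)"
      "\<And>k. k \<in> E0 \<Longrightarrow> integrable Q (\<lambda>\<eta>. (Z k \<eta>)\<^sup>2)"
    and Z_moments: "\<And>k. k \<in> E0 \<Longrightarrow> (\<integral>\<eta>. Z k \<eta> \<partial>Q) = 0"
      "\<And>k. k \<in> E0 \<Longrightarrow> (\<integral>\<eta>. (Z k \<eta>)\<^sup>2 \<partial>Q) = 1"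
    and gam: "\<And>l. 0 \<le> gam l" "\<And>l. gam l \<le> g"
    and r: "\<And>x. 0 \<le> r x"
    and g: "1 \<le> g" and N: "1 \<le> N" and K: "1 \<le> K"
begin

text \<open>One envelope for single coordinates and for products of two. In a product over two
  cycles a vertex is met by at most four edges, two from each, which is why the fourth moment is the
  one controlled by \<open>K\<close>.\<close>

definition Phi :: "nat \<Rightarrow> 'a \<Rightarrow> real" where
  "Phi x \<omega> = 1 + (xi True x \<omega>)\<^sup>2 + (xi False x \<omega>)\<^sup>2"

definition signal :: "bool \<times> nat set \<Rightarrow> 'a \<Rightarrow> real" where
  "signal k \<omega> = gam (fst k) / sqrt N * (\<Prod>z\<in>snd k. xi (fst k) z \<omega>)"

definition X :: "bool \<times> nat set \<Rightarrow> 'a \<times> 'b \<Rightarrow> real" where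
  "X k w = signal k (fst w) + Z k (snd w)"

definition cycle_prod :: "walk \<Rightarrow> 'a \<times> 'b \<Rightarrow> real" where
  "cycle_prod C w = (\<Prod>k\<in>edges C. X k w)"

definition vertex_corr :: "nat \<Rightarrow> bool \<Rightarrow> bool \<Rightarrow> real" where
  "vertex_corr x l l' = (if l = l' then 1 else r x)"

text \<open>Each vertex meets one entering and one leaving edge and contributes the correlation of
  the two spike coordinates concerned; \<open>last\<close> supplies the edge that closes the
  cycle.\<close>

definition mean :: "walk \<Rightarrow> real" where
  "mean C = (\<Prod>t<length C. gam (fst (C ! t)) / sqrt N) *
     (\<Prod>t<length C. vertex_corr (snd (C ! t)) ((last (map fst C) # map fst C) ! t) (fst (C ! t)))"

lemma mean_nonneg: "0 \<le> mean C"
  unfolding mean_def vertex_corr_def using gam N r by (auto intro!: mult_nonneg_nonneg prod_nonneg)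

lemma Phi_ge_1: "1 \<le> Phi x \<omega>"
  by (simp add: Phi_def)

lemma abs_xi_le_Phi: "\<bar>xi l x \<omega>\<bar> \<le> Phi x \<omega>"
proof -
  have "\<bar>a\<bar> \<le> 1 + a\<^sup>2" for a :: real
    using zero_le_power2[of "\<bar>a\<bar> - 1 / 2"] by (simp add: power2_diff power_divide)
  from this[of "xi l x \<omega>"] have "\<bar>xi l x \<omega>\<bar> \<le> 1 + (xi l x \<omega>)\<^sup>2" .
  moreover have "(xi l x \<omega>)\<^sup>2 \<le> (xi True x \<omega>)\<^sup>2 + (xi False x \<omega>)\<^sup>2" by (cases l) simp_all
  ultimately show ?thesis unfolding Phi_def by linarith
qed

lemma abs_xi_xi_le_Phi: "\<bar>xi l x \<omega> * xi l' x \<omega>\<bar> \<le> Phi x \<omega>"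
proof (cases "l = l'")
  case True
  then show ?thesis
    using zero_le_power2[of "xi True x \<omega>"] zero_le_power2[of "xi False x \<omega>"]
    unfolding Phi_def by (cases l) (simp_all add: power2_eq_square)
next
  case False
  have "\<bar>a * b\<bar> \<le> 1 + a\<^sup>2 + b\<^sup>2" for a b :: real
  proof -
    have "2 * (\<bar>a\<bar> * \<bar>b\<bar>) \<le> a\<^sup>2 + b\<^sup>2"
      using sum_squares_bound[of "\<bar>a\<bar>" "\<bar>b\<bar>"] by (simp add: mult.assoc)
    moreover have "0 \<le> \<bar>a\<bar> * \<bar>b\<bar>" by simp
    ultimately show ?thesis unfolding abs_mult by linarith
  qed
  from this[of "xi True x \<omega>" "xi False x \<omega>"] show ?thesis
    using False unfolding Phi_def by (cases l) (auto simp: mult.commute)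
qed

lemma xi_measurable: "x \<in> V \<Longrightarrow> xi l x \<in> borel_measurable P"
proof -
  assume "x \<in> V"
  then have "(\<lambda>\<omega>. (xi True x \<omega>, xi False x \<omega>)) \<in> measurable P (borel \<Otimes>\<^sub>M borel)"
    using indep_xi by (auto simp: P.indep_vars_def)
  from measurable_compose[OF this measurable_proj[of l]] show ?thesis
    by (cases l) (simp_all add: proj_def)
qed

lemma Z_measurable: "k \<in> E0 \<Longrightarrow> Z k \<in> borel_measurable Q"
  using Z_integrable by auto

lemma signal_measurable: "k \<in> E0 \<Longrightarrow> signal k \<in> borel_measurable P"
  unfolding signal_def[abs_def]
  using xi_measurable E0[of k] by (intro borel_measurable_times borel_measurable_const borel_measurable_prod) auto

lemma X_measurable: "k \<in> E0 \<Longrightarrow> X k \<in> borel_measurable (P \<Otimes>\<^sub>M Q)"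
  unfolding X_def[abs_def]
  by (intro borel_measurable_add measurable_compose[OF measurable_fst] measurable_compose[OF measurable_snd]
      signal_measurable Z_measurable)

lemma
  assumes S: "S \<subseteq> V" and f: "\<And>x. x \<in> S \<Longrightarrow> f x \<in> borel_measurable (borel \<Otimes>\<^sub>M borel)"
    and int: "\<And>x. x \<in> S \<Longrightarrow> integrable P (\<lambda>\<omega>. f x (xi True x \<omega>, xi False x \<omega>))"
  shows integrable_prod_xi: "integrable P (\<lambda>\<omega>. \<Prod>x\<in>S. f x (xi True x \<omega>, xi False x \<omega>) :: real)"
    and integral_prod_xi: "(\<integral>\<omega>. (\<Prod>x\<in>S. f x (xi True x \<omega>, xi False x \<omega>)) \<partial>P)
      = (\<Prod>x\<in>S. \<integral>\<omega>. f x (xi True x \<omega>, xi False x \<omega>) \<partial>P)"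
proof -
  have fin: "finite S" using S finite_V by (rule finite_subset)
  have "P.indep_vars (\<lambda>_. borel) (\<lambda>x \<omega>. f x (xi True x \<omega>, xi False x \<omega>)) S"
    by (rule P.indep_vars_compose2[OF P.indep_vars_subset[OF indep_xi S]]) (rule f)
  from P.indep_vars_integrable[OF fin this int] P.indep_vars_lebesgue_integral[OF fin this int]
  show "integrable P (\<lambda>\<omega>. \<Prod>x\<in>S. f x (xi True x \<omega>, xi False x \<omega>) :: real)"
    "(\<integral>\<omega>. (\<Prod>x\<in>S. f x (xi True x \<omega>, xi False x \<omega>)) \<partial>P)
      = (\<Prod>x\<in>S. \<integral>\<omega>. f x (xi True x \<omega>, xi False x \<omega>) \<partial>P)" by auto
qed

lemma
  assumes S: "S \<subseteq> V"
  shows integrable_prod_Phi: "integrable P (\<lambda>\<omega>. \<Prod>x\<in>S. Phi x \<omega> ^ p)"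
    and integral_prod_Phi: "(\<integral>\<omega>. (\<Prod>x\<in>S. Phi x \<omega> ^ 4) \<partial>P) \<le> K ^ card S"
proof -
  let ?f = "\<lambda>p :: nat. \<lambda>y :: real \<times> real. (1 + (fst y)\<^sup>2 + (snd y)\<^sup>2) ^ p"
  have m: "?f p \<in> borel_measurable (borel \<Otimes>\<^sub>M borel)" for p by measurable
  have i: "integrable P (\<lambda>\<omega>. ?f p (xi True x \<omega>, xi False x \<omega>))" if "x \<in> S" for x p
    using Phi_integrable[of x p] S that by auto
  show "integrable P (\<lambda>\<omega>. \<Prod>x\<in>S. Phi x \<omega> ^ p)"
    using integrable_prod_xi[OF S, of "\<lambda>_. ?f p", OF m i] by (simp add: Phi_def)
  have "(\<integral>\<omega>. (\<Prod>x\<in>S. Phi x \<omega> ^ 4) \<partial>P) = (\<Prod>x\<in>S. \<integral>\<omega>. Phi x \<omega> ^ 4 \<partial>P)"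
    using integral_prod_xi[OF S, of "\<lambda>_. ?f 4", OF m i] by (simp add: Phi_def)
  also have "\<dots> \<le> (\<Prod>x\<in>S. K)"
    using Phi_fourth S by (intro prod_mono) (auto simp: Phi_def intro!: integral_nonneg_AE)
  finally show "(\<integral>\<omega>. (\<Prod>x\<in>S. Phi x \<omega> ^ 4) \<partial>P) \<le> K ^ card S" by simp
qed

text \<open>Bounds \<open>sqrt N\<close> times the signal. Being at least 1, it may also be raised
  to a larger power or inserted where no signal occurs.\<close>

definition edge_bound :: "bool \<times> nat set \<Rightarrow> 'a \<Rightarrow> real" where
  "edge_bound k \<omega> = g * (\<Prod>z\<in>snd k. Phi z \<omega>)"

lemma edge_bound_ge_1: "1 \<le> edge_bound k \<omega>"
  unfolding edge_bound_def using g mult_mono[of 1 g 1 "\<Prod>z\<in>snd k. Phi z \<omega>"] prod_ge_1[of "snd k" "\<lambda>z. Phi z \<omega>"] Phi_ge_1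
  by auto

lemma signal_le_edge_bound: "\<bar>signal k \<omega>\<bar> \<le> edge_bound k \<omega> / sqrt N"
proof -
  have "\<bar>\<Prod>z\<in>snd k. xi (fst k) z \<omega>\<bar> \<le> (\<Prod>z\<in>snd k. Phi z \<omega>)"
    unfolding abs_prod by (intro prod_mono) (auto intro: abs_xi_le_Phi)
  then have "gam (fst k) * \<bar>\<Prod>z\<in>snd k. xi (fst k) z \<omega>\<bar> \<le> g * (\<Prod>z\<in>snd k. Phi z \<omega>)"
    using gam g by (intro mult_mono) auto
  then show ?thesis
    using gam N unfolding signal_def edge_bound_def by (simp add: abs_mult divide_right_mono)
qed

lemma signal_sq_le_edge_bound: "(signal k \<omega>)\<^sup>2 \<le> (edge_bound k \<omega>)\<^sup>2 / N"
proof -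
  have "(signal k \<omega>)\<^sup>2 = \<bar>signal k \<omega>\<bar>\<^sup>2" by simp
  also have "\<dots> \<le> (edge_bound k \<omega> / sqrt N)\<^sup>2" by (intro power_mono signal_le_edge_bound) auto
  also have "\<dots> = (edge_bound k \<omega>)\<^sup>2 / N" using N by (simp add: power_divide)
  finally show ?thesis .
qed

text \<open>The \<open>e\<close>-th moment of \<open>s + Z\<close>, for \<open>e\<close> in \<open>{1, 2}\<close>.\<close>

definition shifted_moment :: "nat \<Rightarrow> real \<Rightarrow> real" where
  "shifted_moment e s = (if e = 1 then s else 1 + s\<^sup>2)"

text \<open>Given the spike coordinates the entries are independent, so Fubini integrates out the
  noise one factor at a time. The effort lies in the integrability that Fubini requires.\<close>

lemma
  assumes F: "F \<subseteq> E0" "finite F" and e: "\<And>k. k \<in> F \<Longrightarrow> e k = 1 \<or> e k = 2"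
  shows integrable_prod_X: "integrable (P \<Otimes>\<^sub>M Q) (\<lambda>w. \<Prod>k\<in>F. X k w ^ e k)"
    and integral_prod_X: "(\<integral>w. (\<Prod>k\<in>F. X k w ^ e k) \<partial>(P \<Otimes>\<^sub>M Q)) = (\<integral>\<omega>. (\<Prod>k\<in>F. shifted_moment (e k) (signal k \<omega>)) \<partial>P)"
proof -
  interpret PQ: pair_prob_space P Q ..
  \<comment> \<open>The dominating function comes from \<open>\<bar>s + z\<bar> \<le> (1 +
    \<bar>s\<bar>) * (1 + \<bar>z\<bar>)\<close>, squared since exponents are at most 2; each signal
    is crudely bounded through the envelopes of all vertices.\<close>
  let ?A = "\<lambda>\<omega>. (2 * g) ^ (2 * card F) * (\<Prod>x\<in>V. Phi x \<omega> ^ (2 * card F))"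
  let ?B = "\<lambda>\<eta>. \<Prod>k\<in>F. 2 + 2 * (Z k \<eta>)\<^sup>2"
  have intA: "integrable P ?A"
    using integrable_prod_Phi[of V "2 * card F"] by simp
  have indF: "Q.indep_vars (\<lambda>_. borel) (\<lambda>k \<eta>. f k (Z k \<eta>)) F"
    if "\<And>k. k \<in> F \<Longrightarrow> f k \<in> borel_measurable borel" for f :: "_ \<Rightarrow> real \<Rightarrow> real"
    by (rule Q.indep_vars_compose2[OF Q.indep_vars_subset[OF indep_Z F(1)] that])
  have intB: "integrable Q ?B"
    by (rule Q.indep_vars_integrable[OF F(2) indF]) (use Z_integrable F in auto)
  have meas: "(\<lambda>w. \<Prod>k\<in>F. X k w ^ e k) \<in> borel_measurable (P \<Otimes>\<^sub>M Q)"
    using F by (intro borel_measurable_prod borel_measurable_power X_measurable) auto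
  have bound: "\<bar>\<Prod>k\<in>F. X k w ^ e k\<bar> \<le> ?A (fst w) * ?B (snd w)" for w
  proof -
    let ?Psi = "\<Prod>x\<in>V. Phi x (fst w)"
    have "1 \<le> ?Psi" by (intro prod_ge_1) (rule Phi_ge_1)
    have one: "\<bar>X k w ^ e k\<bar> \<le> (2 * g * ?Psi)\<^sup>2 * (2 + 2 * (Z k (snd w))\<^sup>2)" if k: "k \<in> F" for k
    proof -
      let ?z = "\<bar>Z k (snd w)\<bar>"
      have "(\<Prod>z\<in>snd k. Phi z (fst w)) \<le> ?Psi"
        using E0[of k] k F finite_V
        by (intro prod_mono2) (auto intro: order_trans[OF zero_le_one Phi_ge_1] Phi_ge_1)
      then have "edge_bound k (fst w) \<le> g * ?Psi" unfolding edge_bound_def using g by (intro mult_left_mono) auto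
      moreover have "\<bar>signal k (fst w)\<bar> \<le> edge_bound k (fst w)"
      proof -
        have "edge_bound k (fst w) / sqrt N \<le> edge_bound k (fst w) / 1"
          using N edge_bound_ge_1[of k "fst w"] by (intro divide_left_mono) auto
        then show ?thesis using signal_le_edge_bound[of k "fst w"] by simp
      qed
      moreover have "1 \<le> g * ?Psi" using mult_mono[of 1 g 1 ?Psi] g \<open>1 \<le> ?Psi\<close> by simp
      ultimately have "1 + \<bar>signal k (fst w)\<bar> \<le> 2 * g * ?Psi" by simp
      have "\<bar>X k w\<bar> \<le> \<bar>signal k (fst w)\<bar> + ?z" unfolding X_def by (rule abs_triangle_ineq)
      also have "\<dots> \<le> (1 + \<bar>signal k (fst w)\<bar>) * (1 + ?z)" by (simp add: algebra_simps)
      finally have Xle: "\<bar>X k w\<bar> \<le> (1 + \<bar>signal k (fst w)\<bar>) * (1 + ?z)" .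
      have ge1: "1 \<le> (1 + \<bar>signal k (fst w)\<bar>) * (1 + ?z)"
        using mult_mono[of 1 "1 + \<bar>signal k (fst w)\<bar>" 1 "1 + ?z"] by simp
      have "\<bar>X k w ^ e k\<bar> = \<bar>X k w\<bar> ^ e k" by (simp add: power_abs)
      also have "\<dots> \<le> ((1 + \<bar>signal k (fst w)\<bar>) * (1 + ?z)) ^ e k" by (intro power_mono Xle) auto
      also have "\<dots> \<le> ((1 + \<bar>signal k (fst w)\<bar>) * (1 + ?z))\<^sup>2"
        using e[OF k] ge1 by (intro power_increasing) auto
      also have "\<dots> = (1 + \<bar>signal k (fst w)\<bar>)\<^sup>2 * (1 + ?z)\<^sup>2" by (simp add: power_mult_distrib)
      also have "\<dots> \<le> (2 * g * ?Psi)\<^sup>2 * (2 + 2 * (Z k (snd w))\<^sup>2)"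
      proof (intro mult_mono power_mono)
        show "(1 + ?z)\<^sup>2 \<le> 2 + 2 * (Z k (snd w))\<^sup>2"
          using sum_squares_bound[of 1 ?z] by (simp add: power2_sum)
      qed (use \<open>1 + \<bar>signal k (fst w)\<bar> \<le> 2 * g * ?Psi\<close> in auto)
      finally show ?thesis .
    qed
    have "\<bar>\<Prod>k\<in>F. X k w ^ e k\<bar> = (\<Prod>k\<in>F. \<bar>X k w ^ e k\<bar>)" by (rule abs_prod)
    also have "\<dots> \<le> (\<Prod>k\<in>F. (2 * g * ?Psi)\<^sup>2 * (2 + 2 * (Z k (snd w))\<^sup>2))"
      by (intro prod_mono conjI one) auto
    also have "\<dots> = ?A (fst w) * ?B (snd w)"
      by (simp only: prod.distrib prod_constant power_mult[symmetric] power_mult_distrib[of "2 * g"]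
          prod_power_distrib)
    finally show ?thesis .
  qed
  have "norm (\<Prod>k\<in>F. X k w ^ e k) \<le> norm (?A (fst w) * ?B (snd w))" for w
    unfolding real_norm_def by (rule order_trans[OF bound abs_ge_self])
  then show int: "integrable (P \<Otimes>\<^sub>M Q) (\<lambda>w. \<Prod>k\<in>F. X k w ^ e k)"
    by (intro Bochner_Integration.integrable_bound
        [OF integral_pair_product(1)[OF P.prob_space_axioms Q.prob_space_axioms intA intB] meas] AE_I2)
  have inner: "(\<integral>\<eta>. (\<Prod>k\<in>F. X k (\<omega>, \<eta>) ^ e k) \<partial>Q) = (\<Prod>k\<in>F. shifted_moment (e k) (signal k \<omega>))" for \<omega>
  proof -
    have "integrable Q (\<lambda>\<eta>. (signal k \<omega> + Z k \<eta>) ^ e k) \<and>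
        (\<integral>\<eta>. (signal k \<omega> + Z k \<eta>) ^ e k \<partial>Q) = shifted_moment (e k) (signal k \<omega>)" if k: "k \<in> F" for k
    proof -
      have kE: "k \<in> E0" using k F by auto
      note zi = Z_integrable[OF kE] and zm = Z_moments[OF kE]
      have c: "integrable Q (\<lambda>\<eta>. a)" "(\<integral>\<eta>. a \<partial>Q) = a" for a :: real by (simp_all add: Q.prob_space)
      show ?thesis
      proof (cases "e k = 1")
        case True
        then show ?thesis using zi zm by (simp add: shifted_moment_def Q.prob_space)
      next
        case False
        then have "e k = 2" using e[OF k] by simp
        have *: "(signal k \<omega> + Z k \<eta>) ^ e k = (signal k \<omega>)\<^sup>2 + ((Z k \<eta>)\<^sup>2 + (2 * signal k \<omega>) * Z k \<eta>)" for \<eta>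
          unfolding \<open>e k = 2\<close> by (simp add: power2_sum)
        have i2: "integrable Q (\<lambda>\<eta>. (Z k \<eta>)\<^sup>2 + (2 * signal k \<omega>) * Z k \<eta>)"
          using zi by (intro Bochner_Integration.integrable_add integrable_mult_right)
        have v2: "(\<integral>\<eta>. (Z k \<eta>)\<^sup>2 + (2 * signal k \<omega>) * Z k \<eta> \<partial>Q) = 1"
          using zi zm by (subst Bochner_Integration.integral_add) auto
        show ?thesis
          unfolding * using Bochner_Integration.integral_add[OF c(1) i2, of "(signal k \<omega>)\<^sup>2"] c i2 v2 False
          by (simp add: shifted_moment_def)
      qed
    qed
    then have i: "integrable Q (\<lambda>\<eta>. (signal k \<omega> + Z k \<eta>) ^ e k)"
      and one: "(\<integral>\<eta>. (signal k \<omega> + Z k \<eta>) ^ e k \<partial>Q) = shifted_moment (e k) (signal k \<omega>)" if "k \<in> F" for k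
      using that by auto
    have "(\<integral>\<eta>. (\<Prod>k\<in>F. (signal k \<omega> + Z k \<eta>) ^ e k) \<partial>Q) = (\<Prod>k\<in>F. \<integral>\<eta>. (signal k \<omega> + Z k \<eta>) ^ e k \<partial>Q)"
      by (rule Q.indep_vars_lebesgue_integral[OF F(2) indF[of "\<lambda>k z. (signal k \<omega> + z) ^ e k"] i]) auto
    then show ?thesis by (simp add: X_def one)
  qed
  show "(\<integral>w. (\<Prod>k\<in>F. X k w ^ e k) \<partial>(P \<Otimes>\<^sub>M Q)) = (\<integral>\<omega>. (\<Prod>k\<in>F. shifted_moment (e k) (signal k \<omega>)) \<partial>P)"
    using PQ.integral_fst'[OF int] inner by simp
qed

end

section \<open>Second moments of cycle sums\<close>

text \<open>In the expanded product every term other than 1 carries at least one factor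
  \<open>1 / N\<close>.\<close>

lemma prod_one_plus_div:
  fixes t :: "'k \<Rightarrow> real"
  assumes "finite A" "\<And>k. k \<in> A \<Longrightarrow> 0 \<le> t k" "1 \<le> N"
  shows "(\<Prod>k\<in>A. 1 + t k / N) \<le> 1 + (\<Prod>k\<in>A. 1 + t k) / N"
proof -
  \<comment> \<open>The induction needs the sharper form in which the term 1 is subtracted from the
    product before dividing by \<open>N\<close>.\<close>
  have "(\<Prod>k\<in>A. 1 + t k / N) \<le> 1 + ((\<Prod>k\<in>A. 1 + t k) - 1) / N \<and> 1 \<le> (\<Prod>k\<in>A. 1 + t k)"
    using assms(1,2)
  proof (induction A rule: finite_induct)
    case (insert a A)
    let ?T = "\<Prod>k\<in>A. 1 + t k"
    have IH: "(\<Prod>k\<in>A. 1 + t k / N) \<le> 1 + (?T - 1) / N" "1 \<le> ?T" using insert by auto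
    have ta: "0 \<le> t a" using insert by auto
    have "(1 + t a / N) * (\<Prod>k\<in>A. 1 + t k / N) \<le> (1 + t a / N) * (1 + (?T - 1) / N)"
      using IH ta assms(3) by (intro mult_left_mono) auto
    also have "\<dots> = 1 + (?T - 1) / N + t a / N + (t a * (?T - 1) / N) / N"
      using assms(3) by (simp add: field_simps)
    also have "\<dots> \<le> 1 + (?T - 1) / N + t a / N + (t a * (?T - 1) / N) / 1"
      using IH ta assms(3) by (intro add_left_mono divide_left_mono) auto
    also have "\<dots> = 1 + ((1 + t a) * ?T - 1) / N"
      using assms(3) by (simp add: field_simps)
    finally have "(1 + t a / N) * (\<Prod>k\<in>A. 1 + t k / N) \<le> 1 + ((1 + t a) * ?T - 1) / N" .
    moreover have "1 \<le> (1 + t a) * ?T" using mult_mono[of 1 "1 + t a" 1 ?T] ta IH by simp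
    ultimately show ?case using insert by simp
  qed simp
  then have "(\<Prod>k\<in>A. 1 + t k / N) \<le> 1 + ((\<Prod>k\<in>A. 1 + t k) - 1) / N" by simp
  also have "\<dots> \<le> 1 + (\<Prod>k\<in>A. 1 + t k) / N"
    using assms(3) by (simp add: divide_right_mono)
  finally show ?thesis .
qed

context spiked
begin

text \<open>The factor that one vertex contributes to a product of signals. Looking up the position
  of a vertex by \<open>inv_into\<close> turns a product over positions into one over vertices, to
  which independence applies.\<close>

definition phi :: "walk \<Rightarrow> nat \<Rightarrow> real \<times> real \<Rightarrow> real" where
  "phi C z p = (let t = inv_into {..<length C} (\<lambda>t. snd (C ! t)) z in
     proj ((last (map fst C) # map fst C) ! t) p * proj (fst (C ! t)) p)"

lemma phi_measurable: "phi C z \<in> borel_measurable (borel \<Otimes>\<^sub>M borel)"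
  unfolding phi_def[abs_def] Let_def by measurable

lemma phi_nth:
  assumes "is_cycle C" "t < length C"
  shows "phi C (snd (C ! t)) p = proj ((last (map fst C) # map fst C) ! t) p * proj (fst (C ! t)) p"
  using inv_into_f_f[OF inj_on_snd_nth[OF assms(1)], of t] assms(2) by (simp add: phi_def)

lemma proj_xi: "proj l (xi True x \<omega>, xi False x \<omega>) = xi l x \<omega>"
  by (cases l) (simp_all add: proj_def)

definition gprod :: "walk \<Rightarrow> real" where
  "gprod C = (\<Prod>t<length C. gam (fst (C ! t)) / sqrt N)"

lemma prod_signal:
  assumes C: "is_cycle C"
  shows "(\<Prod>k\<in>edges C. signal k \<omega>) = gprod C * (\<Prod>z\<in>verts C. phi C z (xi True z \<omega>, xi False z \<omega>))"
proof -
  let ?l = "length C" and ?w = "map fst C"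
  have ne: "?w \<noteq> []" using C by (auto simp: is_cycle_def)
  have "(\<Prod>k\<in>edges C. signal k \<omega>) = (\<Prod>t<?l. gam (fst (C ! t)) / sqrt N *
      (xi (fst (C ! t)) (snd (C ! t)) \<omega> * xi (fst (C ! t)) (snd (C ! (Suc t mod ?l))) \<omega>))"
    unfolding prod_edges[OF C] signal_def
    by (intro prod.cong refl)
      (simp add: prod_edge_key[OF C, of _ "\<lambda>l z. xi l z \<omega>"], simp add: edge_key_def)
  also have "\<dots> = gprod C * ((\<Prod>t<?l. xi (fst (C ! t)) (snd (C ! t)) \<omega>) *
      (\<Prod>t<?l. xi (?w ! t) (snd (C ! (Suc t mod ?l))) \<omega>))"
    unfolding gprod_def prod.distrib[symmetric] by (intro prod.cong refl) simp
  also have "(\<Prod>t<?l. xi (?w ! t) (snd (C ! (Suc t mod ?l))) \<omega>)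
      = (\<Prod>t<?l. xi ((last ?w # ?w) ! t) (snd (C ! t)) \<omega>)"
    using prod_cyclic_pred[OF ne, of ?l "\<lambda>l x. xi l x \<omega>" "\<lambda>t. snd (C ! t)"] by simp
  also have "(\<Prod>t<?l. xi (fst (C ! t)) (snd (C ! t)) \<omega>) * \<dots>
      = (\<Prod>t<?l. phi C (snd (C ! t)) (xi True (snd (C ! t)) \<omega>, xi False (snd (C ! t)) \<omega>))"
    unfolding prod.distrib[symmetric]
    by (intro prod.cong refl) (simp add: phi_nth[OF C] proj_xi mult.commute)
  also have "\<dots> = (\<Prod>z\<in>verts C. phi C z (xi True z \<omega>, xi False z \<omega>))"
    by (rule prod_verts[OF C])
  finally show ?thesis .
qed

lemma verts_subset_V:
  assumes "edges C \<subseteq> E0"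
  shows "verts C \<subseteq> V"
proof
  fix z assume "z \<in> verts C"
  then obtain t where "t < length C" "z = snd (C ! t)" by (auto simp: verts_image)
  then have "edge_key C t \<in> edges C" "z \<in> snd (edge_key C t)" by (auto simp: edges_def edge_key_def)
  then show "z \<in> V" using E0 assms by blast
qed

lemma phi_integrable:
  assumes "z \<in> V"
  shows "integrable P (\<lambda>\<omega>. phi C z (xi True z \<omega>, xi False z \<omega>))"
proof (rule Bochner_Integration.integrable_bound[of _ "Phi z"])
  show "integrable P (Phi z)" using Phi_integrable[OF assms, of 1] by (simp add: Phi_def[abs_def])
  have "(\<lambda>\<omega>. (xi True z \<omega>, xi False z \<omega>)) \<in> measurable P (borel \<Otimes>\<^sub>M borel)"
    by (intro measurable_Pair xi_measurable assms)
  from measurable_compose[OF this phi_measurable]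
  show "(\<lambda>\<omega>. phi C z (xi True z \<omega>, xi False z \<omega>)) \<in> borel_measurable P" .
  show "AE \<omega> in P. norm (phi C z (xi True z \<omega>, xi False z \<omega>)) \<le> norm (Phi z \<omega>)"
  proof (intro AE_I2)
    fix \<omega>
    have "norm (phi C z (xi True z \<omega>, xi False z \<omega>)) \<le> Phi z \<omega>"
      unfolding phi_def Let_def proj_xi real_norm_def by (rule abs_xi_xi_le_Phi)
    also have "\<dots> \<le> norm (Phi z \<omega>)" by simp
    finally show "norm (phi C z (xi True z \<omega>, xi False z \<omega>)) \<le> norm (Phi z \<omega>)" .
  qed
qed

lemma integral_xi_xi: "x \<in> V \<Longrightarrow> (\<integral>\<omega>. xi l x \<omega> * xi l' x \<omega> \<partial>P) = vertex_corr x l l'"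
  using xi_square[of x l] xi_cross[of x]
  by (cases l; cases l') (simp_all add: vertex_corr_def mult.commute)

lemma prod_integral_phi:
  assumes C: "is_cycle C" and E: "edges C \<subseteq> E0"
  shows "gprod C * (\<Prod>z\<in>verts C. \<integral>\<omega>. phi C z (xi True z \<omega>, xi False z \<omega>) \<partial>P) = mean C"
proof -
  have V: "verts C \<subseteq> V" by (rule verts_subset_V[OF E])
  have "(\<Prod>z\<in>verts C. \<integral>\<omega>. phi C z (xi True z \<omega>, xi False z \<omega>) \<partial>P)
      = (\<Prod>t<length C. \<integral>\<omega>. phi C (snd (C ! t)) (xi True (snd (C ! t)) \<omega>, xi False (snd (C ! t)) \<omega>) \<partial>P)"
    by (rule prod_verts[OF C, symmetric])
  also have "\<dots> = (\<Prod>t<length C. vertex_corr (snd (C ! t)) ((last (map fst C) # map fst C) ! t) (fst (C ! t)))"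
    using V snd_nth_in_verts[of _ C]
    by (intro prod.cong refl) (auto simp: phi_nth[OF C] proj_xi intro!: integral_xi_xi)
  finally show ?thesis by (simp add: mean_def gprod_def)
qed

lemma integral_prod_signal:
  assumes C: "is_cycle C" and E: "edges C \<subseteq> E0"
  shows "(\<integral>\<omega>. (\<Prod>k\<in>edges C. signal k \<omega>) \<partial>P) = mean C"
  unfolding prod_signal[OF C] prod_integral_phi[OF C E, symmetric]
  using integral_prod_xi[OF verts_subset_V[OF E], of "phi C", OF phi_measurable phi_integrable]
    verts_subset_V[OF E] by (auto simp: subset_iff)

text \<open>Disjoint cycles use independent spike coordinates. Almost all pairs of cycles are
  disjoint in high dimension, so the identity has to be exact: even a small covariance could
  dominate after summation.\<close>

lemma integral_prod_signal_disjoint: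
  assumes C: "is_cycle C" and E: "edges C \<subseteq> E0" and C': "is_cycle C'" and E': "edges C' \<subseteq> E0"
    and d: "verts C \<inter> verts C' = {}"
  shows "(\<integral>\<omega>. (\<Prod>k\<in>edges C. signal k \<omega>) * (\<Prod>k\<in>edges C'. signal k \<omega>) \<partial>P) = mean C * mean C'"
proof -
  let ?f = "\<lambda>z. if z \<in> verts C then phi C z else phi C' z"
  let ?x = "\<lambda>z \<omega>. (xi True z \<omega>, xi False z \<omega>)"
  have V: "verts C \<subseteq> V" "verts C' \<subseteq> V" using verts_subset_V E E' by auto
  then have V2: "verts C \<union> verts C' \<subseteq> V" by simp
  have m: "?f z \<in> borel_measurable (borel \<Otimes>\<^sub>M borel)" for z
    using phi_measurable by simp
  have i: "integrable P (\<lambda>\<omega>. ?f z (?x z \<omega>))" if "z \<in> verts C \<union> verts C'" for z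
    using phi_integrable[of z] V that by (cases "z \<in> verts C") auto
  have split: "(\<Prod>z\<in>verts C \<union> verts C'. h z) = (\<Prod>z\<in>verts C. h z) * (\<Prod>z\<in>verts C'. h z)" for h :: "nat \<Rightarrow> real"
    by (rule prod.union_disjoint) (use d in auto)
  have un: "(\<Prod>z\<in>verts C. F (phi C z) z) * (\<Prod>z\<in>verts C'. F (phi C' z) z) = (\<Prod>z\<in>verts C \<union> verts C'. F (?f z) z)"
    for F :: "(real \<times> real \<Rightarrow> real) \<Rightarrow> nat \<Rightarrow> real"
    unfolding split using d by (intro arg_cong2[of _ _ _ _ "(*)"] prod.cong refl) auto
  have "(\<Prod>k\<in>edges C. signal k \<omega>) * (\<Prod>k\<in>edges C'. signal k \<omega>)
      = gprod C * gprod C' * (\<Prod>z\<in>verts C \<union> verts C'. ?f z (?x z \<omega>))" for \<omega>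
    using un[of "\<lambda>h z. h (?x z \<omega>)"] by (simp add: prod_signal[OF C] prod_signal[OF C'])
  then have "(\<integral>\<omega>. (\<Prod>k\<in>edges C. signal k \<omega>) * (\<Prod>k\<in>edges C'. signal k \<omega>) \<partial>P)
      = gprod C * gprod C' * (\<integral>\<omega>. (\<Prod>z\<in>verts C \<union> verts C'. ?f z (?x z \<omega>)) \<partial>P)" by simp
  also have "(\<integral>\<omega>. (\<Prod>z\<in>verts C \<union> verts C'. ?f z (?x z \<omega>)) \<partial>P)
      = (\<Prod>z\<in>verts C \<union> verts C'. \<integral>\<omega>. ?f z (?x z \<omega>) \<partial>P)"
    by (rule integral_prod_xi[OF V2 m i])
  also have "\<dots> = (\<Prod>z\<in>verts C. \<integral>\<omega>. phi C z (?x z \<omega>) \<partial>P) * (\<Prod>z\<in>verts C'. \<integral>\<omega>. phi C' z (?x z \<omega>) \<partial>P)"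
    using un[of "\<lambda>h z. \<integral>\<omega>. h (?x z \<omega>) \<partial>P"] by simp
  also have "gprod C * gprod C' * \<dots> = mean C * mean C'"
    unfolding prod_integral_phi[OF C E, symmetric] prod_integral_phi[OF C' E', symmetric] by simp
  finally show ?thesis .
qed

lemma
  assumes C: "is_cycle C" and E: "edges C \<subseteq> E0"
  shows cycle_prod_integrable: "integrable (P \<Otimes>\<^sub>M Q) (cycle_prod C)"
    and integral_cycle_prod: "(\<integral>w. cycle_prod C w \<partial>(P \<Otimes>\<^sub>M Q)) = mean C"
  using integrable_prod_X[OF E finite_edges, of "\<lambda>_. 1"] integral_prod_X[OF E finite_edges, of "\<lambda>_. 1"]
    integral_prod_signal[OF C E]
  by (simp_all add: cycle_prod_def[abs_def] shifted_moment_def)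

definition key_mult :: "walk \<Rightarrow> walk \<Rightarrow> bool \<times> nat set \<Rightarrow> nat" where
  "key_mult C C' k = (if k \<in> edges C \<and> k \<in> edges C' then 2 else 1)"

lemma prod_edges_Un:
  fixes h :: "bool \<times> nat set \<Rightarrow> real"
  shows "(\<Prod>k\<in>edges C. h k) * (\<Prod>k\<in>edges C'. h k) = (\<Prod>k\<in>edges C \<union> edges C'. h k ^ key_mult C C' k)"
proof -
  have "(\<Prod>k\<in>edges C. h k) = (\<Prod>k\<in>edges C \<union> edges C'. if k \<in> edges C then h k else 1)"
    "(\<Prod>k\<in>edges C'. h k) = (\<Prod>k\<in>edges C \<union> edges C'. if k \<in> edges C' then h k else 1)"
    by (auto simp: prod.If_cases Int_absorb1 Int_absorb2 intro!: prod.mono_neutral_cong_left)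
  then show ?thesis
    by (auto simp: prod.distrib[symmetric] key_mult_def power2_eq_square intro!: prod.cong)
qed

lemma
  assumes E: "edges C \<subseteq> E0" "edges C' \<subseteq> E0"
  shows cycle_prods_integrable: "integrable (P \<Otimes>\<^sub>M Q) (\<lambda>w. cycle_prod C w * cycle_prod C' w)"
    and integral_cycle_prods: "(\<integral>w. cycle_prod C w * cycle_prod C' w \<partial>(P \<Otimes>\<^sub>M Q)) =
      (\<integral>\<omega>. (\<Prod>k\<in>edges C \<union> edges C'. shifted_moment (key_mult C C' k) (signal k \<omega>)) \<partial>P)"
proof -
  have "edges C \<union> edges C' \<subseteq> E0" "finite (edges C \<union> edges C')" using E by auto
  note * = integrable_prod_X[OF this, of "key_mult C C'"] integral_prod_X[OF this, of "key_mult C C'"]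
  show "integrable (P \<Otimes>\<^sub>M Q) (\<lambda>w. cycle_prod C w * cycle_prod C' w)"
    "(\<integral>w. cycle_prod C w * cycle_prod C' w \<partial>(P \<Otimes>\<^sub>M Q)) =
      (\<integral>\<omega>. (\<Prod>k\<in>edges C \<union> edges C'. shifted_moment (key_mult C C' k) (signal k \<omega>)) \<partial>P)"
    unfolding cycle_prod_def prod_edges_Un by (rule *; simp add: key_mult_def)+
qed

text \<open>Each vertex has degree two in each cycle it belongs to, hence at most four in total;
  since \<open>Phi\<close> is at least 1, the fourth power may be used at every vertex of the
  union.\<close>

lemma prod_edge_bound:
  assumes C: "is_cycle C" and C': "is_cycle C'" and E: "edges C \<subseteq> E0" "edges C' \<subseteq> E0"
  shows "(\<Prod>k\<in>edges C. 2 * edge_bound k \<omega>) * (\<Prod>k\<in>edges C'. 2 * edge_bound k \<omega>)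
    \<le> (2 * g) ^ (length C + length C') * (\<Prod>z\<in>verts C \<union> verts C'. Phi z \<omega> ^ 4)"
proof -
  have *: "(\<Prod>k\<in>edges D. 2 * edge_bound k \<omega>) = (2 * g) ^ length D * (\<Prod>z\<in>verts D. (Phi z \<omega>)\<^sup>2)"
    if "is_cycle D" for D
    using prod_edges_verts[OF that, of "\<lambda>z. Phi z \<omega>"]
    by (simp add: edge_bound_def prod.distrib card_edges[OF that] power_mult_distrib)
  have mono: "(\<Prod>z\<in>verts D. (Phi z \<omega>)\<^sup>2) \<le> (\<Prod>z\<in>verts C \<union> verts C'. (Phi z \<omega>)\<^sup>2)"
    if "verts D \<subseteq> verts C \<union> verts C'" for D
    using that by (intro prod_mono2) (auto simp: one_le_power Phi_ge_1)
  have "(\<Prod>k\<in>edges C. 2 * edge_bound k \<omega>) * (\<Prod>k\<in>edges C'. 2 * edge_bound k \<omega>)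
      = (2 * g) ^ (length C + length C') * ((\<Prod>z\<in>verts C. (Phi z \<omega>)\<^sup>2) * (\<Prod>z\<in>verts C'. (Phi z \<omega>)\<^sup>2))"
    by (simp add: *[OF C] *[OF C'] power_add)
  also have "\<dots> \<le> (2 * g) ^ (length C + length C') *
      ((\<Prod>z\<in>verts C \<union> verts C'. (Phi z \<omega>)\<^sup>2) * (\<Prod>z\<in>verts C \<union> verts C'. (Phi z \<omega>)\<^sup>2))"
    using g by (intro mult_left_mono mult_mono mono) (auto intro!: prod_nonneg)
  also have "(\<Prod>z\<in>verts C \<union> verts C'. (Phi z \<omega>)\<^sup>2) * (\<Prod>z\<in>verts C \<union> verts C'. (Phi z \<omega>)\<^sup>2)
      = (\<Prod>z\<in>verts C \<union> verts C'. Phi z \<omega> ^ 4)"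
    by (simp add: prod.distrib[symmetric] power_add[symmetric])
  finally show ?thesis .
qed

lemma integral_prod_edge_bound:
  assumes C: "is_cycle C" and C': "is_cycle C'" and E: "edges C \<subseteq> E0" "edges C' \<subseteq> E0"
  shows "(\<integral>\<omega>. (2 * g) ^ (length C + length C') * (\<Prod>z\<in>verts C \<union> verts C'. Phi z \<omega> ^ 4) \<partial>P)
    \<le> (2 * g * K) ^ (length C + length C')"
proof -
  have "verts C \<union> verts C' \<subseteq> V" using verts_subset_V E by auto
  from integral_prod_Phi[OF this]
  have "(\<integral>\<omega>. (\<Prod>z\<in>verts C \<union> verts C'. Phi z \<omega> ^ 4) \<partial>P) \<le> K ^ card (verts C \<union> verts C')" .
  also have "\<dots> \<le> K ^ (length C + length C')"
    using card_Un_le[of "verts C" "verts C'"] card_verts[OF C] card_verts[OF C'] K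
    by (intro power_increasing) auto
  finally show ?thesis using g by (simp add: power_mult_distrib)
qed

text \<open>Two cycles of length at most \<open>L\<close> have at most \<open>2 * L\<close> edges,
  each costing \<open>2 * g\<close>, and at most \<open>2 * L\<close> vertices, each costing
  \<open>K\<close>.\<close>

definition moment_const :: "nat \<Rightarrow> real" where
  "moment_const L = (2 * g * K) ^ (2 * L)"

lemma moment_const_ge: "l + l' \<le> 2 * L \<Longrightarrow> (2 * g * K) ^ (l + l') \<le> moment_const L"
  unfolding moment_const_def using g K mult_mono[of 1 g 1 K] by (intro power_increasing) auto

text \<open>
  An edge shared by the two cycles contributes \<open>O(1)\<close> through its noise, any other edge only
  \<open>O(1 / sqrt N)\<close> through its signal.  Unless the edge sets agree, overlapping cycles share more
  vertices than edges, which yields the additional factor \<open>1 / N\<close> in the last term.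
\<close>

lemma second_moment_le:
  assumes C: "is_cycle C" and C': "is_cycle C'" and E: "edges C \<subseteq> E0" "edges C' \<subseteq> E0"
    and L: "length C \<le> L" "length C' \<le> L"
  shows "(\<integral>w. cycle_prod C w * cycle_prod C' w \<partial>(P \<Otimes>\<^sub>M Q)) \<le> mean C * mean C'
    + of_bool (edges C = edges C') * (1 + moment_const L / N)
    + moment_const L * N ^ card (verts C \<inter> verts C') / (N * sqrt N ^ (length C + length C'))"
proof -
  let ?F = "edges C \<union> edges C'" and ?D = "edges C \<inter> edges C'"
  let ?e = "key_mult C C'"
  let ?B = "\<lambda>\<omega>. (2 * g) ^ (length C + length C') * (\<Prod>z\<in>verts C \<union> verts C'. Phi z \<omega> ^ 4)"
  have KL0: "0 \<le> moment_const L" unfolding moment_const_def using g K by simp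
  have third: "0 \<le> moment_const L * N ^ card (verts C \<inter> verts C') / (N * sqrt N ^ (length C + length C'))"
    using KL0 N by simp
  have means: "0 \<le> mean C * mean C'" using mean_nonneg by simp
  have Bint: "integrable P ?B"
    using integrable_prod_Phi[of "verts C \<union> verts C'" 4] verts_subset_V E by simp
  have Fint: "integrable P (\<lambda>\<omega>. \<Prod>k\<in>?F. shifted_moment (?e k) (signal k \<omega>))" if le: "\<And>\<omega>. \<bar>\<Prod>k\<in>?F. shifted_moment (?e k) (signal k \<omega>)\<bar> \<le> c * ?B \<omega>" for c
  proof (rule Bochner_Integration.integrable_bound)
    show "integrable P (\<lambda>\<omega>. c * ?B \<omega>)" using Bint by simp
    show "(\<lambda>\<omega>. \<Prod>k\<in>?F. shifted_moment (?e k) (signal k \<omega>)) \<in> borel_measurable P"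
    proof (intro borel_measurable_prod)
      fix k assume "k \<in> ?F"
      then have [measurable]: "signal k \<in> borel_measurable P" using E by (intro signal_measurable) auto
      show "(\<lambda>\<omega>. shifted_moment (?e k) (signal k \<omega>)) \<in> borel_measurable P" unfolding shifted_moment_def by measurable
    qed
    have "norm (\<Prod>k\<in>?F. shifted_moment (?e k) (signal k \<omega>)) \<le> norm (c * ?B \<omega>)" for \<omega>
      unfolding real_norm_def by (rule order_trans[OF le abs_ge_self])
    then show "AE \<omega> in P. norm (\<Prod>k\<in>?F. shifted_moment (?e k) (signal k \<omega>)) \<le> norm (c * ?B \<omega>)" by simp
  qed
  consider (disj) "verts C \<inter> verts C' = {}" | (eq) "edges C = edges C'"
    | (part) "verts C \<inter> verts C' \<noteq> {}" "edges C \<noteq> edges C'" by blast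
  then show ?thesis
  proof cases
    case disj
    have "?D = {}"
    proof (rule ccontr)
      assume "?D \<noteq> {}"
      then obtain k where k: "k \<in> ?D" by blast
      then have "snd k \<subseteq> verts C \<inter> verts C'" using edges_verts by blast
      then show False using card_edge_key[OF C, of k] k disj by auto
    qed
    then have e1: "?e k = 1" for k by (auto simp: key_mult_def)
    have "(\<integral>w. cycle_prod C w * cycle_prod C' w \<partial>(P \<Otimes>\<^sub>M Q)) = (\<integral>\<omega>. (\<Prod>k\<in>?F. signal k \<omega>) \<partial>P)"
      unfolding integral_cycle_prods[OF E] by (simp add: e1 shifted_moment_def)
    also have "\<dots> = (\<integral>\<omega>. (\<Prod>k\<in>edges C. signal k \<omega>) * (\<Prod>k\<in>edges C'. signal k \<omega>) \<partial>P)"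
      by (simp add: prod_edges_Un e1)
    also have "\<dots> = mean C * mean C'" by (rule integral_prod_signal_disjoint[OF C E(1) C' E(2) disj])
    finally show ?thesis using third KL0 N by simp
  next
    case eq
    have e2: "?e k = 2" if "k \<in> edges C" for k using that eq by (simp add: key_mult_def)
    \<comment> \<open>Every edge is shared: the noise alone contributes exactly 1, and each further
      term contains a squared signal of order \<open>1 / N\<close>.\<close>
    have le: "(\<Prod>k\<in>?F. shifted_moment (?e k) (signal k \<omega>)) \<le> 1 + ?B \<omega> / N" for \<omega>
    proof -
      have "(\<Prod>k\<in>?F. shifted_moment (?e k) (signal k \<omega>)) = (\<Prod>k\<in>edges C. 1 + (signal k \<omega>)\<^sup>2)"
        using eq by (auto intro!: prod.cong simp: e2 shifted_moment_def)
      also have "\<dots> \<le> (\<Prod>k\<in>edges C. 1 + (edge_bound k \<omega>)\<^sup>2 / N)"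
        by (intro prod_mono) (auto intro: signal_sq_le_edge_bound)
      also have "\<dots> \<le> 1 + (\<Prod>k\<in>edges C. 1 + (edge_bound k \<omega>)\<^sup>2) / N"
        using N by (intro prod_one_plus_div) auto
      also have "(\<Prod>k\<in>edges C. 1 + (edge_bound k \<omega>)\<^sup>2) \<le> (\<Prod>k\<in>edges C. (2 * edge_bound k \<omega>)\<^sup>2)"
      proof (intro prod_mono conjI)
        fix k
        have "1 \<le> (edge_bound k \<omega>)\<^sup>2" using edge_bound_ge_1 by (intro one_le_power)
        then show "1 + (edge_bound k \<omega>)\<^sup>2 \<le> (2 * edge_bound k \<omega>)\<^sup>2" by (simp add: power_mult_distrib)
      qed auto
      also have "(\<Prod>k\<in>edges C. (2 * edge_bound k \<omega>)\<^sup>2) = (\<Prod>k\<in>edges C. 2 * edge_bound k \<omega>) * (\<Prod>k\<in>edges C'. 2 * edge_bound k \<omega>)"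
        using eq by (simp add: prod.distrib[symmetric] power2_eq_square)
      also have "\<dots> \<le> ?B \<omega>" by (rule prod_edge_bound[OF C C' E])
      finally show ?thesis using N by (simp add: divide_right_mono)
    qed
    have nn: "0 \<le> (\<Prod>k\<in>?F. shifted_moment (?e k) (signal k \<omega>))" for \<omega>
      using eq by (intro prod_nonneg) (auto simp: e2 shifted_moment_def)
    have B1: "1 \<le> ?B \<omega>" for \<omega>
    proof -
      have "1 * 1 \<le> ?B \<omega>"
        using g by (intro mult_mono one_le_power prod_ge_1) (auto intro!: one_le_power Phi_ge_1)
      then show ?thesis by simp
    qed
    have BN: "?B \<omega> / N \<le> ?B \<omega> / 1" for \<omega> using B1[of \<omega>] N by (intro divide_left_mono) auto
    then have "\<bar>\<Prod>k\<in>?F. shifted_moment (?e k) (signal k \<omega>)\<bar> \<le> 2 * ?B \<omega>" for \<omega>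
      using le[of \<omega>] nn[of \<omega>] B1[of \<omega>] BN[of \<omega>] by linarith
    note int = Fint[OF this]
    have "(\<integral>w. cycle_prod C w * cycle_prod C' w \<partial>(P \<Otimes>\<^sub>M Q)) \<le> (\<integral>\<omega>. 1 + ?B \<omega> / N \<partial>P)"
      unfolding integral_cycle_prods[OF E] using Bint by (intro integral_mono int le) auto
    also have "\<dots> = 1 + (\<integral>\<omega>. ?B \<omega> \<partial>P) / N"
      using Bint by (subst Bochner_Integration.integral_add) (auto simp: P.prob_space)
    also have "\<dots> \<le> 1 + moment_const L / N"
      using order_trans[OF integral_prod_edge_bound[OF C C' E] moment_const_ge] L N
      by (intro add_left_mono divide_right_mono) auto
    finally show ?thesis using eq third means by simp
  next
    case part
    \<comment> \<open>The number of unshared edges, each of which yields a factor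
      \<open>1 / sqrt N\<close>.\<close>
    define s where "s = card (?F - ?D)"
    have le: "\<bar>\<Prod>k\<in>?F. shifted_moment (?e k) (signal k \<omega>)\<bar> \<le> (1 / sqrt N ^ s) * ?B \<omega>" for \<omega>
    proof -
      have one: "\<bar>shifted_moment (?e k) (signal k \<omega>)\<bar> \<le> (if k \<in> ?D then 1 else 1 / sqrt N) * (2 * edge_bound k \<omega>) ^ ?e k"
        if "k \<in> ?F" for k
      proof (cases "k \<in> ?D")
        case True
        have "1 \<le> (edge_bound k \<omega>)\<^sup>2" using edge_bound_ge_1 by (intro one_le_power)
        moreover have "(edge_bound k \<omega>)\<^sup>2 / N \<le> (edge_bound k \<omega>)\<^sup>2 / 1" using N by (intro divide_left_mono) auto
        ultimately have "1 + (signal k \<omega>)\<^sup>2 \<le> 4 * (edge_bound k \<omega>)\<^sup>2" using signal_sq_le_edge_bound[of k \<omega>] by simp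
        then show ?thesis using True by (simp add: shifted_moment_def key_mult_def power_mult_distrib)
      next
        case False
        have "0 \<le> edge_bound k \<omega> / sqrt N" using edge_bound_ge_1[of k \<omega>] N by simp
        then have "\<bar>signal k \<omega>\<bar> \<le> 1 / sqrt N * (2 * edge_bound k \<omega>)" using signal_le_edge_bound[of k \<omega>] by simp
        moreover have "?e k = 1" using False by (auto simp: key_mult_def)
        moreover have "(if k \<in> ?D then 1 else 1 / sqrt N) = 1 / sqrt N" using False by (rule if_not_P)
        ultimately show ?thesis by (simp only: shifted_moment_def power_one_right simp_thms if_True)
      qed
      have "\<bar>\<Prod>k\<in>?F. shifted_moment (?e k) (signal k \<omega>)\<bar> \<le> (\<Prod>k\<in>?F. (if k \<in> ?D then 1 else 1 / sqrt N) * (2 * edge_bound k \<omega>) ^ ?e k)"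
        unfolding abs_prod by (intro prod_mono conjI one) auto
      also have "\<dots> = (\<Prod>k\<in>?F. if k \<in> ?D then 1 else 1 / sqrt N) * ((\<Prod>k\<in>edges C. 2 * edge_bound k \<omega>) * (\<Prod>k\<in>edges C'. 2 * edge_bound k \<omega>))"
        unfolding prod_edges_Un by (rule prod.distrib)
      also have "(\<Prod>k\<in>?F. if k \<in> ?D then 1 else 1 / sqrt N) = (1 / sqrt N) ^ s"
      proof -
        have "(\<Prod>k\<in>?F. if k \<in> ?D then 1 else 1 / sqrt N) = (\<Prod>k\<in>?F - ?D. 1 / sqrt N)"
          by (rule prod.mono_neutral_cong_right) auto
        then show ?thesis by (simp add: s_def)
      qed
      also have "(1 / sqrt N) ^ s * ((\<Prod>k\<in>edges C. 2 * edge_bound k \<omega>) * (\<Prod>k\<in>edges C'. 2 * edge_bound k \<omega>)) \<le> (1 / sqrt N) ^ s * ?B \<omega>"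
        using N by (intro mult_left_mono prod_edge_bound[OF C C' E]) auto
      finally show ?thesis by (simp add: power_one_over)
    qed
    note int = Fint[OF le]
    have "(\<integral>w. cycle_prod C w * cycle_prod C' w \<partial>(P \<Otimes>\<^sub>M Q)) \<le> (\<integral>\<omega>. (1 / sqrt N ^ s) * ?B \<omega> \<partial>P)"
      unfolding integral_cycle_prods[OF E]
    proof (intro integral_mono int)
      show "integrable P (\<lambda>\<omega>. (1 / sqrt N ^ s) * ?B \<omega>)" using Bint by simp
      show "(\<Prod>k\<in>?F. shifted_moment (?e k) (signal k \<omega>)) \<le> (1 / sqrt N ^ s) * ?B \<omega>" for \<omega>
        by (rule order_trans[OF abs_ge_self le])
    qed
    also have "\<dots> = (1 / sqrt N ^ s) * (\<integral>\<omega>. ?B \<omega> \<partial>P)" by (rule integral_mult_right_zero)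
    also have "\<dots> \<le> (1 / sqrt N ^ s) * moment_const L"
      using order_trans[OF integral_prod_edge_bound[OF C C' E] moment_const_ge] L N
      by (intro mult_left_mono) auto
    also have "(1 / sqrt N ^ s) * moment_const L
        \<le> N ^ card (verts C \<inter> verts C') / (N * sqrt N ^ (length C + length C')) * moment_const L"
    proof (rule mult_right_mono[OF _ KL0])
      let ?d = "card ?D" and ?q = "card (verts C \<inter> verts C')"
      have "?d < ?q" by (rule card_common_edges[OF C C' part(2,1)])
      have "card ?F + ?d = length C + length C'"
        using card_Un_Int[of "edges C" "edges C'"] card_edges[OF C] card_edges[OF C'] by simp
      moreover have "card ?F = s + ?d"
      proof -
        have "?d \<le> card ?F" by (rule card_mono) auto
        then show ?thesis unfolding s_def by (subst card_Diff_subset) auto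
      qed
      \<comment> \<open>Unshared edges occur once and shared ones twice in the total length, so
        \<open>1 / sqrt N ^ s\<close> equals
        \<open>N ^ ?d / sqrt N ^ (length C + length C')\<close>; \<open>?d < ?q\<close> then gains
        one factor \<open>N\<close>.\<close>
      ultimately have sl: "length C + length C' = s + 2 * ?d" by simp
      have "sqrt N ^ (length C + length C') = sqrt N ^ s * N ^ ?d"
        using N unfolding sl by (simp add: power_add power_mult)
      moreover have "N * N ^ ?d \<le> N ^ ?q"
        using \<open>?d < ?q\<close> N power_increasing[of "Suc ?d" ?q N] by simp
      ultimately show "1 / sqrt N ^ s \<le> N ^ ?q / (N * sqrt N ^ (length C + length C'))"
        using N by (simp add: field_simps)
    qed
    finally show ?thesis using part means by (simp add: mult.commute)
  qed
qed

end

section \<open>From pairs of cycles to the variance of a weighted sum\<close>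

lemma prod_list_filter_power:
  "prod_list (map (\<lambda>p. if R p then (N :: real) else 1) xs) = N ^ length (filter R xs)"
  by (induction xs) auto

lemma prod_list_divide_const:
  "prod_list (map (\<lambda>p. h p / (N :: real)) xs) = prod_list (map h xs) / N ^ length xs"
  by (induction xs) auto

lemma card_verts_Int:
  assumes "is_cycle C'"
  shows "card (S \<inter> verts C') = length (filter (\<lambda>p. snd p \<in> S) C')"
proof -
  have "S \<inter> verts C' = set (map snd (filter (\<lambda>p. snd p \<in> S) C'))"
    by (auto simp: verts_def)
  moreover have "distinct (map snd (filter (\<lambda>p. snd p \<in> S) C'))"
    using assms by (simp add: is_cycle_def distinct_map_filter)
  ultimately show ?thesis by (metis distinct_card length_map)
qed

text \<open>A Schur test: \<open>H x * H y\<close> is at most the mean of the two squares, and by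
  symmetry both squares contribute equally.\<close>

lemma sum_sym_relation:
  fixes H :: "'c \<Rightarrow> real"
  assumes fin: "finite I" and sym: "\<And>x y. R x y \<Longrightarrow> R y x"
    and deg: "\<And>x. x \<in> I \<Longrightarrow> real (card {y \<in> I. R x y}) \<le> d"
  shows "(\<Sum>x\<in>I. \<Sum>y\<in>I. H x * H y * of_bool (R x y)) \<le> d * (\<Sum>x\<in>I. (H x)\<^sup>2)"
proof -
  have half: "(\<Sum>x\<in>I. \<Sum>y\<in>I. (H x)\<^sup>2 * of_bool (R x y)) \<le> d * (\<Sum>x\<in>I. (H x)\<^sup>2)"
  proof -
    have "(\<Sum>x\<in>I. \<Sum>y\<in>I. (H x)\<^sup>2 * of_bool (R x y)) = (\<Sum>x\<in>I. (H x)\<^sup>2 * card {y \<in> I. R x y})"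
      unfolding sum_distrib_left[symmetric] using fin by (simp add: Int_def)
    also have "\<dots> \<le> (\<Sum>x\<in>I. (H x)\<^sup>2 * d)"
      by (intro sum_mono mult_left_mono deg) auto
    finally show ?thesis by (simp add: sum_distrib_left mult.commute)
  qed
  have swap: "(\<Sum>x\<in>I. \<Sum>y\<in>I. (H y)\<^sup>2 * of_bool (R x y)) = (\<Sum>x\<in>I. \<Sum>y\<in>I. (H x)\<^sup>2 * of_bool (R x y))"
    by (subst sum.swap, intro sum.cong refl arg_cong2[of _ _ _ _ "(*)"] arg_cong[of _ _ of_bool])
      (use sym in blast)
  have "(\<Sum>x\<in>I. \<Sum>y\<in>I. H x * H y * of_bool (R x y))
      \<le> (\<Sum>x\<in>I. \<Sum>y\<in>I. (1/2) * ((H x)\<^sup>2 * of_bool (R x y)) + (1/2) * ((H y)\<^sup>2 * of_bool (R x y)))"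
  proof (intro sum_mono)
    fix x y
    have "2 * H x * H y \<le> (H x)\<^sup>2 + (H y)\<^sup>2" by (rule sum_squares_bound)
    then show "H x * H y * of_bool (R x y)
        \<le> (1/2) * ((H x)\<^sup>2 * of_bool (R x y)) + (1/2) * ((H y)\<^sup>2 * of_bool (R x y))"
      by (cases "R x y") auto
  qed
  also have "\<dots> = (1/2) * (\<Sum>x\<in>I. \<Sum>y\<in>I. (H x)\<^sup>2 * of_bool (R x y))
      + (1/2) * (\<Sum>x\<in>I. \<Sum>y\<in>I. (H y)\<^sup>2 * of_bool (R x y))"
    by (simp add: sum.distrib sum_distrib_left)
  also have "\<dots> \<le> d * (\<Sum>x\<in>I. (H x)\<^sup>2)" using half unfolding swap by simp
  finally show ?thesis .
qed

context spiked
begin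

text \<open>There are \<open>L + 1\<close> possible lengths. One letter chooses between two labels
  and a vertex; the vertices have total weight at most \<open>L + \<kappa>\<close>, namely 1 for
  each of at most \<open>L\<close> vertices in \<open>S\<close> and \<open>1 / N\<close> for each of
  at most \<open>\<kappa> * N\<close> vertices.\<close>

definition walk_const :: "nat \<Rightarrow> real \<Rightarrow> real" where
  "walk_const L \<kappa> = (real L + 1) * (2 * (real L + \<kappa>)) ^ L"

text \<open>
  Weighting every vertex in \<open>S\<close> by \<open>N\<close> makes the sum over all walks factorise into a power of a single
  sum over vertices, which replaces counting walks by the size of the overlap.
\<close>

lemma sum_walks_le:
  assumes I: "finite I" "\<And>C. C \<in> I \<Longrightarrow> length C \<le> L \<and> verts C \<subseteq> V"
    and V: "real (card V) \<le> \<kappa> * N" and "1 \<le> \<kappa>" and S: "card S \<le> L" "finite S"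
  shows "(\<Sum>C\<in>I. N ^ length (filter (\<lambda>p. snd p \<in> S) C) / N ^ length C) \<le> walk_const L \<kappa>"
proof -
  let ?A = "(UNIV :: bool set) \<times> V"
  let ?f = "\<lambda>p :: bool \<times> nat. (if snd p \<in> S then N else 1) / N"
  let ?W = "\<lambda>l. {C :: walk. set C \<subseteq> ?A \<and> length C = l}"
  have finA: "finite ?A" using finite_V by simp
  have finW: "finite (?W l)" for l by (rule finite_lists_length_eq[OF finA])
  have eq: "N ^ length (filter (\<lambda>p. snd p \<in> S) C) / N ^ length C = prod_list (map ?f C)" for C :: walk
    unfolding prod_list_divide_const prod_list_filter_power ..
  have sumA: "(\<Sum>p\<in>?A. ?f p) \<le> 2 * (real L + \<kappa>)"
  proof -
    have "(\<Sum>p\<in>?A. ?f p) = 2 * (\<Sum>x\<in>V. (if x \<in> S then N else 1) / N)"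
    proof -
      have "(\<Sum>p\<in>?A. ?f p) = (\<Sum>(l, x)\<in>?A. (if x \<in> S then N else 1) / N)"
        by (simp add: case_prod_beta)
      also have "\<dots> = (\<Sum>l\<in>(UNIV :: bool set). \<Sum>x\<in>V. (if x \<in> S then N else 1) / N)"
        by (rule sum.cartesian_product[symmetric])
      finally show ?thesis by (simp add: UNIV_bool)
    qed
    also have "(\<Sum>x\<in>V. (if x \<in> S then N else 1) / N) \<le> (\<Sum>x\<in>V. of_bool (x \<in> S) + 1 / N)"
      using N by (intro sum_mono) auto
    also have "\<dots> = real (card (V \<inter> S)) + card V / N"
      using finite_V by (simp add: sum.distrib Int_def)
    also have "\<dots> \<le> real L + \<kappa>"
    proof (intro add_mono)
      show "real (card (V \<inter> S)) \<le> real L"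
        using card_mono[of S "V \<inter> S"] S by simp
      show "card V / N \<le> \<kappa>" using V N by (simp add: pos_divide_le_eq)
    qed
    finally show ?thesis by simp
  qed
  have nn: "0 \<le> prod_list (map ?f C)" for C
    using N by (intro prod_list_nonneg) auto
  have ge1: "1 \<le> 2 * (real L + \<kappa>)" using \<open>1 \<le> \<kappa>\<close> by simp
  have "(\<Sum>C\<in>I. N ^ length (filter (\<lambda>p. snd p \<in> S) C) / N ^ length C) = (\<Sum>C\<in>I. prod_list (map ?f C))"
    using eq by simp
  also have "\<dots> \<le> (\<Sum>C\<in>(\<Union>l\<in>{..L}. ?W l). prod_list (map ?f C))"
  proof (rule sum_mono2)
    show "finite (\<Union>l\<in>{..L}. ?W l)" using finW by blast
    show "I \<subseteq> (\<Union>l\<in>{..L}. ?W l)"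
    proof
      fix C assume "C \<in> I"
      then have "length C \<le> L" "snd ` set C \<subseteq> V" using I(2)[of C] by (auto simp: verts_def)
      then show "C \<in> (\<Union>l\<in>{..L}. ?W l)" by fastforce
    qed
  qed (rule nn)
  also have "\<dots> = (\<Sum>l\<le>L. \<Sum>C\<in>?W l. prod_list (map ?f C))"
    by (rule sum.UNION_disjoint) (use finW in auto)
  also have "\<dots> = (\<Sum>l\<le>L. (\<Sum>p\<in>?A. ?f p) ^ l)"
    by (intro sum.cong refl sum_lists_prod finA)
  also have "\<dots> \<le> (\<Sum>l\<le>L. (2 * (real L + \<kappa>)) ^ L)"
  proof (intro sum_mono)
    fix l assume "l \<in> {..L}"
    have "(\<Sum>p\<in>?A. ?f p) ^ l \<le> (2 * (real L + \<kappa>)) ^ l"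
      using N by (intro power_mono sumA sum_nonneg) auto
    also have "\<dots> \<le> (2 * (real L + \<kappa>)) ^ L"
      using \<open>l \<in> {..L}\<close> ge1 by (intro power_increasing) auto
    finally show "(\<Sum>p\<in>?A. ?f p) ^ l \<le> (2 * (real L + \<kappa>)) ^ L" .
  qed
  finally show ?thesis by (simp add: walk_const_def add.commute)
qed

definition cycle_sum :: "walk set \<Rightarrow> (walk \<Rightarrow> real) \<Rightarrow> 'a \<times> 'b \<Rightarrow> real" where
  "cycle_sum I H w = (\<Sum>C\<in>I. H C * cycle_prod C w)"

lemma
  assumes I: "finite I" "\<And>C. C \<in> I \<Longrightarrow> is_cycle C \<and> edges C \<subseteq> E0"
  shows cycle_sum_integrable: "integrable (P \<Otimes>\<^sub>M Q) (cycle_sum I H)"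
    and integral_cycle_sum: "(\<integral>w. cycle_sum I H w \<partial>(P \<Otimes>\<^sub>M Q)) = (\<Sum>C\<in>I. H C * mean C)"
    and cycle_sum_sq_integrable: "integrable (P \<Otimes>\<^sub>M Q) (\<lambda>w. (cycle_sum I H w)\<^sup>2)"
    and integral_cycle_sum_sq: "(\<integral>w. (cycle_sum I H w)\<^sup>2 \<partial>(P \<Otimes>\<^sub>M Q)) =
      (\<Sum>C\<in>I. \<Sum>C'\<in>I. H C * H C' * (\<integral>w. cycle_prod C w * cycle_prod C' w \<partial>(P \<Otimes>\<^sub>M Q)))"
proof -
  have sq: "(cycle_sum I H w)\<^sup>2 = (\<Sum>C\<in>I. \<Sum>C'\<in>I. H C * H C' * (cycle_prod C w * cycle_prod C' w))" for w
    unfolding cycle_sum_def power2_eq_square sum_product by (simp add: mult_ac)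
  show "integrable (P \<Otimes>\<^sub>M Q) (cycle_sum I H)"
    unfolding cycle_sum_def[abs_def] using I
    by (intro Bochner_Integration.integrable_sum integrable_mult_right cycle_prod_integrable) auto
  show "(\<integral>w. cycle_sum I H w \<partial>(P \<Otimes>\<^sub>M Q)) = (\<Sum>C\<in>I. H C * mean C)"
    unfolding cycle_sum_def using I
    by (subst Bochner_Integration.integral_sum)
      (auto intro!: integrable_mult_right cycle_prod_integrable simp: integral_cycle_prod)
  show "integrable (P \<Otimes>\<^sub>M Q) (\<lambda>w. (cycle_sum I H w)\<^sup>2)"
    unfolding sq using I
    by (intro Bochner_Integration.integrable_sum integrable_mult_right cycle_prods_integrable) auto
  have i2: "integrable (P \<Otimes>\<^sub>M Q) (\<lambda>w. H C * H C' * (cycle_prod C w * cycle_prod C' w))" if "C \<in> I" "C' \<in> I" for C C'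
    using I that by (intro integrable_mult_right cycle_prods_integrable) auto
  show "(\<integral>w. (cycle_sum I H w)\<^sup>2 \<partial>(P \<Otimes>\<^sub>M Q)) =
      (\<Sum>C\<in>I. \<Sum>C'\<in>I. H C * H C' * (\<integral>w. cycle_prod C w * cycle_prod C' w \<partial>(P \<Otimes>\<^sub>M Q)))"
    unfolding sq using i2
    by (simp add: Bochner_Integration.integral_sum Bochner_Integration.integrable_sum cong: sum.cong)
qed

definition error_const :: "nat \<Rightarrow> real \<Rightarrow> real" where
  "error_const L \<kappa> = moment_const L * (walk_const L \<kappa>)\<^sup>2"

text \<open>The three terms of \<open>second_moment_le\<close> are summed separately. Products of
  means rebuild the squared mean and cancel; pairs with equal edges are handled by
  \<open>sum_sym_relation\<close> with degree \<open>L ^ 2\<close>; overlaps are handled by two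
  applications of \<open>sum_walks_le\<close>. The last two results appear as main term and error
  term.\<close>

lemma variance_bound:
  assumes I: "finite I" "\<And>C. C \<in> I \<Longrightarrow> is_cycle C \<and> edges C \<subseteq> E0 \<and> length C \<le> L"
    and H: "\<And>C. C \<in> I \<Longrightarrow> 0 \<le> H C" "\<And>C. C \<in> I \<Longrightarrow> H C \<le> Hm / sqrt N ^ length C"
    and V: "real (card V) \<le> \<kappa> * N" and \<kappa>: "1 \<le> \<kappa>"
  shows "(\<integral>w. (cycle_sum I H w)\<^sup>2 \<partial>(P \<Otimes>\<^sub>M Q)) - (\<integral>w. cycle_sum I H w \<partial>(P \<Otimes>\<^sub>M Q))\<^sup>2
    \<le> (real L)\<^sup>2 * (1 + error_const L \<kappa> / N) * (\<Sum>C\<in>I. (H C)\<^sup>2) + error_const L \<kappa> * Hm\<^sup>2 / N"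
proof -
  have KL0: "0 \<le> moment_const L" unfolding moment_const_def using g K by simp
  have NW1: "1 \<le> walk_const L \<kappa>"
    unfolding walk_const_def using mult_mono[of 1 "real L + 1" 1 "(2 * (real L + \<kappa>)) ^ L"] \<kappa>
    by (simp add: one_le_power)
  have KR: "moment_const L \<le> error_const L \<kappa>"
    unfolding error_const_def using mult_left_mono[of 1 "(walk_const L \<kappa>)\<^sup>2" "moment_const L"] KL0 NW1 by (simp add: one_le_power)
  let ?q = "\<lambda>C C'. card (verts C \<inter> verts C')"
  let ?t = "\<lambda>C C'. N ^ ?q C C' / (N ^ length C * N ^ length C')"
  have mean_sq: "(\<Sum>C\<in>I. H C * mean C)\<^sup>2 = (\<Sum>C\<in>I. \<Sum>C'\<in>I. (H C * mean C) * (H C' * mean C'))"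
    unfolding power2_eq_square by (rule sum_product)
  have sq: "sqrt N ^ l * sqrt N ^ l = N ^ l" for l
    using N by (simp add: power_mult_distrib[symmetric])
  have "(\<integral>w. (cycle_sum I H w)\<^sup>2 \<partial>(P \<Otimes>\<^sub>M Q)) =
      (\<Sum>C\<in>I. \<Sum>C'\<in>I. H C * H C' * (\<integral>w. cycle_prod C w * cycle_prod C' w \<partial>(P \<Otimes>\<^sub>M Q)))"
    using I by (intro integral_cycle_sum_sq) auto
  also have "\<dots> \<le> (\<Sum>C\<in>I. \<Sum>C'\<in>I. (H C * mean C) * (H C' * mean C')
      + (1 + moment_const L / N) * (H C * H C' * of_bool (edges C = edges C')) + moment_const L * Hm\<^sup>2 / N * ?t C C')"
  proof (intro sum_mono)
    fix C C' assume C: "C \<in> I" "C' \<in> I"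
    let ?u = "moment_const L * N ^ ?q C C' / (N * sqrt N ^ (length C + length C'))"
    have "H C * H C' * (\<integral>w. cycle_prod C w * cycle_prod C' w \<partial>(P \<Otimes>\<^sub>M Q)) \<le> H C * H C' *
        (mean C * mean C' + of_bool (edges C = edges C') * (1 + moment_const L / N) + ?u)"
      using I(2)[OF C(1)] I(2)[OF C(2)] H(1) C
      by (intro mult_left_mono second_moment_le mult_nonneg_nonneg) auto
    also have "\<dots> = (H C * mean C) * (H C' * mean C')
      + (1 + moment_const L / N) * (H C * H C' * of_bool (edges C = edges C')) + H C * H C' * ?u"
      by (simp add: algebra_simps)
    \<comment> \<open>The size bound on \<open>H\<close> supplies one more power of
      \<open>sqrt N\<close> per edge, so that each cycle is weighted by
      \<open>1 / N ^ length\<close>, the form that \<open>sum_walks_le\<close> expects.\<close>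
    also have "H C * H C' * ?u \<le> (Hm / sqrt N ^ length C) * (Hm / sqrt N ^ length C') * ?u"
      using H C KL0 N by (intro mult_right_mono mult_mono) (auto intro: order_trans[OF H(1) H(2)])
    also have "\<dots> = moment_const L * Hm\<^sup>2 / N * (N ^ ?q C C' / ((sqrt N ^ length C * sqrt N ^ length C) * (sqrt N ^ length C' * sqrt N ^ length C')))"
      by (simp add: power_add power2_eq_square mult_ac)
    finally show "H C * H C' * (\<integral>w. cycle_prod C w * cycle_prod C' w \<partial>(P \<Otimes>\<^sub>M Q)) \<le> (H C * mean C) * (H C' * mean C')
      + (1 + moment_const L / N) * (H C * H C' * of_bool (edges C = edges C')) + moment_const L * Hm\<^sup>2 / N * ?t C C'"
      unfolding sq by simp
  qed
  also have "\<dots> = (\<Sum>C\<in>I. H C * mean C)\<^sup>2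
      + (1 + moment_const L / N) * (\<Sum>C\<in>I. \<Sum>C'\<in>I. H C * H C' * of_bool (edges C = edges C'))
      + moment_const L * Hm\<^sup>2 / N * (\<Sum>C\<in>I. \<Sum>C'\<in>I. ?t C C')"
    unfolding mean_sq sum.distrib by (simp only: sum_distrib_left)
  also have "(1 + moment_const L / N) * (\<Sum>C\<in>I. \<Sum>C'\<in>I. H C * H C' * of_bool (edges C = edges C'))
      \<le> (1 + error_const L \<kappa> / N) * ((real L)\<^sup>2 * (\<Sum>C\<in>I. (H C)\<^sup>2))"
  proof (rule mult_mono)
    show "1 + moment_const L / N \<le> 1 + error_const L \<kappa> / N" using KR N by (simp add: divide_right_mono)
    show "(\<Sum>C\<in>I. \<Sum>C'\<in>I. H C * H C' * of_bool (edges C = edges C')) \<le> (real L)\<^sup>2 * (\<Sum>C\<in>I. (H C)\<^sup>2)"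
    proof (rule sum_sym_relation[OF I(1)])
      fix C assume C: "C \<in> I"
      have "{C' \<in> I. edges C = edges C'} = {C' \<in> I. edges C' = edges C}" by auto
      then have "card {C' \<in> I. edges C = edges C'} \<le> (length C)\<^sup>2"
        using card_equal_edges[of C I] I(2) C by auto
      also have "\<dots> \<le> L\<^sup>2" using I(2)[OF C] by (intro power_mono) auto
      finally show "real (card {C' \<in> I. edges C = edges C'}) \<le> (real L)\<^sup>2"
        by (metis of_nat_mono of_nat_power)
    qed auto
    show "0 \<le> (\<Sum>C\<in>I. \<Sum>C'\<in>I. H C * H C' * of_bool (edges C = edges C'))"
      using H(1) by (intro sum_nonneg mult_nonneg_nonneg) auto
    show "0 \<le> 1 + error_const L \<kappa> / N" using KR KL0 N by simp
  qed
  also have "moment_const L * Hm\<^sup>2 / N * (\<Sum>C\<in>I. \<Sum>C'\<in>I. ?t C C') \<le> moment_const L * Hm\<^sup>2 / N * (walk_const L \<kappa>)\<^sup>2"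
  proof (rule mult_left_mono)
    have vs: "length C \<le> L \<and> verts C \<subseteq> V" if "C \<in> I" for C
      using I(2)[OF that] verts_subset_V[of C] by auto
    have "(\<Sum>C\<in>I. \<Sum>C'\<in>I. ?t C C') = (\<Sum>C\<in>I. 1 / N ^ length C * (\<Sum>C'\<in>I. N ^ length (filter (\<lambda>p. snd p \<in> verts C) C') / N ^ length C'))"
      using I by (auto simp: sum_distrib_left card_verts_Int intro!: sum.cong)
    also have "\<dots> \<le> (\<Sum>C\<in>I. 1 / N ^ length C * walk_const L \<kappa>)"
      using N I(2) V \<kappa> vs
      by (intro sum_mono mult_left_mono sum_walks_le I(1)) (auto simp: card_verts)
    \<comment> \<open>After the inner sum with \<open>S = verts C\<close>, the outer sum is the same
      kind of sum with empty \<open>S\<close>.\<close>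
    also have "\<dots> = (\<Sum>C\<in>I. N ^ length (filter (\<lambda>p. snd p \<in> {}) C) / N ^ length C) * walk_const L \<kappa>"
      by (simp add: sum_distrib_right)
    also have "\<dots> \<le> walk_const L \<kappa> * walk_const L \<kappa>"
      using NW1 V \<kappa> vs by (intro mult_right_mono sum_walks_le I(1)) auto
    finally show "(\<Sum>C\<in>I. \<Sum>C'\<in>I. ?t C C') \<le> (walk_const L \<kappa>)\<^sup>2" by (simp add: power2_eq_square)
    show "0 \<le> moment_const L * Hm\<^sup>2 / N" using KL0 N by simp
  qed
  also have "moment_const L * Hm\<^sup>2 / N * (walk_const L \<kappa>)\<^sup>2 = error_const L \<kappa> * Hm\<^sup>2 / N" by (simp add: error_const_def)
  finally show ?thesis
    using integral_cycle_sum[OF I(1), of H] I(2) by (simp add: algebra_simps)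
qed

end

section \<open>Block words\<close>

text \<open>\<open>p\<close> is the label whose spike strength is to be estimated. As every block
  ends in its only \<open>p\<close>, the first letter of a word follows a \<open>p\<close>
  cyclically, and an additional \<open>p\<close> in front changes no label transition: it multiplies
  the mean by exactly one factor.\<close>

definition block :: "bool \<Rightarrow> nat \<Rightarrow> bool list" where
  "block p k = replicate k (\<not> p) @ [p]"

definition word :: "bool \<Rightarrow> nat list \<Rightarrow> bool list" where
  "word p ks = concat (map (block p) ks)"

definition stretch :: "nat \<Rightarrow> 'l list \<Rightarrow> 'l list" where
  "stretch e w = concat (map (replicate e) w)"

lemma word_simps [simp]: "word p [] = []" "word p (k # ks) = block p k @ word p ks"
  by (simp_all add: word_def)

lemma stretch_simps [simp]: "stretch e [] = []" "stretch e (l # w) = replicate e l @ stretch e w"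
  by (simp_all add: stretch_def)

lemma length_stretch [simp]: "length (stretch e w) = e * length w"
  by (induction w) (auto simp: algebra_simps)

lemma length_word_le: "length (word p ks) \<le> length ks * M" if "set ks \<subseteq> {..<M}"
  using that by (induction ks) (auto simp: block_def)

lemma length_word_ge: "length ks \<le> length (word p ks)"
  by (induction ks) (auto simp: block_def)

lemma last_word: "ks \<noteq> [] \<Longrightarrow> last (word p ks) = p"
proof (induction ks)
  case (Cons k ks)
  have "word p ks = [] \<longleftrightarrow> ks = []" by (cases ks) (auto simp: block_def)
  then show ?case using Cons.IH by (simp add: last_append block_def)
qed simp

lemma last_stretch: "0 < e \<Longrightarrow> w \<noteq> [] \<Longrightarrow> last (stretch e w) = last w"
proof (induction w)
  case (Cons l w)
  have "stretch e w = [] \<longleftrightarrow> w = []" using Cons.prems by (cases w) auto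
  then show ?case using Cons by (simp add: last_append)
qed simp

text \<open>Blocks form a prefix code, since \<open>k\<close> is the number of letters before the
  first \<open>p\<close>. Hence different block lists give different walks, and the statistic is a
  sum over a set of cycles.\<close>

lemma block_append_inject: "block p k @ u = block p k' @ v \<Longrightarrow> k = k' \<and> u = v"
proof (induction k arbitrary: k')
  case 0
  then show ?case by (cases k') (auto simp: block_def)
next
  case (Suc k)
  then show ?case by (cases k') (auto simp: block_def)
qed

lemma word_inject: "word p ks = word p ks' \<longleftrightarrow> ks = ks'"
proof
  have ne: "block p k @ u \<noteq> []" for k u by (simp add: block_def)
  show "word p ks = word p ks' \<Longrightarrow> ks = ks'"
  proof (induction ks arbitrary: ks')
    case Nil
    then show ?case using ne by (cases ks') auto
  next
    case (Cons k ks)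
    show ?case
    proof (cases ks')
      case Nil
      then show ?thesis using Cons.prems ne[of k "word p ks"] by simp
    next
      case (Cons k' v)
      then have "block p k @ word p ks = block p k' @ word p v" using Cons.prems by simp
      then have "k = k' \<and> word p ks = word p v" by (rule block_append_inject)
      then show ?thesis using Cons.IH Cons by simp
    qed
  qed
qed simp

lemma stretch_inject: "0 < e \<Longrightarrow> stretch e w = stretch e w' \<longleftrightarrow> w = w'"
proof
  assume e: "0 < e"
  show "stretch e w = stretch e w' \<Longrightarrow> w = w'"
  proof (induction w arbitrary: w')
    case Nil
    then show ?case using e by (cases w') auto
  next
    case (Cons l w)
    obtain e' where e': "e = Suc e'" using e by (cases e) auto
    show ?case
    proof (cases w')
      case Nil
      then show ?thesis using Cons.prems e' by simp
    next
      case (Cons l' v)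
      then have eq: "replicate e l @ stretch e w = replicate e l' @ stretch e v" using Cons.prems by simp
      then have "replicate e l = replicate e l'" "stretch e w = stretch e v"
        unfolding append_eq_append_conv[OF disjI1[of "length (replicate e l) = length (replicate e l')"], OF length_replicate[THEN trans, OF length_replicate[symmetric]]] by auto
      then show ?thesis using Cons.IH Cons e' by simp
    qed
  qed
qed simp

text \<open>The mean of an open path, where \<open>v\<close> is the label of the preceding edge.\<close>

fun path_weight :: "(bool \<Rightarrow> real) \<Rightarrow> real \<Rightarrow> bool \<Rightarrow> bool list \<Rightarrow> real" where
  "path_weight h \<rho> v [] = 1"
| "path_weight h \<rho> v (l # w) = h l * (if v = l then 1 else \<rho>) * path_weight h \<rho> l w"

lemma path_weight_conv_prod:
  "path_weight h \<rho> v w = (\<Prod>t<length w. h (w ! t)) * (\<Prod>t<length w. if (v # w) ! t = w ! t then 1 else \<rho>)"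
proof (induction w arbitrary: v)
  case (Cons l w)
  then show ?case
    by (simp add: prod.lessThan_Suc_shift del: prod.lessThan_Suc)
qed simp

lemma path_weight_replicate_append:
  "path_weight h \<rho> v (replicate (Suc e) l @ w) = h l ^ Suc e * (if v = l then 1 else \<rho>) * path_weight h \<rho> l w"
proof (induction e arbitrary: v)
  case (Suc e)
  have "path_weight h \<rho> v (replicate (Suc (Suc e)) l @ w)
      = h l * (if v = l then 1 else \<rho>) * path_weight h \<rho> l (replicate (Suc e) l @ w)" by simp
  also have "\<dots> = h l ^ Suc (Suc e) * (if v = l then 1 else \<rho>) * path_weight h \<rho> l w"
    unfolding Suc.IH by simp
  finally show ?case .
qed simp

lemma path_weight_stretch: "0 < e \<Longrightarrow> path_weight h \<rho> v (stretch e w) = path_weight (\<lambda>l. h l ^ e) \<rho> v w"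
proof (induction w arbitrary: v)
  case (Cons l w)
  then show ?case using path_weight_replicate_append[of h \<rho> v "e - 1" l "stretch e w"] by simp
qed simp

text \<open>A block with \<open>k > 0\<close> changes the label twice, away from \<open>p\<close>
  and back, whence the square of \<rho>; a block with \<open>k = 0\<close> does not change
  it.\<close>

definition block_weight :: "(bool \<Rightarrow> real) \<Rightarrow> real \<Rightarrow> bool \<Rightarrow> nat \<Rightarrow> real" where
  "block_weight h \<rho> p k = (if k = 0 then h p else h p * \<rho>\<^sup>2 * h (\<not> p) ^ k)"

lemma path_weight_block_append: "path_weight h \<rho> p (block p k @ w) = block_weight h \<rho> p k * path_weight h \<rho> p w"
proof (cases k)
  case (Suc k')
  then show ?thesis
    using path_weight_replicate_append[of h \<rho> p k' "\<not> p" "p # w"]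
    by (simp add: block_def block_weight_def power2_eq_square mult_ac)
qed (simp add: block_def block_weight_def)

lemma path_weight_word: "path_weight h \<rho> p (word p ks) = prod_list (map (block_weight h \<rho> p) ks)"
  by (induction ks) (simp_all add: path_weight_block_append)

text \<open>
  The parameter \<open>e\<close> selects the model: \<open>e = 1\<close> is the Wigner model (with \<open>m = n\<close>), \<open>e = 2\<close> the Wishart
  model, in which vertices \<open>0, \<dots>, n - 1\<close> are rows and \<open>n, \<dots>, n + m - 1\<close> columns.  There every letter of
  a word is read twice, along a step from a column to a row and the step back to a column, because
  \<open>u\<close> and \<open>v\<close> are independent and so a label change at a row has mean \<open>0\<close>.
\<close>

definition columns :: "nat \<Rightarrow> nat \<Rightarrow> nat \<Rightarrow> nat set" where
  "columns e n m = (if e = 1 then {..<n} else {n..<n + m})"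

definition vertex_lists :: "nat \<Rightarrow> nat \<Rightarrow> nat \<Rightarrow> nat \<Rightarrow> nat list set" where
  "vertex_lists e n m l = {xs. length xs = l \<and> distinct xs \<and>
     (\<forall>t<l. xs ! t \<in> (if even t then columns e n m else {..<n}))}"

text \<open>The condition \<open>x \<noteq> y\<close> keeps the walks off the diagonal, where a GOE
  entry has twice the variance.\<close>

definition model_keys :: "nat \<Rightarrow> nat \<Rightarrow> nat \<Rightarrow> (bool \<times> nat set) set" where
  "model_keys e n m = {k. \<exists>x y. x \<in> columns e n m \<and> y < n \<and> x \<noteq> y \<and> snd k = {x, y}}"

lemma finite_vertex_lists: "finite (vertex_lists e n m l)"
proof (rule finite_subset)
  show "vertex_lists e n m l \<subseteq> {xs. set xs \<subseteq> columns e n m \<union> {..<n} \<and> length xs = l}"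
  proof
    fix xs assume xs: "xs \<in> vertex_lists e n m l"
    have "x \<in> columns e n m \<union> {..<n}" if x: "x \<in> set xs" for x
    proof -
      obtain t where "t < l" "x = xs ! t" using x xs by (auto simp: vertex_lists_def in_set_conv_nth)
      moreover from this have "xs ! t \<in> (if even t then columns e n m else {..<n})"
        using xs unfolding vertex_lists_def by blast
      ultimately show ?thesis by (simp split: if_splits)
    qed
    then show "xs \<in> {xs. set xs \<subseteq> columns e n m \<union> {..<n} \<and> length xs = l}"
      using xs by (auto simp: vertex_lists_def)
  qed
  show "finite {xs. set xs \<subseteq> columns e n m \<union> {..<n} \<and> length xs = l}"
    by (rule finite_lists_length_eq) (simp add: columns_def)
qed

text \<open>The vertices are chosen one after another; at position \<open>t\<close> at most
  \<open>t\<close> candidates are already taken. The truncated subtraction makes the bound trivially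
  true in small dimensions.\<close>

lemma card_vertex_lists_ge:
  "(\<Prod>t<l. card (if even t then columns e n m else {..<n}) - t) \<le> card (vertex_lists e n m l)"
proof (induction l)
  case 0
  have "vertex_lists e n m 0 = {[]}" by (auto simp: vertex_lists_def)
  then show ?case by simp
next
  case (Suc l)
  let ?S = "if even l then columns e n m else {..<n}"
  let ?D = "SIGMA xs:vertex_lists e n m l. ?S - set xs"
  have finS: "finite ?S" by (simp add: columns_def)
  have "(\<lambda>(xs, x). xs @ [x]) ` ?D \<subseteq> vertex_lists e n m (Suc l)"
  proof safe
    fix xs x assume xs: "xs \<in> vertex_lists e n m l" and x: "x \<in> ?S" "x \<notin> set xs"
    have "(xs @ [x]) ! t \<in> (if even t then columns e n m else {..<n})" if "t < Suc l" for t
    proof (cases "t = l")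
      case True
      then show ?thesis using x xs by (simp add: nth_append vertex_lists_def)
    next
      case False
      then have "t < l" using that by simp
      then have "xs ! t \<in> (if even t then columns e n m else {..<n})" "(xs @ [x]) ! t = xs ! t"
        using xs by (auto simp: vertex_lists_def nth_append)
      then show ?thesis by simp
    qed
    then show "xs @ [x] \<in> vertex_lists e n m (Suc l)" using xs x by (simp add: vertex_lists_def)
  qed
  moreover have "inj_on (\<lambda>(xs, x). xs @ [x]) ?D" by (auto simp: inj_on_def)
  ultimately have "card ?D \<le> card (vertex_lists e n m (Suc l))"
    using card_inj_on_le[of "\<lambda>(xs, x). xs @ [x]" ?D "vertex_lists e n m (Suc l)"] finite_vertex_lists by blast
  moreover have "card ?D = (\<Sum>xs\<in>vertex_lists e n m l. card (?S - set xs))"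
    by (rule card_SigmaI) (use finite_vertex_lists finS in auto)
  moreover have "(\<Sum>xs\<in>vertex_lists e n m l. card (?S - set xs)) \<ge> (\<Sum>xs\<in>vertex_lists e n m l. card ?S - l)"
  proof (rule sum_mono)
    fix xs assume "xs \<in> vertex_lists e n m l"
    then have "card (set xs) \<le> l" using card_length[of xs] by (auto simp: vertex_lists_def)
    then show "card ?S - l \<le> card (?S - set xs)"
      using diff_card_le_card_Diff[of "set xs" ?S] by simp
  qed
  ultimately have "card (vertex_lists e n m l) * (card ?S - l) \<le> card (vertex_lists e n m (Suc l))" by simp
  with Suc.IH show ?case
    by (simp only: prod.lessThan_Suc) (meson le_trans mult_le_mono1)
qed

text \<open>In the Wishart case the alternation between columns and rows must survive the edge that
  closes the cycle, hence the even length.\<close>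

lemma vertex_lists_cycle:
  assumes e: "e = 1 \<or> (e = 2 \<and> even l)" and x: "x \<in> vertex_lists e n m l" and l: "3 \<le> l" and W: "length W = l"
  shows "is_cycle (zip W x)" "edges (zip W x) \<subseteq> model_keys e n m" "length (zip W x) = l"
    "map fst (zip W x) = W" "map snd (zip W x) = x"
proof -
  have lx: "length x = l" "distinct x" using x by (auto simp: vertex_lists_def)
  show len: "length (zip W x) = l" and "map fst (zip W x) = W" and snd: "map snd (zip W x) = x"
    using lx W by simp_all
  show cyc: "is_cycle (zip W x)" unfolding is_cycle_def len snd using lx l by simp
  show "edges (zip W x) \<subseteq> model_keys e n m"
  proof
    fix k assume "k \<in> edges (zip W x)"
    then obtain t where t: "t < l" "k = edge_key (zip W x) t" unfolding edges_def len by auto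
    let ?s = "Suc t mod l"
    have s: "?s < l" "?s \<noteq> t" using t l by (auto simp: Suc_mod_eq)
    have k: "snd k = {x ! t, x ! ?s}" using t s lx W by (simp add: edge_key_def)
    have ne: "x ! t \<noteq> x ! ?s" using s t lx by (simp add: nth_eq_iff_index_eq)
    have in1: "x ! u \<in> (if even u then columns e n m else {..<n})" if "u < l" for u
      using x that by (auto simp: vertex_lists_def)
    show "k \<in> model_keys e n m"
    proof (cases "e = 1")
      case True
      then have "x ! t < n" "x ! ?s < n" using in1[OF t(1)] in1[OF s(1)] by (auto simp: columns_def split: if_splits)
      then show ?thesis using k ne True by (auto simp: model_keys_def columns_def)
    next
      case False
      then have ev: "even l" using e by simp
      have par: "even ?s \<longleftrightarrow> odd t" using t ev by (auto simp: Suc_mod_eq)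
      show ?thesis
      proof (cases "even t")
        case True
        then have "x ! t \<in> columns e n m" "x ! ?s < n" using in1[OF t(1)] in1[OF s(1)] par by auto
        then show ?thesis using k ne by (auto simp: model_keys_def)
      next
        case False
        then have "x ! ?s \<in> columns e n m" "x ! t < n" using in1[OF t(1)] in1[OF s(1)] par by auto
        then show ?thesis
          using k ne unfolding model_keys_def
          by (intro CollectI exI[of _ "x ! ?s"] exI[of _ "x ! t"]) (auto simp: insert_commute)
      qed
    qed
  qed
qed

section \<open>Cycle statistics\<close>

definition block_lists :: "nat list \<Rightarrow> nat \<Rightarrow> nat list set" where
  "block_lists c J = {ks. set ks \<subseteq> {..<length c} \<and> length ks = J}"

definition list_weight :: "nat list \<Rightarrow> nat list \<Rightarrow> real" where
  "list_weight c ks = prod_list (map (\<lambda>k. real (c ! k)) ks)"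

text \<open>Rows have the smaller vertex numbers in the Wishart case, so \<open>Min\<close> is the
  row and \<open>Max\<close>, shifted by \<open>n\<close>, the column. In the Wigner case this reads
  the upper triangle.\<close>

definition matrix_entry :: "nat \<Rightarrow> nat \<Rightarrow> bool \<times> nat set \<Rightarrow> rmat \<times> rmat \<Rightarrow> real" where
  "matrix_entry e n k uv = (if fst k then fst uv else snd uv)
     (Min (snd k), Max (snd k) - (if e = 1 then 0 else n))"

text \<open>The product of \<open>l\<close> matrix entries along a walk has mean equal to the path
  weight divided by \<open>m ^ l\<close>. The prefactor undoes this and averages over vertex lists,
  so each word contributes its path weight times its list weight.\<close>

definition cycle_stat :: "nat \<Rightarrow> nat \<Rightarrow> nat \<Rightarrow> bool \<Rightarrow> bool list \<Rightarrow> nat list \<Rightarrow> nat \<Rightarrow> rmat \<times> rmat \<Rightarrow> real" where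
  "cycle_stat e n m p pre c J uv = (\<Sum>ks\<in>block_lists c J. let W = stretch e (pre @ word p ks); l = length W in
     list_weight c ks * (real m ^ l / real (card (vertex_lists e n m l))) *
       (\<Sum>x\<in>vertex_lists e n m l. \<Prod>k\<in>edges (zip W x). matrix_entry e n k uv))"

definition block_signal :: "nat list \<Rightarrow> (nat \<Rightarrow> real) \<Rightarrow> real" where
  "block_signal c f = (\<Sum>k<length c. real (c ! k) * f k)"

text \<open>A block of index \<open>k\<close> has \<open>Suc k\<close> letters, and the variance of
  a normalised walk average is of order q per letter: it is \<open>m ^ l\<close> over the number of
  vertex lists.\<close>

definition block_noise :: "nat list \<Rightarrow> real \<Rightarrow> real" where
  "block_noise c q = (\<Sum>k<length c. (real (c ! k))\<^sup>2 * q ^ Suc k)"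

lemma block_signal_nonneg: "(\<And>k. 0 \<le> f k) \<Longrightarrow> 0 \<le> block_signal c f"
  unfolding block_signal_def by (intro sum_nonneg) auto

lemma finite_block_lists: "finite (block_lists c J)"
  unfolding block_lists_def by (rule finite_lists_length_eq) simp

lemma list_weight_nonneg: "0 \<le> list_weight c ks"
  unfolding list_weight_def by (intro prod_list_nonneg) auto

lemma sum_block_lists: "(\<Sum>ks\<in>block_lists c J. prod_list (map f ks)) = (\<Sum>k<length c. f k :: real) ^ J"
  unfolding block_lists_def by (rule sum_lists_prod) simp

lemma prod_list_map_mult:
  "prod_list (map (\<lambda>k. f k * g k :: real) ks) = prod_list (map f ks) * prod_list (map g ks)"
  by (induction ks) auto

lemma list_weight_sq: "(list_weight c ks)\<^sup>2 = prod_list (map (\<lambda>k. (real (c ! k))\<^sup>2) ks)"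
  unfolding list_weight_def by (induction ks) (auto simp: power_mult_distrib)

lemma power_length_word: "q ^ length (word p ks) = prod_list (map (\<lambda>k. q ^ Suc k :: real) ks)"
  by (induction ks) (auto simp: block_def power_add)

lemma list_weight_le: "ks \<in> block_lists c J \<Longrightarrow> list_weight c ks \<le> (block_signal c (\<lambda>_. 1)) ^ J"
proof -
  have "list_weight c ks \<le> (block_signal c (\<lambda>_. 1)) ^ length ks" if "set ks \<subseteq> {..<length c}" for ks
    using that
  proof (induction ks)
    case (Cons k ks)
    have "real (c ! k) \<le> block_signal c (\<lambda>_. 1)"
      unfolding block_signal_def using Cons.prems member_le_sum[of k "{..<length c}" "\<lambda>k. real (c ! k)"] by simp
    then have "real (c ! k) * list_weight c ks \<le> block_signal c (\<lambda>_. 1) * block_signal c (\<lambda>_. 1) ^ length ks"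
      using Cons list_weight_nonneg by (intro mult_mono) auto
    then show ?case by (simp add: list_weight_def)
  qed (simp add: list_weight_def)
  then show "ks \<in> block_lists c J \<Longrightarrow> list_weight c ks \<le> (block_signal c (\<lambda>_. 1)) ^ J" by (auto simp: block_lists_def)
qed

text \<open>Odd positions are the rows of the Wishart model. No label changes there, so the
  vanishing correlation of \<open>u\<close> and \<open>v\<close> never enters a mean.\<close>

lemma nth_stretch_2_odd: "t < length (stretch 2 w) \<Longrightarrow> odd t \<Longrightarrow> stretch 2 w ! t = stretch 2 w ! (t - 1)"
proof (induction w arbitrary: t)
  case (Cons l w)
  have r: "stretch 2 (l # w) = l # l # stretch 2 w" by (simp add: numeral_2_eq_2)
  consider "t = 1" | u where "t = Suc (Suc u)" "odd u"
  proof (cases t)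
    case 0
    then show ?thesis using Cons.prems(2) by simp
  next
    case (Suc t')
    then show ?thesis using Cons.prems(2) that by (cases t') auto
  qed
  then show ?case
  proof cases
    case 1
    then show ?thesis unfolding r by simp
  next
    case 2
    then obtain v where v: "u = Suc v" by (cases u) auto
    have "stretch 2 w ! u = stretch 2 w ! (u - 1)" using Cons.IH[of u] Cons.prems 2 by simp
    then show ?thesis unfolding r using 2 v by simp
  qed
qed simp

locale spiked_app = spiked P Q xi Z "{..<n} \<union> columns e n m" "model_keys e n m" gam r "real m" g K
  for P :: "'a measure" and Q :: "'b measure" and xi Z gam r g K and e n m :: nat +
  fixes \<rho> :: real
  assumes e: "e = 1 \<and> n = m \<or> e = 2"
    and r_cols: "\<And>x. x \<in> columns e n m \<Longrightarrow> r x = \<rho>"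
begin

lemma e_pos: "0 < e" using e by auto

text \<open>Label changes occur only at columns, where the correlation is always \<rho>; the mean
  therefore does not depend on the vertices visited.\<close>

lemma mean_zip:
  assumes x: "x \<in> vertex_lists e n m (e * length w)" and w: "w \<noteq> []"
  shows "mean (zip (stretch e w) x) = path_weight (\<lambda>l. gam l ^ e) \<rho> (last w) w / sqrt m ^ (e * length w)"
proof -
  let ?W = "stretch e w" and ?l = "e * length w"
  have lx: "length x = ?l" using x by (simp add: vertex_lists_def)
  have "vertex_corr (x ! t) ((last ?W # ?W) ! t) (?W ! t) = (if (last ?W # ?W) ! t = ?W ! t then 1 else \<rho>)"
    if t: "t < ?l" for t
  proof (cases "(last ?W # ?W) ! t = ?W ! t")
    case False
    have xt: "x ! t \<in> (if even t then columns e n m else {..<n})" using x t unfolding vertex_lists_def by blast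
    have "x ! t \<in> columns e n m"
    proof (cases "e = 1 \<or> even t")
      case True
      then show ?thesis using xt by (auto simp: columns_def split: if_splits)
    next
      case F: False
      then have "e = 2" "odd t" using e by auto
      then have "(last ?W # ?W) ! t = ?W ! t" using nth_stretch_2_odd[of t w] t by (cases t) auto
      then show ?thesis using False by simp
    qed
    then show ?thesis using False by (simp add: vertex_corr_def r_cols)
  qed (simp add: vertex_corr_def)
  then have "mean (zip ?W x) = (\<Prod>t<?l. gam (?W ! t) / sqrt m) *
      (\<Prod>t<?l. if (last ?W # ?W) ! t = ?W ! t then 1 else \<rho>)"
    unfolding mean_def using lx by simp
  also have "\<dots> = path_weight gam \<rho> (last ?W) ?W / sqrt m ^ ?l"
    by (simp add: path_weight_conv_prod prod_dividef)
  also have "path_weight gam \<rho> (last ?W) ?W = path_weight (\<lambda>l. gam l ^ e) \<rho> (last w) w"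
    using last_stretch[OF e_pos w] path_weight_stretch[OF e_pos] by simp
  finally show ?thesis .
qed

definition full_word :: "bool \<Rightarrow> bool list \<Rightarrow> nat list \<Rightarrow> bool list" where
  "full_word p pre ks = pre @ word p ks"

definition walk_index :: "bool \<Rightarrow> bool list \<Rightarrow> nat list \<Rightarrow> nat \<Rightarrow> (nat list \<times> nat list) set" where
  "walk_index p pre c J = Sigma (block_lists c J) (\<lambda>ks. vertex_lists e n m (e * length (full_word p pre ks)))"

definition walk_of :: "bool \<Rightarrow> bool list \<Rightarrow> nat list \<times> nat list \<Rightarrow> walk" where
  "walk_of p pre = (\<lambda>(ks, x). zip (stretch e (full_word p pre ks)) x)"

text \<open>Here \<open>sqrt m\<close> replaces the \<open>m\<close> of \<open>cycle_stat\<close>,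
  because \<open>X\<close> is a matrix entry multiplied by \<open>sqrt m\<close>.\<close>

definition walk_coeff :: "bool \<Rightarrow> bool list \<Rightarrow> nat list \<Rightarrow> nat list \<times> nat list \<Rightarrow> real" where
  "walk_coeff p pre c = (\<lambda>(ks, x). list_weight c ks * (sqrt m ^ (e * length (full_word p pre ks)) /
     card (vertex_lists e n m (e * length (full_word p pre ks)))))"

definition model_stat :: "bool \<Rightarrow> bool list \<Rightarrow> nat list \<Rightarrow> nat \<Rightarrow> 'a \<times> 'b \<Rightarrow> real" where
  "model_stat p pre c J w = (\<Sum>s\<in>walk_index p pre c J. walk_coeff p pre c s * cycle_prod (walk_of p pre s) w)"

lemma finite_walk_index: "finite (walk_index p pre c J)"
  unfolding walk_index_def by (intro finite_SigmaI finite_block_lists finite_vertex_lists)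

lemma inj_walk_of: "inj_on (walk_of p pre) (walk_index p pre c J)"
proof (rule inj_onI, clarify)
  fix ks x ks' x' assume s: "(ks, x) \<in> walk_index p pre c J" "(ks', x') \<in> walk_index p pre c J"
    and eq: "walk_of p pre (ks, x) = walk_of p pre (ks', x')"
  have l: "length (stretch e (full_word p pre ks)) = length x" "length (stretch e (full_word p pre ks')) = length x'"
    using s by (auto simp: walk_index_def vertex_lists_def)
  have z: "zip (stretch e (full_word p pre ks)) x = zip (stretch e (full_word p pre ks')) x'" using eq by (simp add: walk_of_def)
  have "stretch e (full_word p pre ks) = stretch e (full_word p pre ks')"
    using map_fst_zip[OF l(1)] map_fst_zip[OF l(2)] unfolding z by metis
  moreover have "x = x'"
    using map_snd_zip[OF l(1)] map_snd_zip[OF l(2)] unfolding z by metis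
  ultimately have "stretch e (full_word p pre ks) = stretch e (full_word p pre ks')" "x = x'" by simp_all
  then have "full_word p pre ks = full_word p pre ks'" using stretch_inject[OF e_pos] by blast
  then show "ks = ks' \<and> x = x'" using \<open>x = x'\<close> by (simp add: full_word_def word_inject)
qed

lemma model_stat_cycle_sum:
  "model_stat p pre c J w = cycle_sum (walk_of p pre ` walk_index p pre c J) (walk_coeff p pre c \<circ> inv_into (walk_index p pre c J) (walk_of p pre)) w"
  unfolding model_stat_def cycle_sum_def sum.reindex[OF inj_walk_of]
  by (intro sum.cong refl) (simp add: inv_into_f_f[OF inj_walk_of])

lemma length_full_word_le:
  assumes "ks \<in> block_lists c J" "length pre \<le> 1"
  shows "length (full_word p pre ks) \<le> 1 + J * length c" "J \<le> length (full_word p pre ks)"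
  using length_word_le[of ks "length c" p] length_word_ge[of ks p] assms
  by (auto simp: full_word_def block_lists_def)

lemma path_weight_full_word:
  assumes "ks \<noteq> []" and pre: "pre = [] \<or> pre = [p]"
  shows "path_weight h \<rho> (last (full_word p pre ks)) (full_word p pre ks) = h p ^ length pre * prod_list (map (block_weight h \<rho> p) ks)"
proof -
  have "word p ks \<noteq> []" using assms(1) by (cases ks) (auto simp: block_def)
  then have "last (full_word p pre ks) = p" using last_word[OF assms(1)] by (simp add: full_word_def)
  then show ?thesis using pre by (auto simp: full_word_def path_weight_word)
qed

text \<open>All sums over block lists factorise into J-th powers: the means give
  \<open>block_signal\<close>, and the squared coefficients give \<open>block_noise\<close>.
  \<open>\<kappa>\<close> arises from \<open>n + m \<le> (1 / q + 1) * m\<close>, the 1 in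
  \<open>L\<close> from the possible additional letter, and the factors 2 from the hypothesis on the
  number of vertex lists.\<close>

lemma model_stat_moments:
  fixes p c J pre q
  defines "L \<equiv> e * (1 + J * length c)" and "\<kappa> \<equiv> 1 + 1 / q"
  defines "Hm \<equiv> 2 * block_signal c (\<lambda>_. 1) ^ J * (1 + q) ^ (1 + J * length c)"
  assumes J: "3 \<le> J" and q: "0 < q" "real n \<le> real m / q" and pre: "pre = [] \<or> pre = [p]"
    and vertex_lists: "\<And>l. l \<le> 1 + J * length c \<Longrightarrow> 0 < card (vertex_lists e n m (e * l))"
      "\<And>l. l \<le> 1 + J * length c \<Longrightarrow> real m ^ (e * l) \<le> 2 * q ^ l * card (vertex_lists e n m (e * l))"
  shows "integrable (P \<Otimes>\<^sub>M Q) (model_stat p pre c J)"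
    and "integrable (P \<Otimes>\<^sub>M Q) (\<lambda>w. (model_stat p pre c J w)\<^sup>2)"
    and "(\<integral>w. model_stat p pre c J w \<partial>(P \<Otimes>\<^sub>M Q))
      = gam p ^ (e * length pre) * block_signal c (block_weight (\<lambda>l. gam l ^ e) \<rho> p) ^ J"
    and "(\<integral>w. (model_stat p pre c J w)\<^sup>2 \<partial>(P \<Otimes>\<^sub>M Q)) - (\<integral>w. model_stat p pre c J w \<partial>(P \<Otimes>\<^sub>M Q))\<^sup>2
      \<le> (real L)\<^sup>2 * (1 + error_const L \<kappa> / m) * (2 * q ^ length pre * block_noise c q ^ J) + error_const L \<kappa> * Hm\<^sup>2 / m"
proof -
  let ?S = "walk_index p pre c J" and ?F = "walk_of p pre" and ?H = "walk_coeff p pre c"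
  let ?I = "?F ` ?S" and ?h = "?H \<circ> inv_into ?S ?F"
  let ?l = "\<lambda>ks. e * length (full_word p pre ks)"
  have prel: "length pre \<le> 1" using pre by auto
  have m1: "1 \<le> real m" by (rule N)
  have sq: "sqrt m ^ l * sqrt m ^ l = real m ^ l" for l
    by (simp add: power_mult_distrib[symmetric])
  have el: "e = 1 \<or> (e = 2 \<and> even (?l ks))" for ks using e by auto
  have l3: "3 \<le> ?l ks" if "ks \<in> block_lists c J" for ks
  proof -
    have "1 * J \<le> ?l ks" using length_full_word_le(2)[OF that prel] e_pos by (intro mult_le_mono) auto
    then show ?thesis using J by simp
  qed
  have lL: "?l ks \<le> L" if "ks \<in> block_lists c J" for ks
    unfolding L_def by (intro mult_le_mono2 length_full_word_le(1)[OF that prel])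
  have lXV: "0 < card (vertex_lists e n m (?l ks))"
    "real m ^ ?l ks \<le> 2 * q ^ length (full_word p pre ks) * card (vertex_lists e n m (?l ks))" if "ks \<in> block_lists c J" for ks
    by (rule vertex_lists length_full_word_le(1)[OF that prel])+
  have cyc: "is_cycle (?F (ks, x))" "edges (?F (ks, x)) \<subseteq> model_keys e n m" "length (?F (ks, x)) = ?l ks"
    if "(ks, x) \<in> ?S" for ks x
    using that vertex_lists_cycle[OF el, of x n m ks "stretch e (full_word p pre ks)"] l3[of ks] by (auto simp: walk_index_def walk_of_def)
  have I: "finite ?I" "\<And>C. C \<in> ?I \<Longrightarrow> is_cycle C \<and> edges C \<subseteq> model_keys e n m \<and> length C \<le> L"
  proof -
    show "finite ?I" by (intro finite_imageI finite_walk_index)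
    fix C assume "C \<in> ?I"
    then obtain ks x where s: "(ks, x) \<in> ?S" "C = ?F (ks, x)" by auto
    moreover from s(1) have "ks \<in> block_lists c J" by (simp add: walk_index_def)
    ultimately show "is_cycle C \<and> edges C \<subseteq> model_keys e n m \<and> length C \<le> L"
      using cyc[OF s(1)] lL[of ks] by simp
  qed
  have h: "?h (?F s) = ?H s" if "s \<in> ?S" for s by (simp add: inv_into_f_f[OF inj_walk_of that])
  have H0: "0 \<le> ?H s" for s by (cases s) (simp add: walk_coeff_def list_weight_nonneg)
  have ratio: "real m ^ ?l ks / card (vertex_lists e n m (?l ks)) \<le> 2 * q ^ length (full_word p pre ks)" if "ks \<in> block_lists c J" for ks
    using lXV[OF that] by (simp add: pos_divide_le_eq)
  \<comment> \<open>The weight of a list is at most the J-th power of the sum of all weights, and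
    the normalisation costs at most \<open>2 * (1 + q)\<close> to the maximal length, up to the
    placement of the 2 outside the power.\<close>
  have Hle: "?H (ks, x) \<le> Hm / sqrt m ^ ?l ks" if "ks \<in> block_lists c J" for ks x
  proof -
    have "?H (ks, x) * sqrt m ^ ?l ks = list_weight c ks * (real m ^ ?l ks / card (vertex_lists e n m (?l ks)))"
      unfolding walk_coeff_def case_prod_conv sq[symmetric] by simp
    also have "\<dots> \<le> block_signal c (\<lambda>_. 1) ^ J * (2 * q ^ length (full_word p pre ks))"
      by (intro mult_mono list_weight_le[OF that] ratio[OF that]) (auto intro!: zero_le_power block_signal_nonneg)
    also have "q ^ length (full_word p pre ks) \<le> (1 + q) ^ length (full_word p pre ks)"
      using q by (intro power_mono) auto
    also have "\<dots> \<le> (1 + q) ^ (1 + J * length c)"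
      using q length_full_word_le(1)[OF that prel] by (intro power_increasing) auto
    finally have "?H (ks, x) * sqrt m ^ ?l ks \<le> block_signal c (\<lambda>_. 1) ^ J * (2 * (1 + q) ^ (1 + J * length c))"
      by (simp add: block_signal_nonneg mult_left_mono)
    then have "?H (ks, x) * sqrt m ^ ?l ks \<le> Hm"
      unfolding Hm_def by (simp add: mult_ac)
    then show ?thesis using m1 by (simp add: pos_le_divide_eq)
  qed
  have TTeq: "model_stat p pre c J = cycle_sum ?I ?h" by (rule ext) (rule model_stat_cycle_sum)
  have I': "\<And>C. C \<in> ?I \<Longrightarrow> is_cycle C \<and> edges C \<subseteq> model_keys e n m" using I(2) by blast
  show "integrable (P \<Otimes>\<^sub>M Q) (model_stat p pre c J)"
    unfolding TTeq by (rule cycle_sum_integrable[OF I(1) I'])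
  show "integrable (P \<Otimes>\<^sub>M Q) (\<lambda>w. (model_stat p pre c J w)\<^sup>2)"
    unfolding TTeq by (rule cycle_sum_sq_integrable[OF I(1) I'])
  have "(\<integral>w. model_stat p pre c J w \<partial>(P \<Otimes>\<^sub>M Q)) = (\<Sum>C\<in>?I. ?h C * mean C)"
    unfolding TTeq by (rule integral_cycle_sum[OF I(1) I'])
  also have "\<dots> = (\<Sum>s\<in>?S. ?H s * mean (?F s))"
    unfolding sum.reindex[OF inj_walk_of] by (intro sum.cong refl) (simp add: inv_into_f_f[OF inj_walk_of])
  also have "\<dots> = (\<Sum>ks\<in>block_lists c J. \<Sum>x\<in>vertex_lists e n m (?l ks). ?H (ks, x) * mean (?F (ks, x)))"
    unfolding walk_index_def by (subst sum.Sigma) (auto simp: finite_block_lists finite_vertex_lists)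
  also have "\<dots> = (\<Sum>ks\<in>block_lists c J. gam p ^ (e * length pre) * prod_list (map (\<lambda>k. real (c ! k) * block_weight (\<lambda>l. gam l ^ e) \<rho> p k) ks))"
  proof (intro sum.cong refl)
    fix ks assume ks: "ks \<in> block_lists c J"
    have "3 \<le> length (full_word p pre ks)" using J length_full_word_le(2)[OF ks prel, of p] by simp
    then have ne: "ks \<noteq> []" "full_word p pre ks \<noteq> []"
      using ks J by (auto simp: block_lists_def)
    have "(\<Sum>x\<in>vertex_lists e n m (?l ks). ?H (ks, x) * mean (?F (ks, x)))
        = (\<Sum>x\<in>vertex_lists e n m (?l ks). list_weight c ks * path_weight (\<lambda>l. gam l ^ e) \<rho> (last (full_word p pre ks)) (full_word p pre ks)
            / card (vertex_lists e n m (?l ks)))"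
      using m1 by (intro sum.cong refl) (simp add: walk_coeff_def walk_of_def mean_zip[OF _ ne(2)])
    also have "\<dots> = list_weight c ks * path_weight (\<lambda>l. gam l ^ e) \<rho> (last (full_word p pre ks)) (full_word p pre ks)"
      using lXV(1)[OF ks] by simp
    finally show "(\<Sum>x\<in>vertex_lists e n m (?l ks). ?H (ks, x) * mean (?F (ks, x)))
        = gam p ^ (e * length pre) * prod_list (map (\<lambda>k. real (c ! k) * block_weight (\<lambda>l. gam l ^ e) \<rho> p k) ks)"
      unfolding path_weight_full_word[OF ne(1) pre] prod_list_map_mult list_weight_def by (simp add: power_mult)
  qed
  also have "\<dots> = gam p ^ (e * length pre) * block_signal c (block_weight (\<lambda>l. gam l ^ e) \<rho> p) ^ J"
    unfolding sum_distrib_left[symmetric] sum_block_lists block_signal_def ..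
  finally show "(\<integral>w. model_stat p pre c J w \<partial>(P \<Otimes>\<^sub>M Q))
      = gam p ^ (e * length pre) * block_signal c (block_weight (\<lambda>l. gam l ^ e) \<rho> p) ^ J" .
  have V: "real (card ({..<n} \<union> columns e n m)) \<le> \<kappa> * real m"
  proof -
    have "real (card ({..<n} \<union> columns e n m)) \<le> real n + real m"
      using e card_Un_le[of "{..<n}" "columns e n m"] by (auto simp: columns_def)
    then show ?thesis using q by (simp add: \<kappa>_def algebra_simps)
  qed
  have var: "(\<integral>w. (model_stat p pre c J w)\<^sup>2 \<partial>(P \<Otimes>\<^sub>M Q)) - (\<integral>w. model_stat p pre c J w \<partial>(P \<Otimes>\<^sub>M Q))\<^sup>2
    \<le> (real L)\<^sup>2 * (1 + error_const L \<kappa> / real m) * (\<Sum>C\<in>?I. (?h C)\<^sup>2) + error_const L \<kappa> * Hm\<^sup>2 / real m"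
    unfolding TTeq
  proof (rule variance_bound[OF I _ _ V])
    fix C assume "C \<in> ?I"
    then obtain ks x where s: "(ks, x) \<in> ?S" "C = ?F (ks, x)" by auto
    then show "0 \<le> ?h C" "?h C \<le> Hm / sqrt (real m) ^ length C"
      using h[OF s(1)] H0 Hle[of ks x] cyc(3)[OF s(1)] by (auto simp: walk_index_def)
  qed (use q in \<open>simp_all add: \<kappa>_def\<close>)
  have "(\<Sum>C\<in>?I. (?h C)\<^sup>2) = (\<Sum>s\<in>?S. (?H s)\<^sup>2)"
    unfolding sum.reindex[OF inj_walk_of] by (intro sum.cong refl) (simp add: inv_into_f_f[OF inj_walk_of])
  also have "\<dots> = (\<Sum>ks\<in>block_lists c J. \<Sum>x\<in>vertex_lists e n m (?l ks). (?H (ks, x))\<^sup>2)"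
    unfolding walk_index_def by (subst sum.Sigma) (auto simp: finite_block_lists finite_vertex_lists)
  also have "\<dots> \<le> (\<Sum>ks\<in>block_lists c J. 2 * q ^ length pre * prod_list (map (\<lambda>k. (real (c ! k))\<^sup>2 * q ^ Suc k) ks))"
  proof (intro sum_mono)
    fix ks assume ks: "ks \<in> block_lists c J"
    \<comment> \<open>Summing over the vertex lists cancels one of the two normalising denominators
      in the squared coefficient.\<close>
    have "(\<Sum>x\<in>vertex_lists e n m (?l ks). (?H (ks, x))\<^sup>2) = (list_weight c ks)\<^sup>2 * (real m ^ ?l ks / card (vertex_lists e n m (?l ks)))"
      using lXV(1)[OF ks] unfolding walk_coeff_def case_prod_conv
      by (simp add: power_mult_distrib power_divide power2_eq_square sq)
    also have "\<dots> \<le> (list_weight c ks)\<^sup>2 * (2 * q ^ length (full_word p pre ks))"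
      by (intro mult_left_mono ratio[OF ks]) auto
    also have "\<dots> = 2 * q ^ length pre * prod_list (map (\<lambda>k. (real (c ! k))\<^sup>2 * q ^ Suc k) ks)"
      unfolding prod_list_map_mult list_weight_sq full_word_def length_append power_add power_length_word by simp
    finally show "(\<Sum>x\<in>vertex_lists e n m (?l ks). (?H (ks, x))\<^sup>2)
        \<le> 2 * q ^ length pre * prod_list (map (\<lambda>k. (real (c ! k))\<^sup>2 * q ^ Suc k) ks)" .
  qed
  also have "\<dots> = 2 * q ^ length pre * block_noise c q ^ J"
    unfolding sum_distrib_left[symmetric] sum_block_lists block_noise_def ..
  finally have S2: "(\<Sum>C\<in>?I. (?h C)\<^sup>2) \<le> 2 * q ^ length pre * block_noise c q ^ J" .
  have "0 \<le> error_const L \<kappa>" unfolding error_const_def moment_const_def using g K by simp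
  then have "(real L)\<^sup>2 * (1 + error_const L \<kappa> / real m) * (\<Sum>C\<in>?I. (?h C)\<^sup>2)
      \<le> (real L)\<^sup>2 * (1 + error_const L \<kappa> / real m) * (2 * q ^ length pre * block_noise c q ^ J)"
    by (intro mult_left_mono S2) auto
  with var show "(\<integral>w. (model_stat p pre c J w)\<^sup>2 \<partial>(P \<Otimes>\<^sub>M Q)) - (\<integral>w. model_stat p pre c J w \<partial>(P \<Otimes>\<^sub>M Q))\<^sup>2
      \<le> (real L)\<^sup>2 * (1 + error_const L \<kappa> / m) * (2 * q ^ length pre * block_noise c q ^ J) + error_const L \<kappa> * Hm\<^sup>2 / m"
    by linarith
qed

lemma cycle_stat_eq_model_stat:
  assumes matrix_entry: "\<And>k. k \<in> model_keys e n m \<Longrightarrow> matrix_entry e n k uv = X k w / sqrt m" and J: "3 \<le> J"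
  shows "cycle_stat e n m p pre c J uv = model_stat p pre c J w"
proof -
  have m1: "1 \<le> real m" by (rule N)
  have el: "e = 1 \<or> (e = 2 \<and> even (e * length (full_word p pre ks)))" for ks using e by auto
  have sq: "real m ^ l = sqrt m ^ l * sqrt m ^ l" for l
    by (simp add: power_mult_distrib[symmetric])
  have "model_stat p pre c J w = (\<Sum>ks\<in>block_lists c J. \<Sum>x\<in>vertex_lists e n m (e * length (full_word p pre ks)).
      walk_coeff p pre c (ks, x) * cycle_prod (walk_of p pre (ks, x)) w)"
    unfolding model_stat_def walk_index_def by (subst sum.Sigma) (auto simp: finite_block_lists finite_vertex_lists)
  also have "\<dots> = cycle_stat e n m p pre c J uv"
    unfolding cycle_stat_def Let_def full_word_def[symmetric] length_stretch sum_distrib_left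
  proof (intro sum.cong refl)
    fix ks x assume ks: "ks \<in> block_lists c J" and x: "x \<in> vertex_lists e n m (e * length (full_word p pre ks))"
    let ?l = "e * length (full_word p pre ks)"
    have "J \<le> length (word p ks)" using ks length_word_ge[of ks p] by (simp add: block_lists_def)
    then have "1 * J \<le> ?l" unfolding full_word_def using e_pos by (intro mult_le_mono) auto
    then have "3 \<le> ?l" using J by simp
    note cyc = vertex_lists_cycle[OF el x this length_stretch]
    have "(\<Prod>k\<in>edges (zip (stretch e (full_word p pre ks)) x). matrix_entry e n k uv)
        = (\<Prod>k\<in>edges (zip (stretch e (full_word p pre ks)) x). X k w / sqrt m)"
      using cyc(2) by (intro prod.cong refl matrix_entry) auto
    also have "\<dots> = cycle_prod (walk_of p pre (ks, x)) w / sqrt m ^ ?l"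
      unfolding prod_dividef using card_edges[OF cyc(1)] cyc(3) by (simp add: cycle_prod_def walk_of_def)
    finally show "walk_coeff p pre c (ks, x) * cycle_prod (walk_of p pre (ks, x)) w =
        list_weight c ks * (real m ^ ?l / real (card (vertex_lists e n m ?l))) *
        (\<Prod>k\<in>edges (zip (stretch e (full_word p pre ks)) x). matrix_entry e n k uv)"
      using m1 by (simp add: walk_coeff_def sq)
  qed
  finally show ?thesis ..
qed

end

section \<open>A least-squares ratio estimator\<close>

text \<open>The quotient minimises the sum of \<open>(B i - b * A i) ^ 2 / S i\<close> over b. Each
  residual, scaled by its own noise, has bounded mean, so the total is of order \<open>J\<close>
  whatever the lists are. The denominator is at least the contribution of the good index
  \<open>i0\<close>, which need not be known; \<open>t\<close> is its signal-to-noise ratio reduced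
  by \<open>J ^ 2\<close>.\<close>

lemma (in prob_space) ratio_estimator_prob:
  fixes A B :: "nat \<Rightarrow> 'a \<Rightarrow> real" and S mu :: "nat \<Rightarrow> real"
  assumes int: "\<And>i. i < J \<Longrightarrow> integrable M (A i)" "\<And>i. i < J \<Longrightarrow> integrable M (\<lambda>x. (A i x)\<^sup>2)"
      "\<And>i. i < J \<Longrightarrow> integrable M (B i)" "\<And>i. i < J \<Longrightarrow> integrable M (\<lambda>x. (B i x)\<^sup>2)"
    and EA: "\<And>i. i < J \<Longrightarrow> expectation (A i) = mu i" and EB: "\<And>i. i < J \<Longrightarrow> expectation (B i) = a * mu i"
    and VA: "\<And>i. i < J \<Longrightarrow> expectation (\<lambda>x. (A i x)\<^sup>2) - (mu i)\<^sup>2 \<le> C * S i"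
    and VB: "\<And>i. i < J \<Longrightarrow> expectation (\<lambda>x. (B i x)\<^sup>2) - (a * mu i)\<^sup>2 \<le> C * S i"
    and S: "\<And>i. i < J \<Longrightarrow> 0 \<le> S i" and C: "0 \<le> C"
    and i0: "i0 < J" "0 < S i0" "0 < mu i0"
    and t: "t = (mu i0)\<^sup>2 / (S i0 * (real J)\<^sup>2)"
  shows "1 - (2 * C * (1 + a\<^sup>2) / real J + 4 * C / t)
    \<le> prob {x \<in> space M. \<bar>(\<Sum>i<J. A i x * B i x / S i) / (\<Sum>i<J. (A i x)\<^sup>2 / S i) - a\<bar> \<le> 2 / sqrt t}"
proof -
  have J: "0 < real J" using i0 by simp
  have t0: "0 < t" unfolding t using i0 J by simp
  have meas: "A i \<in> borel_measurable M" "B i \<in> borel_measurable M" if "i < J" for i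
    using int(1,3)[OF that] by auto
  define D where "D x = (\<Sum>i<J. (B i x - a * A i x)\<^sup>2 / S i)" for x
  define G where "G x = (\<Sum>i<J. (A i x)\<^sup>2 / S i)" for x
  define F where "F x = (\<Sum>i<J. A i x * B i x / S i)" for x
  have sum_meas: "(\<lambda>x. \<Sum>i<J. h i x) \<in> borel_measurable M"
    if "\<And>i. i < J \<Longrightarrow> h i \<in> borel_measurable M" for h :: "nat \<Rightarrow> 'a \<Rightarrow> real"
    using that by (intro borel_measurable_sum) auto
  have Dm: "D \<in> borel_measurable M" and Gm: "G \<in> borel_measurable M" and Fm: "F \<in> borel_measurable M"
    unfolding D_def[abs_def] G_def[abs_def] F_def[abs_def]
    by (intro sum_meas borel_measurable_divide borel_measurable_power borel_measurable_diff
        borel_measurable_times borel_measurable_const meas; assumption)+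
  have dev: "integrable M (\<lambda>x. (h x - c)\<^sup>2)" "expectation (\<lambda>x. (h x - c)\<^sup>2) = expectation (\<lambda>x. (h x)\<^sup>2) - c\<^sup>2"
    if "integrable M h" "integrable M (\<lambda>x. (h x)\<^sup>2)" "expectation h = c" for h :: "'a \<Rightarrow> real" and c
  proof -
    have *: "(h x - c)\<^sup>2 = (h x)\<^sup>2 - ((2 * c) * h x - c\<^sup>2)" for x by (simp add: power2_diff)
    have i: "integrable M (\<lambda>x. (2 * c) * h x - c\<^sup>2)"
      using that by (intro Bochner_Integration.integrable_diff integrable_mult_right) auto
    show "integrable M (\<lambda>x. (h x - c)\<^sup>2)"
      unfolding * by (intro Bochner_Integration.integrable_diff that i)
    show "expectation (\<lambda>x. (h x - c)\<^sup>2) = expectation (\<lambda>x. (h x)\<^sup>2) - c\<^sup>2"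
      unfolding * using that i
      by (simp add: Bochner_Integration.integral_diff prob_space power2_eq_square)
  qed
  have devA: "integrable M (\<lambda>x. (A i x - mu i)\<^sup>2)" "expectation (\<lambda>x. (A i x - mu i)\<^sup>2) \<le> C * S i" if "i < J" for i
    using dev[OF int(1)[OF that] int(2)[OF that] EA[OF that]] VA[OF that] by auto
  have devB: "integrable M (\<lambda>x. (B i x - a * mu i)\<^sup>2)" "expectation (\<lambda>x. (B i x - a * mu i)\<^sup>2) \<le> C * S i" if "i < J" for i
    using dev[OF int(3)[OF that] int(4)[OF that] EB[OF that]] VB[OF that] by auto
  have summand: "integrable M (\<lambda>x. (B i x - a * A i x)\<^sup>2) \<and>
      expectation (\<lambda>x. (B i x - a * A i x)\<^sup>2) \<le> 2 * C * (1 + a\<^sup>2) * S i" if i: "i < J" for i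
  proof -
    let ?u = "\<lambda>x. 2 * (B i x - a * mu i)\<^sup>2 + 2 * a\<^sup>2 * (A i x - mu i)\<^sup>2"
    have le: "(B i x - a * A i x)\<^sup>2 \<le> ?u x" for x
    proof -
      have "(b - c)\<^sup>2 \<le> 2 * b\<^sup>2 + 2 * c\<^sup>2" for b c :: real
        using zero_le_power2[of "b + c"] by (simp add: power2_sum power2_diff)
      moreover have "B i x - a * mu i - a * (A i x - mu i) = B i x - a * A i x"
        by (simp add: algebra_simps)
      ultimately have "(B i x - a * A i x)\<^sup>2 \<le> 2 * (B i x - a * mu i)\<^sup>2 + 2 * (a * (A i x - mu i))\<^sup>2"
        by metis
      then show ?thesis by (simp add: power_mult_distrib mult.assoc)
    qed
    have iu: "integrable M ?u"
      using devA(1)[OF i] devB(1)[OF i] by (intro Bochner_Integration.integrable_add integrable_mult_right)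
    have int: "integrable M (\<lambda>x. (B i x - a * A i x)\<^sup>2)"
    proof (rule Bochner_Integration.integrable_bound[OF iu])
      show "(\<lambda>x. (B i x - a * A i x)\<^sup>2) \<in> borel_measurable M"
        using meas[OF i] by measurable
      show "AE x in M. norm ((B i x - a * A i x)\<^sup>2) \<le> norm (?u x)"
        by (intro AE_I2) (use le in \<open>auto intro: order_trans\<close>)
    qed
    have "expectation (\<lambda>x. (B i x - a * A i x)\<^sup>2) \<le> expectation ?u"
      by (rule integral_mono[OF int iu le])
    also have "\<dots> = 2 * expectation (\<lambda>x. (B i x - a * mu i)\<^sup>2) + 2 * a\<^sup>2 * expectation (\<lambda>x. (A i x - mu i)\<^sup>2)"
      using devA(1)[OF i] devB(1)[OF i] by (subst Bochner_Integration.integral_add) auto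
    also have "\<dots> \<le> 2 * (C * S i) + 2 * a\<^sup>2 * (C * S i)"
      using devA(2)[OF i] devB(2)[OF i] by (intro add_mono mult_left_mono) auto
    finally show ?thesis using int by (simp add: algebra_simps)
  qed
  have Dint: "integrable M D"
    unfolding D_def[abs_def] using summand by (intro Bochner_Integration.integrable_sum) auto
  have "expectation D = (\<Sum>i<J. expectation (\<lambda>x. (B i x - a * A i x)\<^sup>2) / S i)"
    unfolding D_def using summand by (subst Bochner_Integration.integral_sum) auto
  also have "\<dots> \<le> (\<Sum>i<J. 2 * C * (1 + a\<^sup>2))"
  proof (intro sum_mono)
    fix i assume "i \<in> {..<J}"
    \<comment> \<open>If \<open>S i = 0\<close>, the quotient is 0 by the convention for
      division.\<close>
    then show "expectation (\<lambda>x. (B i x - a * A i x)\<^sup>2) / S i \<le> 2 * C * (1 + a\<^sup>2)"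
      using summand[of i] S[of i] C by (cases "S i = 0") (auto simp: divide_le_eq)
  qed
  finally have ED: "expectation D \<le> real J * (2 * C * (1 + a\<^sup>2))" by simp
  have D0: "0 \<le> D x" for x unfolding D_def using S by (intro sum_nonneg) auto
  \<comment> \<open>The threshold \<open>J ^ 2\<close> exceeds the mean of \<open>D\<close>, of
    order \<open>J\<close>, by a factor \<open>J\<close>, so that Markov leaves probability
    \<open>O(1 / J)\<close>. The second event is treated by Chebyshev for the good index
    alone.\<close>
  define bad1 where "bad1 = {x \<in> space M. (real J)\<^sup>2 \<le> D x}"
  define bad2 where "bad2 = {x \<in> space M. (mu i0 / 2)\<^sup>2 \<le> (A i0 x - mu i0)\<^sup>2}"
  have "prob bad1 \<le> expectation D / (real J)\<^sup>2"
    unfolding bad1_def using Dint D0 J by (intro integral_Markov_inequality_measure[where A = "space M" and u = D, simplified]) auto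
  also have "\<dots> \<le> real J * (2 * C * (1 + a\<^sup>2)) / (real J)\<^sup>2"
    using ED by (intro divide_right_mono) auto
  also have "\<dots> = 2 * C * (1 + a\<^sup>2) / real J"
    using J by (simp add: power2_eq_square)
  finally have p1: "prob bad1 \<le> 2 * C * (1 + a\<^sup>2) / real J" .
  have "prob bad2 \<le> expectation (\<lambda>x. (A i0 x - mu i0)\<^sup>2) / (mu i0 / 2)\<^sup>2"
    unfolding bad2_def using devA(1)[OF i0(1)] i0
    by (intro integral_Markov_inequality_measure[where A = "space M", simplified]) auto
  also have "\<dots> \<le> C * S i0 / (mu i0 / 2)\<^sup>2"
    using devA(2)[OF i0(1)] by (intro divide_right_mono) auto
  also have "\<dots> = 4 * C * S i0 / (mu i0)\<^sup>2" by (simp add: power_divide)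
  also have "\<dots> = 4 * C / t / (real J)\<^sup>2" unfolding t using i0 J by (simp add: field_simps)
  also have "\<dots> \<le> 4 * C / t / 1"
  proof -
    have "1 \<le> (real J)\<^sup>2" using i0(1) by (intro one_le_power) simp
    then show ?thesis using C t0 J by (intro divide_left_mono) auto
  qed
  finally have p2: "prob bad2 \<le> 4 * C / t" by simp
  let ?good = "{x \<in> space M. \<bar>F x / G x - a\<bar> \<le> 2 / sqrt t}"
  have good_ev: "?good \<in> events"
    using Fm Gm by measurable
  have bad_ev: "bad1 \<in> events" "bad2 \<in> events"
    unfolding bad1_def bad2_def using Dm meas[OF i0(1)] by measurable
  have "space M - (bad1 \<union> bad2) \<subseteq> ?good"
  proof (intro subsetI CollectI conjI)
    fix x assume x: "x \<in> space M - (bad1 \<union> bad2)"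
    then show "x \<in> space M" by simp
    have DJ: "D x \<le> (real J)\<^sup>2" using x by (auto simp: bad1_def)
    have "(A i0 x - mu i0)\<^sup>2 < (mu i0 / 2)\<^sup>2" using x by (auto simp: bad2_def)
    then have "\<bar>A i0 x - mu i0\<bar> < mu i0 / 2"
      using i0(3) by (metis abs_le_square_iff abs_of_pos half_gt_zero not_less)
    then have Age: "mu i0 / 2 \<le> A i0 x" by linarith
    have "(mu i0 / 2)\<^sup>2 / S i0 \<le> (A i0 x)\<^sup>2 / S i0"
      using Age i0 by (intro divide_right_mono power_mono) auto
    also have "\<dots> \<le> G x"
      unfolding G_def using i0(1) S member_le_sum[of i0 "{..<J}" "\<lambda>i. (A i x)\<^sup>2 / S i"] by auto
    finally have Gge: "(mu i0)\<^sup>2 / (4 * S i0) \<le> G x" by (simp add: power_divide)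
    have "0 < (mu i0)\<^sup>2 / (4 * S i0)" using i0 by simp
    then have G0: "0 < G x" using Gge by linarith
    \<comment> \<open>Dividing both factors by \<open>sqrt (S i)\<close> prepares Cauchy-Schwarz:
      the two sums of squares are \<open>G\<close> and \<open>D\<close>.\<close>
    have num: "F x - a * G x = (\<Sum>i<J. (A i x / sqrt (S i)) * ((B i x - a * A i x) / sqrt (S i)))"
      unfolding F_def G_def sum_distrib_left sum_subtractf[symmetric] using S
      by (intro sum.cong refl) (simp add: power2_eq_square diff_divide_distrib[symmetric] algebra_simps)
    have "(F x - a * G x)\<^sup>2 \<le> (\<Sum>i<J. (A i x / sqrt (S i))\<^sup>2) * (\<Sum>i<J. ((B i x - a * A i x) / sqrt (S i))\<^sup>2)"
      unfolding num by (rule Cauchy_Schwarz_ineq_sum)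
    also have "\<dots> = G x * D x" unfolding G_def D_def using S by (simp add: power_divide)
    finally have cs: "(F x - a * G x)\<^sup>2 \<le> G x * D x" .
    have "(F x / G x - a)\<^sup>2 = (F x - a * G x)\<^sup>2 / (G x)\<^sup>2"
      using G0 by (simp add: power_divide[symmetric] diff_divide_distrib)
    also have "\<dots> \<le> G x * D x / (G x)\<^sup>2" using cs by (intro divide_right_mono) auto
    also have "\<dots> = D x / G x" using G0 by (simp add: power2_eq_square)
    also have "\<dots> \<le> (real J)\<^sup>2 / ((mu i0)\<^sup>2 / (4 * S i0))"
      using DJ Gge i0 D0 by (intro frac_le) auto
    also have "\<dots> = 4 / t" unfolding t using i0 J by (simp add: field_simps)
    also have "\<dots> = (2 / sqrt t)\<^sup>2" using t0 by (simp add: power_divide)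
    finally have "(F x / G x - a)\<^sup>2 \<le> (2 / sqrt t)\<^sup>2" .
    then show "\<bar>F x / G x - a\<bar> \<le> 2 / sqrt t"
      using t0 by (metis abs_le_square_iff abs_of_pos divide_pos_pos real_sqrt_gt_zero zero_less_numeral)
  qed
  then have "prob (space M - (bad1 \<union> bad2)) \<le> prob ?good"
    by (rule finite_measure_mono[OF _ good_ev])
  moreover have "prob (space M - (bad1 \<union> bad2)) = 1 - prob (bad1 \<union> bad2)"
    using bad_ev by (intro prob_compl) auto
  moreover have "prob (bad1 \<union> bad2) \<le> prob bad1 + prob bad2"
    by (rule measure_Un_le) (use bad_ev in auto)
  ultimately show ?thesis using p1 p2 unfolding F_def G_def by linarith
qed

lemma whp_consistentI:
  assumes P: "\<forall>\<^sub>F n in sequentially. prob_space (P n)"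
    and bound: "\<forall>\<^sub>F n in sequentially. 1 - \<eta> n \<le> measure (P n) {x \<in> space (P n). \<bar>estimator n x - \<theta>\<bar> \<le> \<delta> n}"
    and lim: "\<eta> \<longlonglongrightarrow> 0" "\<delta> \<longlonglongrightarrow> 0"
  shows "whp_consistent P estimator \<theta>"
  unfolding whp_consistent_def
proof (intro exI[of _ \<delta>] conjI lim(2))
  show "(\<lambda>n. measure (P n) {x \<in> space (P n). \<bar>estimator n x - \<theta>\<bar> \<le> \<delta> n}) \<longlonglongrightarrow> 1"
  proof (rule tendsto_sandwich[OF bound])
    show "\<forall>\<^sub>F n in sequentially. measure (P n) {x \<in> space (P n). \<bar>estimator n x - \<theta>\<bar> \<le> \<delta> n} \<le> 1"
      using P by eventually_elim (rule prob_space.prob_le_1)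
    show "(\<lambda>n. 1 - \<eta> n) \<longlonglongrightarrow> 1" using tendsto_diff[OF tendsto_const lim(1), of 1] by simp
    show "(\<lambda>n. 1 :: real) \<longlonglongrightarrow> 1" by simp
  qed
qed

section \<open>The signal above the threshold\<close>

lemma block_noise_nonneg: "0 \<le> q \<Longrightarrow> 0 \<le> block_noise c q"
  unfolding block_noise_def by (intro sum_nonneg) auto

lemma block_noise_eq_0_imp: "0 < q \<Longrightarrow> block_noise c q = 0 \<Longrightarrow> block_signal c f = 0"
proof -
  assume q: "0 < q" and 0: "block_noise c q = 0"
  have "real (c ! k) = 0" if "k < length c" for k
  proof -
    have "(real (c ! k))\<^sup>2 * q ^ Suc k = 0"
      using 0 q that unfolding block_noise_def by (subst (asm) sum_nonneg_eq_0_iff) auto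
    then show ?thesis using q by simp
  qed
  then show ?thesis unfolding block_signal_def by (intro sum.neutral) auto
qed

text \<open>
  The best weights are \<open>s k * \<tau> ^ Suc k\<close>; only their ratios matter, so integer parts of large multiples
  are almost as good.
\<close>

lemma exists_integer_weights:
  fixes s :: "nat \<Rightarrow> real"
  assumes tau: "0 < \<tau>" and s: "\<And>k. 0 \<le> s k"
    and gt: "1 < (\<Sum>k<M. (s k)\<^sup>2 * \<tau> ^ Suc k)"
  shows "\<exists>c :: nat list. 0 < block_noise c (1 / \<tau>) \<and> block_noise c (1 / \<tau>) < (block_signal c s)\<^sup>2"
proof -
  define T where "T = (\<Sum>k<M. (s k)\<^sup>2 * \<tau> ^ Suc k)"
  define U where "U = (\<Sum>k<M. s k)"
  have T1: "1 < T" using gt by (simp add: T_def)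
  have sT: "sqrt T < T" using T1 by (simp add: real_less_rsqrt real_less_lsqrt power2_eq_square)
  \<comment> \<open>Rounding down costs at most \<open>U\<close> of the signal \<open>R * T\<close>,
    while the noise is at most \<open>R ^ 2 * T\<close>. So \<open>R * (T - sqrt T) > U\<close> is
    needed, and \<open>R\<close> makes the left side equal to \<open>U + 1\<close>.\<close>
  define R where "R = (U + 1) / (T - sqrt T)"
  have U0: "0 \<le> U" unfolding U_def using s by (intro sum_nonneg) auto
  have R0: "0 < R" unfolding R_def using sT U0 by (intro divide_pos_pos) auto
  define c where "c = map (\<lambda>k. nat \<lfloor>R * s k * \<tau> ^ Suc k\<rfloor>) [0..<M]"
  have y0: "0 \<le> R * s k * \<tau> ^ Suc k" for k using R0 s tau by simp
  have ck: "real (c ! k) \<le> R * s k * \<tau> ^ Suc k" "R * s k * \<tau> ^ Suc k - 1 \<le> real (c ! k)" if "k < M" for k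
    using that y0[of k] by (auto simp: c_def)
  have len: "length c = M" by (simp add: c_def)
  have lower: "R * T - U \<le> block_signal c s"
  proof -
    have "R * T - U = (\<Sum>k<M. (R * s k * \<tau> ^ Suc k - 1) * s k)"
      unfolding T_def U_def sum_distrib_left sum_subtractf[symmetric]
      by (intro sum.cong refl) (simp add: power2_eq_square algebra_simps)
    also have "\<dots> \<le> block_signal c s"
      unfolding block_signal_def len using ck s by (intro sum_mono mult_right_mono) auto
    finally show ?thesis .
  qed
  have upper: "block_noise c (1 / \<tau>) \<le> R\<^sup>2 * T"
  proof -
    have "block_noise c (1 / \<tau>) \<le> (\<Sum>k<M. (R * s k * \<tau> ^ Suc k)\<^sup>2 * (1 / \<tau>) ^ Suc k)"
      unfolding block_noise_def len using ck tau by (intro sum_mono mult_right_mono power_mono) auto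
    also have "\<dots> = R\<^sup>2 * T"
      unfolding T_def sum_distrib_left using tau
      by (intro sum.cong refl) (simp add: power2_eq_square power_one_over field_simps)
    finally show ?thesis .
  qed
  have "R * (T - sqrt T) = U + 1" unfolding R_def using sT by simp
  then have "R * sqrt T < R * T - U" by (simp add: algebra_simps)
  moreover have "0 \<le> R * sqrt T" using R0 T1 by simp
  ultimately have "(R * sqrt T)\<^sup>2 < (block_signal c s)\<^sup>2" and cs: "0 < block_signal c s"
    using lower by (auto intro!: power_strict_mono)
  then have "block_noise c (1 / \<tau>) < (block_signal c s)\<^sup>2" using upper T1 by (simp add: power_mult_distrib)
  moreover have "block_noise c (1 / \<tau>) \<noteq> 0" using block_noise_eq_0_imp[of "1 / \<tau>" c s] cs tau by auto
  then have "0 < block_noise c (1 / \<tau>)" using block_noise_nonneg[of "1 / \<tau>" c] tau by simp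
  ultimately show ?thesis by blast
qed

lemma geometric_partial_gt:
  fixes A B R :: real
  assumes A: "0 < A" and B: "0 < B" "B \<le> 1" and R: "0 < R"
    and c: "B = 1 \<or> (1 - A) * (1 - B) < R * A * B"
  shows "\<exists>M. 1 < A + A * R * B * (\<Sum>k<M. B ^ k)"
proof (cases "B = 1")
  case True
  obtain M :: nat where "1 / (A * R) < real M" using reals_Archimedean2 by blast
  then have "1 < A * R * real M" using A R by (simp add: pos_divide_less_eq mult.commute)
  then show ?thesis using A True by (intro exI[of _ M]) (simp add: add_pos_pos)
next
  case False
  then have B1: "B < 1" using B by simp
  have "(\<lambda>M. \<Sum>k<M. B ^ k) \<longlonglongrightarrow> 1 / (1 - B)"
    using geometric_sums[of B] B B1 by (simp add: sums_def)
  then have lim: "(\<lambda>M. A + A * R * B * (\<Sum>k<M. B ^ k)) \<longlonglongrightarrow> A + A * R * B * (1 / (1 - B))"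
    by (intro tendsto_intros)
  have "1 < A + A * R * B * (1 / (1 - B))"
    using c False B1 by (simp add: field_simps)
  then have "\<forall>\<^sub>F M in sequentially. 1 < A + A * R * B * (\<Sum>k<M. B ^ k)"
    using order_tendstoD(1)[OF lim] by blast
  then show ?thesis by (auto simp: eventually_sequentially)
qed

text \<open>The squared block weights, divided by the noise per letter, form a geometric series with
  ratio \<open>\<tau> * (G (\<not> p))\<^sup>2\<close>; squaring turns the factor
  \<open>\<rho>\<^sup>2\<close> of two label changes into \<open>\<rho> ^ 4\<close>.\<close>

lemma signal_weights:
  assumes tau: "0 < \<tau>" and G: "\<And>l. 0 < G l" "\<And>l. \<tau> * (G l)\<^sup>2 \<le> 1" and rho: "0 < \<rho>"
    and c: "\<tau> * (G (\<not> p))\<^sup>2 = 1 \<or>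
      (1 - \<tau> * (G p)\<^sup>2) * (1 - \<tau> * (G (\<not> p))\<^sup>2) < \<rho> ^ 4 * (\<tau> * (G p)\<^sup>2) * (\<tau> * (G (\<not> p))\<^sup>2)"
  shows "\<exists>c :: nat list. 0 < block_noise c (1 / \<tau>) \<and> block_noise c (1 / \<tau>) < (block_signal c (block_weight G \<rho> p))\<^sup>2"
proof -
  let ?A = "\<tau> * (G p)\<^sup>2" and ?B = "\<tau> * (G (\<not> p))\<^sup>2"
  obtain M where M: "1 < ?A + ?A * \<rho> ^ 4 * ?B * (\<Sum>k<M. ?B ^ k)"
  proof -
    have "0 < ?A" "0 < ?B" using tau G(1)[of p] G(1)[of "\<not> p"] by auto
    then show ?thesis using geometric_partial_gt[of ?A ?B "\<rho> ^ 4"] rho c G(2)[of "\<not> p"] that by force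
  qed
  have "(\<Sum>k<Suc M. (block_weight G \<rho> p k)\<^sup>2 * \<tau> ^ Suc k) = ?A + ?A * \<rho> ^ 4 * ?B * (\<Sum>k<M. ?B ^ k)"
    unfolding sum.lessThan_Suc_shift sum_distrib_left
    by (intro arg_cong2[of _ _ _ _ "(+)"] sum.cong refl)
      (simp_all add: block_weight_def power_mult_distrib power_mult[symmetric] mult_ac power_even_eq)
  then have "1 < (\<Sum>k<Suc M. (block_weight G \<rho> p k)\<^sup>2 * \<tau> ^ Suc k)" using M by simp
  then show ?thesis
    using G rho tau by (intro exists_integer_weights[where M = "Suc M"]) (auto simp: block_weight_def less_imp_le)
qed

text \<open>The last inequality is \<open>\<rho> > kappa \<tau> \<alpha> \<beta>\<close> raised to
  the fourth power and freed of denominators.\<close>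

lemma admissible_signal:
  assumes eps: "0 < \<epsilon>" and tau: "0 < \<tau>" and adm: "admissible \<epsilon> \<tau> \<alpha> \<beta> \<rho>"
  shows "0 < \<alpha>" "0 < \<beta>" "\<tau> * \<alpha>\<^sup>2 \<le> 1" "\<tau> * \<beta>\<^sup>2 \<le> 1" "0 < \<rho>" "\<rho> \<le> 1"
    "(1 - \<tau> * \<alpha>\<^sup>2) * (1 - \<tau> * \<beta>\<^sup>2) < \<rho> ^ 4 * (\<tau> * \<alpha>\<^sup>2) * (\<tau> * \<beta>\<^sup>2)"
proof -
  let ?u = "\<tau> powr (-1/2)"
  have u0: "0 < ?u" using tau by simp
  have u2: "\<tau> * ?u\<^sup>2 = 1"
  proof -
    have "?u\<^sup>2 = \<tau> powr (-1)" by (simp add: power2_eq_square powr_add[symmetric])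
    then show ?thesis using tau by (simp add: powr_minus)
  qed
  have ab: "\<epsilon> * ?u < \<alpha>" "\<alpha> \<le> ?u" "\<epsilon> * ?u < \<beta>" "\<beta> \<le> ?u" "\<rho> \<le> 1" "kappa \<tau> \<alpha> \<beta> + \<epsilon> < \<rho>"
    using adm by (auto simp: admissible_def)
  have eu: "0 < \<epsilon> * ?u" using eps u0 by simp
  show a0: "0 < \<alpha>" and b0: "0 < \<beta>" using ab eu by linarith+
  have "\<tau> * x\<^sup>2 \<le> 1" if "0 < x" "x \<le> ?u" for x
  proof -
    have "\<tau> * x\<^sup>2 \<le> \<tau> * ?u\<^sup>2" using that tau by (intro mult_left_mono power_mono) auto
    then show ?thesis using u2 by simp
  qed
  then show A: "\<tau> * \<alpha>\<^sup>2 \<le> 1" and B: "\<tau> * \<beta>\<^sup>2 \<le> 1" using ab a0 b0 by auto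
  show "\<rho> \<le> 1" by fact
  have k0: "0 \<le> kappa \<tau> \<alpha> \<beta>" by (simp add: kappa_def)
  then show r0: "0 < \<rho>" using ab eps by linarith
  let ?X = "(1 - \<tau> * \<alpha>\<^sup>2) * (1 - \<tau> * \<beta>\<^sup>2) / (\<tau>\<^sup>2 * \<alpha>\<^sup>2 * \<beta>\<^sup>2)"
  have X0: "0 \<le> ?X" using A B by (intro divide_nonneg_nonneg mult_nonneg_nonneg) auto
  have "kappa \<tau> \<alpha> \<beta> ^ 4 = ?X"
  proof (cases "?X = 0")
    case True
    then show ?thesis unfolding kappa_def True by simp
  next
    case False
    then have "0 < ?X" using X0 by (metis order_less_le)
    moreover have "(x powr (1 / 4)) ^ 4 = x" if "0 < x" for x :: real
      using that powr_realpow[of "x powr (1 / 4)" 4] by (simp add: powr_powr)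
    ultimately show ?thesis unfolding kappa_def by blast
  qed
  moreover have "kappa \<tau> \<alpha> \<beta> ^ 4 < \<rho> ^ 4"
    using ab eps k0 by (intro power_strict_mono) auto
  ultimately have "?X < \<rho> ^ 4" by simp
  then show "(1 - \<tau> * \<alpha>\<^sup>2) * (1 - \<tau> * \<beta>\<^sup>2) < \<rho> ^ 4 * (\<tau> * \<alpha>\<^sup>2) * (\<tau> * \<beta>\<^sup>2)"
    using tau a0 b0 by (simp add: pos_divide_less_eq power2_eq_square mult_ac)
qed

section \<open>Choosing the number of blocks from the dimensions alone\<close>

text \<open>The \<open>error_const\<close> of the locale with \<open>g\<close> and \<open>K\<close>
  as explicit arguments, so that the estimator can refer to it without a model at hand.\<close>

definition err_const :: "real \<Rightarrow> real \<Rightarrow> nat \<Rightarrow> real \<Rightarrow> real" where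
  "err_const g K L \<kappa> = (2 * g * K) ^ (2 * L) * ((real L + 1) * (2 * (real L + \<kappa>)) ^ L)\<^sup>2"

lemma (in spiked) error_const_eq: "error_const L \<kappa> = err_const g K L \<kappa>"
  by (simp add: error_const_def err_const_def moment_const_def walk_const_def)

text \<open>The noise cost q of one letter, computable from the dimensions; its limit is 1 in the
  Wigner model and \<open>1 / \<tau>\<close> in the Wishart model.\<close>

definition aspect :: "nat \<Rightarrow> nat \<Rightarrow> nat \<Rightarrow> real" where
  "aspect e n m = (if e = 1 then 1 else real m / real n)"

definition max_len :: "nat \<Rightarrow> nat \<Rightarrow> nat list \<Rightarrow> nat" where
  "max_len e J c = e * (1 + J * length c)"

text \<open>The order of the main term of the variance. The squared length bounds the number of
  cycles with the same edges, and the power is the noise of J independent block choices.\<close>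

definition noise_scale :: "nat \<Rightarrow> real \<Rightarrow> nat \<Rightarrow> nat list \<Rightarrow> real" where
  "noise_scale e q J c = (real (max_len e J c))\<^sup>2 * block_noise c q ^ J"

text \<open>Says that for this list the lower-order terms of the variance bound are already
  dominated by \<open>noise_scale\<close>, and that vertex lists are numerous enough. The unknown
  bound \<open>g\<close> on the spike strengths is replaced by \<open>J\<close>, which keeps the
  test free of parameters.\<close>

definition list_ok :: "nat \<Rightarrow> real \<Rightarrow> nat \<Rightarrow> nat \<Rightarrow> nat \<Rightarrow> nat list \<Rightarrow> bool" where
  "list_ok e K n m J c \<longleftrightarrow> (let q = aspect e n m; R = err_const (real J) K (max_len e J c) (1 + 1 / q) in
     0 < q \<and> 0 < m \<and> R \<le> real m \<and>
     R * (2 * block_signal c (\<lambda>_. 1) ^ J * (1 + q) ^ (1 + J * length c))\<^sup>2 \<le> real m * noise_scale e q J c \<and>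
     (\<forall>l\<le>1 + J * length c. 0 < card (vertex_lists e n m (e * l)) \<and>
        real m ^ (e * l) \<le> 2 * q ^ l * card (vertex_lists e n m (e * l))))"

text \<open>\<open>from_nat\<close> enumerates all lists of naturals, so any fixed good list is
  among the first J once J exceeds its code.\<close>

definition level_ok :: "nat \<Rightarrow> real \<Rightarrow> nat \<Rightarrow> nat \<Rightarrow> nat \<Rightarrow> bool" where
  "level_ok e K n m J \<longleftrightarrow> 3 \<le> J \<and> (\<forall>i<J. list_ok e K n m J (from_nat i))"

text \<open>Deterministic given the dimensions. The bound \<open>J \<le> n\<close> makes the maximum
  exist, and 0 is the value when no level passes.\<close>

definition level :: "nat \<Rightarrow> real \<Rightarrow> nat \<Rightarrow> nat \<Rightarrow> nat" where
  "level e K n m = Max (insert 0 {J. J \<le> n \<and> level_ok e K n m J})"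

lemma finite_level_set: "finite {J. J \<le> n \<and> level_ok e K n m J}"
  by (rule finite_subset[of _ "{..n}"]) auto

lemma level_ok_level: "0 < level e K n m \<Longrightarrow> level_ok e K n m (level e K n m)"
proof -
  assume "0 < level e K n m"
  moreover have "level e K n m \<in> insert 0 {J. J \<le> n \<and> level_ok e K n m J}"
    unfolding level_def using finite_level_set by (intro Max_in) auto
  ultimately show ?thesis by auto
qed

lemma level_ge: "J \<le> n \<Longrightarrow> level_ok e K n m J \<Longrightarrow> J \<le> level e K n m"
  unfolding level_def using finite_level_set by (intro Max_ge) auto

lemma level_at_top:
  assumes "\<And>J. 3 \<le> J \<Longrightarrow> \<forall>\<^sub>F n in sequentially. level_ok e K n (m n) J"
  shows "filterlim (\<lambda>n. level e K n (m n)) at_top sequentially"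
  unfolding filterlim_at_top
proof
  fix Z :: nat
  have "\<forall>\<^sub>F n in sequentially. level_ok e K n (m n) (max 3 Z)" by (rule assms) simp
  moreover have "\<forall>\<^sub>F n in sequentially. max 3 Z \<le> n" by (rule eventually_ge_at_top)
  ultimately show "\<forall>\<^sub>F n in sequentially. Z \<le> level e K n (m n)"
    by eventually_elim (meson level_ge max.bounded_iff order_trans order_refl max.cobounded2)
qed

section \<open>Consistency\<close>

lemma eventually_le_at_top:
  fixes f g :: "nat \<Rightarrow> real"
  assumes "f \<longlonglongrightarrow> F" "filterlim g at_top sequentially"
  shows "\<forall>\<^sub>F n in sequentially. f n \<le> g n"
proof -
  have "\<forall>\<^sub>F n in sequentially. f n < F + 1" by (rule order_tendstoD(2)[OF assms(1)]) simp
  moreover have "\<forall>\<^sub>F n in sequentially. F + 1 \<le> g n"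
    using assms(2) unfolding filterlim_at_top by blast
  ultimately show ?thesis by eventually_elim simp
qed

lemma eventually_pos_nat:
  fixes m :: "nat \<Rightarrow> nat"
  assumes "filterlim m at_top sequentially"
  shows "\<forall>\<^sub>F n in sequentially. 0 < m n"
proof -
  have "\<forall>\<^sub>F n in sequentially. 1 \<le> m n" using assms unfolding filterlim_at_top by blast
  then show ?thesis by eventually_elim simp
qed

lemma tendsto_block_noise: "q \<longlonglongrightarrow> Q \<Longrightarrow> (\<lambda>n. block_noise c (q n)) \<longlonglongrightarrow> block_noise c Q"
  unfolding block_noise_def by (intro tendsto_intros)

lemma tendsto_noise_scale: "q \<longlonglongrightarrow> Q \<Longrightarrow> (\<lambda>n. noise_scale e (q n) J c) \<longlonglongrightarrow> noise_scale e Q J c"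
  unfolding noise_scale_def by (intro tendsto_intros tendsto_block_noise)

lemma max_len_pos: "0 < e \<Longrightarrow> 0 < max_len e J c"
  by (simp add: max_len_def)

lemma noise_scale_pos: "0 < e \<Longrightarrow> 0 < block_noise c q \<Longrightarrow> 0 < noise_scale e q J c"
  using max_len_pos[of e J c] by (simp add: noise_scale_def)

lemma prod_alternate: "(\<Prod>t<2 * l. if even t then a else b) = (a * b :: real) ^ l"
  by (induction l) auto

text \<open>The lower bound of \<open>card_vertex_lists_ge\<close>, relative to the number of
  unrestricted lists, is a product of a fixed number of factors tending to 1. It eventually exceeds
  1/2, which is the 2 in the claim.\<close>

lemma eventually_vertex_lists:
  fixes m :: "nat \<Rightarrow> nat"
  assumes e: "(e = 1 \<and> (\<forall>n. m n = n)) \<or> e = 2" and m: "filterlim m at_top sequentially"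
  shows "\<forall>\<^sub>F n in sequentially. 0 < card (vertex_lists e n (m n) (e * l)) \<and>
    real (m n) ^ (e * l) \<le> 2 * aspect e n (m n) ^ l * card (vertex_lists e n (m n) (e * l))"
proof -
  define s where "s n t = (if even t then card (columns e n (m n)) else n)" for n t :: nat
  have card_cols: "card (columns e n (m n)) = m n" for n using e by (auto simp: columns_def)
  have s_top: "filterlim (\<lambda>n. real (s n t)) at_top sequentially" for t
    using m by (cases "even t")
      (simp_all add: s_def card_cols filterlim_compose[OF filterlim_real_sequentially] filterlim_real_sequentially)
  have ratio: "(\<lambda>n. real (s n t - t) / real (s n t)) \<longlonglongrightarrow> 1" for t
  proof -
    have "(\<lambda>n. 1 - real t / real (s n t)) \<longlonglongrightarrow> 1 - 0"
      by (intro tendsto_diff tendsto_const tendsto_divide_0[OF tendsto_const] filterlim_at_top_imp_at_infinity s_top)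
    moreover have "\<forall>\<^sub>F n in sequentially. 1 - real t / real (s n t) = real (s n t - t) / real (s n t)"
    proof -
      have "\<forall>\<^sub>F n in sequentially. real t + 1 \<le> real (s n t)"
        using s_top[of t] unfolding filterlim_at_top by blast
      then show ?thesis
      proof eventually_elim
        case (elim n)
        then have "t \<le> s n t" "0 < s n t" by linarith+
        then show ?case by (simp add: of_nat_diff diff_divide_distrib)
      qed
    qed
    ultimately show ?thesis using tendsto_cong[of "\<lambda>n. 1 - real t / real (s n t)"] by force
  qed
  have "(\<lambda>n. \<Prod>t<e * l. real (s n t - t) / real (s n t)) \<longlonglongrightarrow> (\<Prod>t<e * l. 1)"
    by (intro tendsto_prod ratio)
  then have "\<forall>\<^sub>F n in sequentially. 1 / 2 < (\<Prod>t<e * l. real (s n t - t) / real (s n t))"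
    by (rule order_tendstoD(1)) simp
  moreover have "\<forall>\<^sub>F n in sequentially. 0 < m n"
    by (rule eventually_pos_nat[OF m])
  moreover have "\<forall>\<^sub>F n in sequentially. 0 < n" by (rule eventually_gt_at_top)
  ultimately show ?thesis
  proof eventually_elim
    case (elim n)
    have s0: "0 < s n t" for t using elim by (simp add: s_def card_cols)
    let ?P = "\<Prod>t<e * l. real (s n t - t)" and ?Q = "\<Prod>t<e * l. real (s n t)"
    have Q0: "0 < ?Q" by (intro prod_pos) (use s0 in auto)
    have "1 / 2 < ?P / ?Q" using elim(1) by (simp add: prod_dividef)
    then have QP: "?Q < 2 * ?P" using Q0 by (simp add: field_simps)
    have "(\<Prod>t<e * l. s n t - t) \<le> card (vertex_lists e n (m n) (e * l))"
      using card_vertex_lists_ge[of e n "m n" "e * l"] by (simp add: s_def if_distrib cong: if_cong)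
    then have Pc: "?P \<le> card (vertex_lists e n (m n) (e * l))"
      unfolding of_nat_prod[symmetric] by (rule of_nat_mono)
    have q0: "0 < aspect e n (m n)" using elim by (simp add: aspect_def)
    have "real (m n) ^ (e * l) = aspect e n (m n) ^ l * ?Q"
    proof (cases "e = 1")
      case True
      then have "m n = n" using e by auto
      then have "s n t = n" for t using card_cols[of n] by (simp add: s_def)
      then show ?thesis using True \<open>m n = n\<close> by (simp add: aspect_def)
    next
      case False
      then have e2: "e = 2" using e by simp
      have "?Q = (\<Prod>t<2 * l. if even t then real (m n) else real n)"
        unfolding e2 by (intro prod.cong refl) (use card_cols[of n] e2 in \<open>simp add: s_def\<close>)
      also have "\<dots> = (real (m n) * real n) ^ l" by (rule prod_alternate)
      finally show ?thesis using elim
        by (simp add: e2 aspect_def power_mult_distrib[symmetric] power_mult power2_eq_square)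
    qed
    also have "\<dots> \<le> aspect e n (m n) ^ l * (2 * card (vertex_lists e n (m n) (e * l)))"
      using QP Pc q0 by (intro mult_left_mono) auto
    finally show ?case using QP Pc Q0 by (simp add: mult_ac)
  qed
qed

lemma tendsto_err_const:
  "f \<longlonglongrightarrow> F \<Longrightarrow> (\<lambda>n. err_const g K L (f n)) \<longlonglongrightarrow> err_const g K L F"
  unfolding err_const_def by (intro tendsto_intros)

text \<open>With \<open>J\<close> and \<open>c\<close> fixed, every quantity in the test converges
  except \<open>m\<close>, which tends to infinity.\<close>

lemma eventually_list_ok:
  fixes m :: "nat \<Rightarrow> nat"
  assumes e: "(e = 1 \<and> (\<forall>n. m n = n)) \<or> e = 2" and m: "filterlim m at_top sequentially"
    and q: "(\<lambda>n. aspect e n (m n)) \<longlonglongrightarrow> Q" and Q: "0 < Q" and J: "3 \<le> J"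
  shows "\<forall>\<^sub>F n in sequentially. list_ok e K n (m n) J c"
proof -
  let ?q = "\<lambda>n. aspect e n (m n)"
  let ?R = "\<lambda>n. err_const (real J) K (max_len e J c) (1 + 1 / ?q n)"
  let ?H = "\<lambda>n. 2 * block_signal c (\<lambda>_. 1) ^ J * (1 + ?q n) ^ (1 + J * length c)"
  have mt: "filterlim (\<lambda>n. real (m n)) at_top sequentially"
    by (rule filterlim_compose[OF filterlim_real_sequentially m])
  have R: "?R \<longlonglongrightarrow> err_const (real J) K (max_len e J c) (1 + 1 / Q)"
    using Q by (intro tendsto_err_const tendsto_intros q) auto
  have RH: "(\<lambda>n. ?R n * (?H n)\<^sup>2) \<longlonglongrightarrow> err_const (real J) K (max_len e J c) (1 + 1 / Q) *
      (2 * block_signal c (\<lambda>_. 1) ^ J * (1 + Q) ^ (1 + J * length c))\<^sup>2"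
    by (intro tendsto_intros R q)
  have q0: "\<forall>\<^sub>F n in sequentially. 0 < ?q n" using order_tendstoD(1)[OF q Q] .
  have m0: "\<forall>\<^sub>F n in sequentially. 0 < m n"
    by (rule eventually_pos_nat[OF m])
  have second: "\<forall>\<^sub>F n in sequentially. ?R n * (?H n)\<^sup>2 \<le> real (m n) * noise_scale e (?q n) J c"
  \<comment> \<open>A list of zeros has no noise to dominate the error term, but its coefficient
    bound vanishes too, as \<open>J > 0\<close>.\<close>
  proof (cases "block_noise c Q = 0")
    case True
    then have "block_signal c (\<lambda>_. 1) = 0" using block_noise_eq_0_imp Q by blast
    then have eq: "?R n * (?H n)\<^sup>2 = 0" for n using J by simp
    have "\<forall>\<^sub>F n in sequentially. 0 \<le> real (m n) * noise_scale e (?q n) J c"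
      using q0 by eventually_elim (simp add: noise_scale_def block_noise_nonneg)
    then show ?thesis unfolding eq .
  next
    case False
    then have "0 < block_noise c Q" using block_noise_nonneg[of Q c] Q by simp
    then have S: "0 < noise_scale e Q J c" using e by (intro noise_scale_pos) auto
    have "filterlim (\<lambda>n. noise_scale e (?q n) J c * real (m n)) at_top sequentially"
      by (rule filterlim_tendsto_pos_mult_at_top[OF tendsto_noise_scale[OF q] S mt])
    from eventually_le_at_top[OF RH this] show ?thesis by (simp add: mult.commute)
  qed
  have "\<forall>\<^sub>F n in sequentially. \<forall>l\<in>{..1 + J * length c}. 0 < card (vertex_lists e n (m n) (e * l)) \<and>
    real (m n) ^ (e * l) \<le> 2 * ?q n ^ l * card (vertex_lists e n (m n) (e * l))"
    by (intro eventually_ball_finite ballI eventually_vertex_lists[OF e m]) auto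
  with q0 m0 eventually_le_at_top[OF R mt] second show ?thesis
    by eventually_elim (auto simp: list_ok_def Let_def)
qed

lemma eventually_level_ok:
  fixes m :: "nat \<Rightarrow> nat"
  assumes e: "(e = 1 \<and> (\<forall>n. m n = n)) \<or> e = 2" and m: "filterlim m at_top sequentially"
    and q: "(\<lambda>n. aspect e n (m n)) \<longlonglongrightarrow> Q" and Q: "0 < Q" and J: "3 \<le> J"
  shows "\<forall>\<^sub>F n in sequentially. level_ok e K n (m n) J"
proof -
  have "\<forall>\<^sub>F n in sequentially. \<forall>i\<in>{..<J}. list_ok e K n (m n) J (from_nat i)"
    by (intro eventually_ball_finite ballI eventually_list_ok[OF e m q Q J]) auto
  then show ?thesis by eventually_elim (use J in \<open>auto simp: level_ok_def\<close>)
qed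

text \<open>The squared signal per block exceeds the noise per block by a factor above 1, so the
  ratio grows exponentially in J, whereas the squared length and the loss \<open>J ^ 2\<close> of
  the least-squares step are together of order \<open>J ^ 4\<close>.\<close>

lemma growth:
  fixes q :: "nat \<Rightarrow> real" and J :: "nat \<Rightarrow> nat"
  assumes q: "q \<longlonglongrightarrow> Q" "0 < Q" and J: "filterlim J at_top sequentially" and e: "0 < e"
    and c: "0 < block_noise c Q" "block_noise c Q < s\<^sup>2" and s: "0 < s"
  shows "filterlim (\<lambda>n. (s ^ J n)\<^sup>2 / (noise_scale e (q n) (J n) c * (real (J n))\<^sup>2)) at_top sequentially"
proof -
  \<comment> \<open>Midway between 1 and the limiting gain per block: this leaves room for the
    difference between \<open>q n\<close> and \<open>Q\<close>.\<close>
  define lam where "lam = (1 + s\<^sup>2 / block_noise c Q) / 2"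
  have l1: "1 < lam" unfolding lam_def using c by (simp add: pos_less_divide_eq)
  have l2: "lam * block_noise c Q < s\<^sup>2" unfolding lam_def using c by (simp add: field_simps)
  \<comment> \<open>The fourth root distributes the exponential over the four polynomial factors,
    leaving the standard limit of \<open>j * (1 / \<nu>) ^ j\<close>.\<close>
  define \<nu> where "\<nu> = root 4 lam"
  have nu: "1 < \<nu>" "\<nu> ^ 4 = lam" unfolding \<nu>_def using l1 by (auto simp: real_root_pow_pos2)
  define C where "C = (real (e * (1 + length c)))\<^sup>2"
  have "0 < e * (1 + length c)" using e by simp
  then have C0: "0 < C" unfolding C_def by (intro zero_less_power) (rule of_nat_0_less_iff[THEN iffD2])
  define u where "u j = C * (real j * (1 / \<nu>) ^ j) ^ 4" for j :: nat
  have "(\<lambda>j. real j * (1 / \<nu>) ^ j) \<longlonglongrightarrow> 0"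
    using nu by (intro powser_times_n_limit_0) auto
  then have "(\<lambda>j. u j) \<longlonglongrightarrow> C * 0 ^ 4" unfolding u_def by (intro tendsto_intros)
  then have "u \<longlonglongrightarrow> 0" by simp
  then have uJ: "(\<lambda>n. u (J n)) \<longlonglongrightarrow> 0" by (rule filterlim_compose[OF _ J])
  have J1: "\<forall>\<^sub>F n in sequentially. 1 \<le> J n" using J unfolding filterlim_at_top by blast
  have upos: "\<forall>\<^sub>F n in sequentially. 0 < u (J n)"
    using J1 by eventually_elim (use C0 nu in \<open>simp add: u_def\<close>)
  have inv: "filterlim (\<lambda>n. inverse (u (J n))) at_top sequentially"
    by (rule filterlim_inverse_at_top[OF uJ upos])
  have "(\<lambda>n. lam * block_noise c (q n)) \<longlonglongrightarrow> lam * block_noise c Q" by (intro tendsto_intros tendsto_block_noise q)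
  then have "\<forall>\<^sub>F n in sequentially. lam * block_noise c (q n) < s\<^sup>2" using l2 by (rule order_tendstoD(2))
  moreover have "\<forall>\<^sub>F n in sequentially. 0 < block_noise c (q n)"
    using order_tendstoD(1)[OF tendsto_block_noise[OF q(1)] c(1)] .
  ultimately have "\<forall>\<^sub>F n in sequentially.
      inverse (u (J n)) \<le> (s ^ J n)\<^sup>2 / (noise_scale e (q n) (J n) c * (real (J n))\<^sup>2)"
    using J1
  proof eventually_elim
    case (elim n)
    let ?j = "J n" and ?c = "block_noise c (q n)"
    have j: "1 \<le> real ?j" using elim by simp
    have "max_len e ?j c \<le> ?j * (e * (1 + length c))"
      unfolding max_len_def using elim(3) by (simp add: algebra_simps)
    then have "(real (max_len e ?j c))\<^sup>2 \<le> (real (?j * (e * (1 + length c))))\<^sup>2"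
      by (intro power_mono of_nat_mono) auto
    then have LLle: "(real (max_len e ?j c))\<^sup>2 \<le> (real ?j)\<^sup>2 * C"
      by (simp only: C_def of_nat_mult power_mult_distrib)
    have LL0: "0 < (real (max_len e ?j c))\<^sup>2" using max_len_pos[OF e, of ?j c] by simp
    have "lam ^ ?j * ?c ^ ?j \<le> (s ^ ?j)\<^sup>2"
    proof -
      have "(lam * ?c) ^ ?j \<le> (s\<^sup>2) ^ ?j" using elim l1 by (intro power_mono) auto
      then show ?thesis by (simp add: power_mult_distrib power_mult[symmetric] mult.commute)
    qed
    have "inverse (u ?j) = lam ^ ?j / (C * (real ?j) ^ 4)"
      using nu C0 j by (simp add: u_def power_mult_distrib power_one_over field_simps power_mult[symmetric] mult.commute flip: nu(2))
    also have "\<dots> = lam ^ ?j * ?c ^ ?j / ((real ?j)\<^sup>2 * C * ?c ^ ?j * (real ?j)\<^sup>2)"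
      using elim j C0 by (simp add: field_simps power2_eq_square power4_eq_xxxx)
    also have "\<dots> \<le> (s ^ ?j)\<^sup>2 / ((real (max_len e ?j c))\<^sup>2 * ?c ^ ?j * (real ?j)\<^sup>2)"
      using elim j C0 l1 LLle LL0 \<open>lam ^ ?j * ?c ^ ?j \<le> (s ^ ?j)\<^sup>2\<close>
      by (intro frac_le mult_right_mono mult_pos_pos) auto
    finally show ?case by (simp add: noise_scale_def)
  qed
  then show ?thesis using inv by (rule filterlim_at_top_mono[rotated])
qed

text \<open>
  Weight lists that vanish identically have scale \<open>0\<close> and drop out of both sums, since \<open>x / 0 = 0\<close>.
\<close>

definition estimator :: "nat \<Rightarrow> real \<Rightarrow> bool \<Rightarrow> nat \<Rightarrow> nat \<Rightarrow> rmat \<times> rmat \<Rightarrow> real" where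
  "estimator e K p n m uv = (let J = level e K n m in
     (\<Sum>i<J. cycle_stat e n m p [] (from_nat i) J uv * cycle_stat e n m p [p] (from_nat i) J uv /
        noise_scale e (aspect e n m) J (from_nat i)) /
     (\<Sum>i<J. (cycle_stat e n m p [] (from_nat i) J uv)\<^sup>2 / noise_scale e (aspect e n m) J (from_nat i)))"

text \<open>Both variance constants are \<open>1 + 4 * q ^ length pre\<close>. The 4 is the product
  of the 2 from the vertex-list count and of \<open>1 + 1\<close> from an error of relative size at
  most 1; the remaining 1 is the additive error term.\<close>

definition stat_moments ::
  "(rmat \<times> rmat) measure \<Rightarrow> nat \<Rightarrow> nat \<Rightarrow> nat \<Rightarrow> bool \<Rightarrow> (bool \<Rightarrow> real) \<Rightarrow> real \<Rightarrow> nat \<Rightarrow> nat list \<Rightarrow> bool" where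
  "stat_moments M e n m p G \<rho> J c \<longleftrightarrow>
    integrable M (cycle_stat e n m p [] c J) \<and> integrable M (\<lambda>x. (cycle_stat e n m p [] c J x)\<^sup>2) \<and>
    integrable M (cycle_stat e n m p [p] c J) \<and> integrable M (\<lambda>x. (cycle_stat e n m p [p] c J x)\<^sup>2) \<and>
    integral\<^sup>L M (cycle_stat e n m p [] c J) = block_signal c (block_weight G \<rho> p) ^ J \<and>
    integral\<^sup>L M (cycle_stat e n m p [p] c J) = G p * block_signal c (block_weight G \<rho> p) ^ J \<and>
    (\<integral>x. (cycle_stat e n m p [] c J x)\<^sup>2 \<partial>M) - (block_signal c (block_weight G \<rho> p) ^ J)\<^sup>2 \<le> 5 * noise_scale e (aspect e n m) J c \<and>
    (\<integral>x. (cycle_stat e n m p [p] c J x)\<^sup>2 \<partial>M) - (G p * block_signal c (block_weight G \<rho> p) ^ J)\<^sup>2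
      \<le> (1 + 4 * aspect e n m) * noise_scale e (aspect e n m) J c"

text \<open>The unknown quantities are fixed while the level tends to infinity, so eventually it
  exceeds the code of the good list \<open>c0\<close> and both spike strengths. From then on
  \<open>ratio_estimator_prob\<close> applies, with failure probability of order
  \<open>1 / J n + 1 / t n\<close>.\<close>

lemma estimator_consistent:
  fixes m :: "nat \<Rightarrow> nat"
  assumes e: "(e = 1 \<and> (\<forall>n. m n = n)) \<or> e = 2" and m: "filterlim m at_top sequentially"
    and q: "(\<lambda>n. aspect e n (m n)) \<longlonglongrightarrow> Q" and Q: "0 < Q"
    and c0: "0 < block_noise c0 Q" "block_noise c0 Q < (block_signal c0 (block_weight G \<rho> p))\<^sup>2"
    and G: "\<And>l. 0 \<le> G l" and \<rho>: "0 \<le> \<rho>"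
    and P: "\<And>n. 0 < m n \<Longrightarrow> prob_space (M n)"
    and mom: "\<And>n J i. level_ok e K n (m n) J \<Longrightarrow> (\<And>l. G l \<le> real J) \<Longrightarrow> i < J \<Longrightarrow>
      stat_moments (M n) e n (m n) p G \<rho> J (from_nat i)"
  shows "whp_consistent M (\<lambda>n. estimator e K p n (m n)) (G p)"
proof -
  define J where "J n = level e K n (m n)" for n
  define i0 where "i0 = to_nat c0"
  define s where "s = block_signal c0 (block_weight G \<rho> p)"
  \<comment> \<open>Eventually \<open>aspect\<close> is below \<open>Q + 1\<close>, and then
    \<open>C\<close> dominates both variance constants of \<open>stat_moments\<close>.\<close>
  define C where "C = 5 + 4 * (Q + 1)"
  define t where "t n = (s ^ J n)\<^sup>2 / (noise_scale e (aspect e n (m n)) (J n) c0 * (real (J n))\<^sup>2)" for n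
  have fi0: "from_nat i0 = c0" by (simp add: i0_def)
  have "0 \<le> s" unfolding s_def using G \<rho> by (intro block_signal_nonneg) (auto simp: block_weight_def)
  moreover have "s \<noteq> 0" using c0 by (auto simp: s_def)
  ultimately have s: "0 < s" by simp
  have J_top: "filterlim J at_top sequentially"
    unfolding J_def by (rule level_at_top) (rule eventually_level_ok[OF e m q Q])
  have Jr: "filterlim (\<lambda>n. real (J n)) at_top sequentially"
    by (rule filterlim_compose[OF filterlim_real_sequentially J_top])
  have t_top: "filterlim t at_top sequentially"
    unfolding t_def using e c0 by (intro growth[OF q Q J_top] s) (auto simp: s_def)
  have m0: "\<forall>\<^sub>F n in sequentially. 0 < m n"
    by (rule eventually_pos_nat[OF m])
  have q1: "\<forall>\<^sub>F n in sequentially. aspect e n (m n) < Q + 1"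
    by (rule order_tendstoD(2)[OF q]) simp
  have q0: "\<forall>\<^sub>F n in sequentially. 0 < aspect e n (m n)" using order_tendstoD(1)[OF q Q] .
  have cq: "\<forall>\<^sub>F n in sequentially. 0 < block_noise c0 (aspect e n (m n))"
    using order_tendstoD(1)[OF tendsto_block_noise[OF q] c0(1)] .
  have Jbig: "\<forall>\<^sub>F n in sequentially. Suc i0 \<le> J n" "\<forall>\<^sub>F n in sequentially. max (G True) (G False) \<le> real (J n)"
    using J_top Jr unfolding filterlim_at_top by blast+
  show ?thesis
  proof (rule whp_consistentI[where \<delta> = "\<lambda>n. 2 / sqrt (t n)"
        and \<eta> = "\<lambda>n. 2 * C * (1 + (G p)\<^sup>2) / real (J n) + 4 * C / t n"])
    show "\<forall>\<^sub>F n in sequentially. prob_space (M n)" using m0 by eventually_elim (rule P)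
    show "\<forall>\<^sub>F n in sequentially. 1 - (2 * C * (1 + (G p)\<^sup>2) / real (J n) + 4 * C / t n)
        \<le> measure (M n) {x \<in> space (M n). \<bar>estimator e K p n (m n) x - G p\<bar> \<le> 2 / sqrt (t n)}"
      using m0 q1 q0 cq Jbig
    proof eventually_elim
      case (elim n)
      interpret prob_space "M n" by (rule P) fact
      have "level_ok e K n (m n) (J n)" unfolding J_def using elim by (intro level_ok_level) (simp add: J_def)
      moreover have "G l \<le> real (J n)" for l using elim by (cases l) auto
      ultimately have mo: "stat_moments (M n) e n (m n) p G \<rho> (J n) (from_nat i)" if "i < J n" for i
        using mom that by blast
      have sc0: "0 \<le> noise_scale e (aspect e n (m n)) (J n) c" for c
        using elim by (simp add: noise_scale_def block_noise_nonneg)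
      have C5: "5 \<le> C" "1 + 4 * aspect e n (m n) \<le> C" "0 \<le> C" using elim Q by (auto simp: C_def)
      show ?case
        unfolding estimator_def Let_def J_def[symmetric]
      proof (rule ratio_estimator_prob[where ?i0.0 = i0 and mu = "\<lambda>i. block_signal (from_nat i) (block_weight G \<rho> p) ^ J n" and C = C])
        fix i assume i: "i < J n"
        note mi = mo[OF i, unfolded stat_moments_def]
        show "(\<integral>x. (cycle_stat e n (m n) p [] (from_nat i) (J n) x)\<^sup>2 \<partial>M n) - (block_signal (from_nat i) (block_weight G \<rho> p) ^ J n)\<^sup>2
            \<le> C * noise_scale e (aspect e n (m n)) (J n) (from_nat i)"
          using mi mult_right_mono[OF C5(1) sc0[of "from_nat i"]] by linarith
        show "(\<integral>x. (cycle_stat e n (m n) p [p] (from_nat i) (J n) x)\<^sup>2 \<partial>M n) - (G p * block_signal (from_nat i) (block_weight G \<rho> p) ^ J n)\<^sup>2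
            \<le> C * noise_scale e (aspect e n (m n)) (J n) (from_nat i)"
          using mi mult_right_mono[OF C5(2) sc0[of "from_nat i"]] by linarith
      next
        show "i0 < J n" using elim by simp
        show "0 < noise_scale e (aspect e n (m n)) (J n) (from_nat i0)" using elim e unfolding fi0 by (intro noise_scale_pos) auto
        show "0 < block_signal (from_nat i0) (block_weight G \<rho> p) ^ J n" using s by (simp add: fi0 s_def)
        show "t n = (block_signal (from_nat i0) (block_weight G \<rho> p) ^ J n)\<^sup>2 / (noise_scale e (aspect e n (m n)) (J n) (from_nat i0) * (real (J n))\<^sup>2)"
          by (simp add: t_def fi0 s_def)
      qed (use mo C5 sc0 in \<open>auto simp: stat_moments_def\<close>)
    qed
    have "(\<lambda>n. 2 * C * (1 + (G p)\<^sup>2) / real (J n) + 4 * C / t n) \<longlonglongrightarrow> 0 + 0"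
      by (intro tendsto_add tendsto_divide_0[OF tendsto_const] filterlim_at_top_imp_at_infinity Jr t_top)
    then show "(\<lambda>n. 2 * C * (1 + (G p)\<^sup>2) / real (J n) + 4 * C / t n) \<longlonglongrightarrow> 0" by simp
    show "(\<lambda>n. 2 / sqrt (t n)) \<longlonglongrightarrow> 0"
      by (intro tendsto_divide_0[OF tendsto_const] filterlim_at_top_imp_at_infinity
          filterlim_compose[OF sqrt_at_top t_top])
  qed
qed

section \<open>Gaussian arrays and the two models\<close>

lemma indep_vars_reindex:
  assumes P: "prob_space M" and ind: "prob_space.indep_vars M (\<lambda>_. N) X I"
    and f: "inj_on f J" "f ` J \<subseteq> I"
  shows "prob_space.indep_vars M (\<lambda>_. N) (\<lambda>j. X (f j)) J"
proof -
  interpret prob_space M by fact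
  have rv: "X (f j) \<in> measurable M N" if "j \<in> J" for j
    using ind f that by (auto simp: indep_vars_def)
  show ?thesis
    unfolding indep_vars_def2
  proof (intro conjI ballI indep_setsI rv)
    fix j assume "j \<in> J"
    then show "{X (f j) -` A \<inter> space M |A. A \<in> sets N} \<subseteq> events"
      using measurable_sets[OF rv] by auto
  next
    fix A K assume K: "K \<noteq> {}" "K \<subseteq> J" "finite K"
      and AB: "\<forall>j\<in>K. A j \<in> {X (f j) -` A \<inter> space M |A. A \<in> sets N}"
    have "\<forall>j\<in>K. \<exists>C. C \<in> sets N \<and> A j = X (f j) -` C \<inter> space M" using AB by blast
    from bchoice[OF this] obtain B where B: "\<forall>j\<in>K. B j \<in> sets N \<and> A j = X (f j) -` B j \<inter> space M" ..
    have inj: "inj_on f K" using f(1) K(2) by (rule inj_on_subset)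
    let ?B = "\<lambda>i. B (inv_into K f i)"
    have eq: "X (f j) -` ?B (f j) \<inter> space M = A j" if "j \<in> K" for j
      using B that by (simp add: inv_into_f_f[OF inj])
    have "prob (\<Inter>i\<in>f ` K. X i -` ?B i \<inter> space M) = (\<Prod>i\<in>f ` K. prob (X i -` ?B i \<inter> space M))"
    proof (rule indep_varsD[OF ind])
      show "f ` K \<noteq> {}" "finite (f ` K)" "f ` K \<subseteq> I" using K f by auto
      show "?B i \<in> sets N" if "i \<in> f ` K" for i
        using that B by (auto simp: inv_into_f_f[OF inj])
    qed
    moreover have "(\<Inter>i\<in>f ` K. X i -` ?B i \<inter> space M) = (\<Inter>j\<in>K. A j)"
      unfolding image_image by (intro INF_cong refl eq)
    moreover have "(\<Prod>i\<in>f ` K. prob (X i -` ?B i \<inter> space M)) = (\<Prod>j\<in>K. prob (A j))"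
      unfolding prod.reindex[OF inj] using eq by simp
    ultimately show "prob (\<Inter>j\<in>K. A j) = (\<Prod>j\<in>K. prob (A j))" by simp
  qed
qed

lemma
  assumes "prob_space M" "prob_space N"
  shows integrable_fst: "integrable M (f :: _ \<Rightarrow> real) \<Longrightarrow> integrable (M \<Otimes>\<^sub>M N) (\<lambda>w. f (fst w))"
    and integral_fst: "integrable M f \<Longrightarrow> (\<integral>w. f (fst w) \<partial>(M \<Otimes>\<^sub>M N)) = (\<integral>x. f x \<partial>M)"
    and integrable_snd: "integrable N (h :: _ \<Rightarrow> real) \<Longrightarrow> integrable (M \<Otimes>\<^sub>M N) (\<lambda>w. h (snd w))"
    and integral_snd: "integrable N h \<Longrightarrow> (\<integral>w. h (snd w) \<partial>(M \<Otimes>\<^sub>M N)) = (\<integral>x. h x \<partial>N)"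
proof -
  interpret M: prob_space M by fact
  interpret N: prob_space N by fact
  have 1: "integrable M (\<lambda>_. 1 :: real)" "integrable N (\<lambda>_. 1 :: real)" by auto
  show "integrable M f \<Longrightarrow> integrable (M \<Otimes>\<^sub>M N) (\<lambda>w. f (fst w))"
    "integrable M f \<Longrightarrow> (\<integral>w. f (fst w) \<partial>(M \<Otimes>\<^sub>M N)) = (\<integral>x. f x \<partial>M)"
    using integral_pair_product[OF assms _ 1(2), of f] by (simp_all add: N.prob_space)
  show "integrable N h \<Longrightarrow> integrable (M \<Otimes>\<^sub>M N) (\<lambda>w. h (snd w))"
    "integrable N h \<Longrightarrow> (\<integral>w. h (snd w) \<partial>(M \<Otimes>\<^sub>M N)) = (\<integral>x. h x \<partial>N)"
    using integral_pair_product[OF assms 1(1), of h] by (simp_all add: M.prob_space)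
qed

abbreviation gau :: "real \<Rightarrow> real measure" where
  "gau v \<equiv> density lborel (normal_density 0 (sqrt v))"

lemma gau_power:
  assumes "0 < v"
  shows "integrable (gau v) (\<lambda>x. x ^ k)"
  using integrable_normal_moment[of "sqrt v" 0 k] assms
  by (simp add: integrable_density)

lemma gau_moments:
  assumes "0 < v"
  shows "(\<integral>x. x \<partial>gau v) = 0" "(\<integral>x. x\<^sup>2 \<partial>gau v) = v"
proof -
  have "(\<integral>x. x \<partial>gau v) = integral\<^sup>L lborel (\<lambda>x. normal_density 0 (sqrt v) x * x)"
    by (subst integral_density) auto
  then show "(\<integral>x. x \<partial>gau v) = 0" using integral_normal_moment_nz_1[of "sqrt v" 0] assms by simp
  have "(\<integral>x. x\<^sup>2 \<partial>gau v) = integral\<^sup>L lborel (\<lambda>x. normal_density 0 (sqrt v) x * x\<^sup>2)"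
    by (subst integral_density) auto
  then show "(\<integral>x. x\<^sup>2 \<partial>gau v) = v"
    using integral_normal_moment_even[of "sqrt v" 0 1] assms by (simp add: fact_numeral)
qed

lemma gau_one_plus_sq_power:
  assumes "0 < v"
  shows "integrable (gau v) (\<lambda>x. (1 + x\<^sup>2) ^ p)"
proof -
  have "(\<lambda>x :: real. (1 + x\<^sup>2) ^ p) = (\<lambda>x. \<Sum>k\<le>p. real (p choose k) * x ^ (2 * (p - k)))"
    by (rule ext, subst binomial_ring) (simp add: power_mult)
  then show ?thesis
    using gau_power[OF assms] by (simp add: integrable_mult_right Bochner_Integration.integrable_sum)
qed

lemma
  assumes v: "\<And>p. p \<in> I \<Longrightarrow> 0 < v p" and p: "p \<in> I" and h: "integrable (gau (v p)) (h :: real \<Rightarrow> real)"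
  shows integrable_gaussian_array: "integrable (gaussian_array I v) (\<lambda>\<omega>. h (\<omega> p))"
    and integral_gaussian_array: "(\<integral>\<omega>. h (\<omega> p) \<partial>gaussian_array I v) = (\<integral>x. h x \<partial>gau (v p))"
proof -
  have ps: "prob_space (gau (v i))" if "i \<in> I" for i
    using v[OF that] by (intro prob_space_normal_density) simp
  have D: "distr (gaussian_array I v) (gau (v p)) (\<lambda>\<omega>. \<omega> p) = gau (v p)"
    unfolding gaussian_array_def by (rule distr_PiM_component[OF ps p])
  have m: "(\<lambda>\<omega>. \<omega> p) \<in> measurable (gaussian_array I v) (gau (v p))"
    unfolding gaussian_array_def using p by (rule measurable_component_singleton)
  have hm: "h \<in> borel_measurable (gau (v p))" using h by auto
  show "integrable (gaussian_array I v) (\<lambda>\<omega>. h (\<omega> p))"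
    using integrable_distr_eq[OF m hm] h unfolding D by simp
  show "(\<integral>\<omega>. h (\<omega> p) \<partial>gaussian_array I v) = (\<integral>x. h x \<partial>gau (v p))"
    using integral_distr[OF m hm] unfolding D by simp
qed

lemma indep_gaussian_array:
  assumes "\<And>p. p \<in> I \<Longrightarrow> 0 < v p" "finite I"
  shows "prob_space.indep_vars (gaussian_array I v) (\<lambda>_. borel) (\<lambda>p \<omega>. \<omega> p) I"
  unfolding gaussian_array_def
  by (rule indep_vars_PiM_components) (use assms in \<open>auto intro!: prob_space_normal_density\<close>)

text \<open>The coordinates of both vectors, indexed by a flag and a position, are jointly
  independent; grouping them by position gives independent pairs.\<close>

lemma indep_pairs:
  fixes N1 N2 :: "(nat \<Rightarrow> real) measure"
  assumes P: "prob_space N1" "prob_space N2"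
    and i1: "prob_space.indep_vars N1 (\<lambda>_. borel) (\<lambda>i \<omega>. \<omega> i) I"
    and i2: "prob_space.indep_vars N2 (\<lambda>_. borel) (\<lambda>i \<omega>. \<omega> i) I"
  shows "prob_space.indep_vars (N1 \<Otimes>\<^sub>M N2) (\<lambda>_. borel \<Otimes>\<^sub>M borel) (\<lambda>i w. (fst w i, snd w i)) I"
proof -
  let ?P = "N1 \<Otimes>\<^sub>M N2"
  interpret prob_space ?P by (rule prob_space_pair[OF P])
  have r1: "prob_space.indep_vars N1 (\<lambda>_. borel) (\<lambda>(j :: bool \<times> nat) \<omega>. \<omega> (snd j)) ({True} \<times> I)"
    by (rule indep_vars_reindex[OF P(1) i1]) (auto simp: inj_on_def)
  have r2: "prob_space.indep_vars N2 (\<lambda>_. borel) (\<lambda>(j :: bool \<times> nat) \<omega>. \<omega> (snd j)) ({False} \<times> I)"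
    by (rule indep_vars_reindex[OF P(2) i2]) (auto simp: inj_on_def)
  have "indep_vars (\<lambda>_. borel) (\<lambda>(j :: bool \<times> nat) w. if j \<in> {True} \<times> I then fst w (snd j) else snd w (snd j))
      ({True} \<times> I \<union> {False} \<times> I)"
    by (rule indep_vars_pair_measure[OF P r1 r2]) auto
  then have "indep_vars (\<lambda>i. PiM (UNIV \<times> {i}) (\<lambda>_. borel))
      (\<lambda>i w. restrict (\<lambda>j. if j \<in> {True} \<times> I then fst w (snd j) else snd w (snd j)) (UNIV \<times> {i})) I"
    by (rule indep_vars_restrict) (auto simp: disjoint_family_on_def)
  then have "indep_vars (\<lambda>_. borel \<Otimes>\<^sub>M borel) (\<lambda>i w. (\<lambda>\<eta>. (\<eta> (True, i), \<eta> (False, i)))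
      (restrict (\<lambda>j. if j \<in> {True} \<times> I then fst w (snd j) else snd w (snd j)) (UNIV \<times> {i}))) I"
    by (rule indep_vars_compose2) (intro measurable_Pair measurable_component_singleton; simp)
  then show ?thesis
    by (rule indep_vars_cong[THEN iffD1, rotated -1]) auto
qed

text \<open>The label of a key selects the copy; within one copy, injectivity of \<open>f\<close> on
  pairs ensures that different keys read different entries.\<close>

lemma indep_two_copies:
  fixes R :: "(nat \<times> nat \<Rightarrow> real) measure" and f :: "nat set \<Rightarrow> nat \<times> nat"
  assumes P: "prob_space R" and ind: "prob_space.indep_vars R (\<lambda>_. borel) (\<lambda>p \<omega>. \<omega> p) I"
    and f: "inj_on f (snd ` Ks)" "f ` snd ` Ks \<subseteq> I"
  shows "prob_space.indep_vars (R \<Otimes>\<^sub>M R) (\<lambda>_. borel)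
    (\<lambda>(k :: bool \<times> nat set) w. c * (if fst k then fst w else snd w) (f (snd k))) Ks"
proof -
  interpret prob_space "R \<Otimes>\<^sub>M R" by (rule prob_space_pair[OF P P])
  have r: "prob_space.indep_vars R (\<lambda>_. borel) (\<lambda>(k :: bool \<times> nat set) \<omega>. \<omega> (f (snd k))) {k \<in> Ks. fst k = b}" for b
  proof (rule indep_vars_reindex[OF P ind, of "\<lambda>k. f (snd k)"])
    show "inj_on (\<lambda>k. f (snd k)) {k \<in> Ks. fst k = b}"
      using f(1) by (auto simp: inj_on_def image_iff)
    show "(\<lambda>k. f (snd k)) ` {k \<in> Ks. fst k = b} \<subseteq> I" using f(2) by auto
  qed
  have "indep_vars (\<lambda>_. borel) (\<lambda>(k :: bool \<times> nat set) w. if k \<in> {k \<in> Ks. fst k = True} then fst w (f (snd k)) else snd w (f (snd k)))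
      ({k \<in> Ks. fst k = True} \<union> {k \<in> Ks. fst k = False})"
    by (rule indep_vars_pair_measure[OF P P r r]) auto
  moreover have "{k \<in> Ks. fst k = True} \<union> {k \<in> Ks. fst k = False} = Ks" by auto
  ultimately have "indep_vars (\<lambda>_. borel) (\<lambda>k w. if k \<in> {k \<in> Ks. fst k = True} then fst w (f (snd k)) else snd w (f (snd k))) Ks"
    by simp
  then have "indep_vars (\<lambda>_. borel) (\<lambda>k w. (\<lambda>x. c * x) (if k \<in> {k \<in> Ks. fst k = True} then fst w (f (snd k)) else snd w (f (snd k)))) Ks"
    by (rule indep_vars_compose2) auto
  then show ?thesis
    by (rule indep_vars_cong[THEN iffD1, rotated -1]) auto
qed

text \<open>The 81 is the fourth power of the 3 in \<open>1 + x\<^sup>2 + (b * x + c * y)\<^sup>2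
  \<le> 3 * (1 + x\<^sup>2) * (1 + y\<^sup>2)\<close>. The value does not involve \<rho>, so the
  estimator may use it.\<close>

definition Phi_bound :: real where
  "Phi_bound = 1 + 81 * (\<integral>x. (1 + x\<^sup>2) ^ 4 \<partial>gau 1)\<^sup>2"

lemma Phi_bound_ge_1: "1 \<le> Phi_bound"
  by (simp add: Phi_bound_def)

text \<open>Cauchy-Schwarz with \<open>b\<^sup>2 + c\<^sup>2 = 1\<close> makes the bound uniform in
  the correlation. Columns use \<open>b = \<rho>\<close>; the choice \<open>b = 0\<close>,
  \<open>c = 1\<close> covers the independent pair at a row of the Wishart model.\<close>

lemma
  fixes N :: nat
  assumes i: "i < N" and bc: "b\<^sup>2 + c\<^sup>2 = 1"
  shows gauss_pair_integrable: "integrable (gaussian_vec N 1 \<Otimes>\<^sub>M gaussian_vec N 1)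
      (\<lambda>w. (1 + (fst w i)\<^sup>2 + (b * fst w i + c * snd w i)\<^sup>2) ^ p)" (is ?int)
    and gauss_pair_fourth: "(\<integral>w. (1 + (fst w i)\<^sup>2 + (b * fst w i + c * snd w i)\<^sup>2) ^ 4
      \<partial>(gaussian_vec N 1 \<Otimes>\<^sub>M gaussian_vec N 1)) \<le> Phi_bound"
proof -
  let ?G = "gaussian_vec N 1"
  have G: "prob_space ?G" by (simp add: prob_space_gaussian_vec)
  have ig: "integrable ?G (\<lambda>\<omega>. (1 + (\<omega> i)\<^sup>2) ^ p)"
    and eg: "(\<integral>\<omega>. (1 + (\<omega> i)\<^sup>2) ^ p \<partial>?G) = (\<integral>x. (1 + x\<^sup>2) ^ p \<partial>gau 1)" for p
    unfolding gaussian_vec_def using i gau_one_plus_sq_power[of 1 p]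
      integrable_gaussian_array[of "{..<N}" "\<lambda>_. 1" i "\<lambda>x. (1 + x\<^sup>2) ^ p"]
      integral_gaussian_array[of "{..<N}" "\<lambda>_. 1" i "\<lambda>x. (1 + x\<^sup>2) ^ p"]
    by auto
  have dom: "(1 + x\<^sup>2 + (b * x + c * y)\<^sup>2) \<le> 3 * (1 + x\<^sup>2) * (1 + y\<^sup>2)" for x y :: real
  proof -
    have "(b * x + c * y)\<^sup>2 \<le> (b\<^sup>2 + c\<^sup>2) * (x\<^sup>2 + y\<^sup>2)"
      using zero_le_power2[of "b * y - c * x"] by (simp add: power2_eq_square algebra_simps)
    then have "1 + x\<^sup>2 + (b * x + c * y)\<^sup>2 \<le> 1 + 2 * x\<^sup>2 + y\<^sup>2" using bc by simp
    also have "\<dots> \<le> 3 * (1 + x\<^sup>2) * (1 + y\<^sup>2)"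
      using mult_nonneg_nonneg[of "x\<^sup>2" "y\<^sup>2"] zero_le_power2[of x] zero_le_power2[of y]
      unfolding distrib_left distrib_right by linarith
    finally show ?thesis .
  qed
  have nn: "0 \<le> 1 + x\<^sup>2 + (b * x + c * y)\<^sup>2" for x y :: real by simp
  have domp: "(1 + x\<^sup>2 + (b * x + c * y)\<^sup>2) ^ p \<le> 3 ^ p * ((1 + x\<^sup>2) ^ p * (1 + y\<^sup>2) ^ p)" for x y p
    using power_mono[OF dom nn, of x y p] by (simp only: power_mult_distrib mult.assoc)
  have iu: "integrable (?G \<Otimes>\<^sub>M ?G) (\<lambda>w. 3 ^ p * ((1 + (fst w i)\<^sup>2) ^ p * (1 + (snd w i)\<^sup>2) ^ p))" for p
    by (intro integrable_mult_right integral_pair_product(1)[OF G G ig ig])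
  have meas: "(\<lambda>w. (1 + (fst w i)\<^sup>2 + (b * fst w i + c * snd w i)\<^sup>2) ^ p) \<in> borel_measurable (?G \<Otimes>\<^sub>M ?G)" for p
  proof -
    have [measurable]: "(\<lambda>w. fst w i) \<in> borel_measurable (?G \<Otimes>\<^sub>M ?G)" "(\<lambda>w. snd w i) \<in> borel_measurable (?G \<Otimes>\<^sub>M ?G)"
      by (rule measurable_vec_entry[of _ _ N]; use i in measurable)+
    show ?thesis by measurable
  qed
  show int: "integrable (?G \<Otimes>\<^sub>M ?G) (\<lambda>w. (1 + (fst w i)\<^sup>2 + (b * fst w i + c * snd w i)\<^sup>2) ^ p)" for p
  proof (rule Bochner_Integration.integrable_bound[OF iu meas])
    have "norm ((1 + x\<^sup>2 + (b * x + c * y)\<^sup>2) ^ p) \<le> norm (3 ^ p * ((1 + x\<^sup>2) ^ p * (1 + y\<^sup>2) ^ p))" for x y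
      using domp[of x y p] zero_le_power[OF nn, of x y p] by (simp only: real_norm_def)
    then show "AE w in ?G \<Otimes>\<^sub>M ?G. norm ((1 + (fst w i)\<^sup>2 + (b * fst w i + c * snd w i)\<^sup>2) ^ p)
        \<le> norm (3 ^ p * ((1 + (fst w i)\<^sup>2) ^ p * (1 + (snd w i)\<^sup>2) ^ p))" by (intro AE_I2)
  qed
  have "(\<integral>w. (1 + (fst w i)\<^sup>2 + (b * fst w i + c * snd w i)\<^sup>2) ^ 4 \<partial>(?G \<Otimes>\<^sub>M ?G))
      \<le> (\<integral>w. 3 ^ 4 * ((1 + (fst w i)\<^sup>2) ^ 4 * (1 + (snd w i)\<^sup>2) ^ 4) \<partial>(?G \<Otimes>\<^sub>M ?G))"
    by (intro integral_mono int iu domp)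
  also have "\<dots> = 3 ^ 4 * ((\<integral>x. (1 + x\<^sup>2) ^ 4 \<partial>gau 1) * (\<integral>x. (1 + x\<^sup>2) ^ 4 \<partial>gau 1))"
    using integral_pair_product(2)[OF G G ig ig, of 4 4] by (simp add: eg)
  also have "\<dots> \<le> Phi_bound" by (simp add: Phi_bound_def power2_eq_square)
  finally show "(\<integral>w. (1 + (fst w i)\<^sup>2 + (b * fst w i + c * snd w i)\<^sup>2) ^ 4 \<partial>(?G \<Otimes>\<^sub>M ?G)) \<le> Phi_bound" .
qed

text \<open>\<open>cswish\<close> groups \<open>u\<close> and \<open>v\<close> with the noise,
  whereas the locale needs all spike coordinates in one factor.\<close>

lemma distr_assoc:
  assumes "prob_space A" "prob_space B" "prob_space C"
  shows "distr ((A \<Otimes>\<^sub>M B) \<Otimes>\<^sub>M C) (A \<Otimes>\<^sub>M (B \<Otimes>\<^sub>M C)) (\<lambda>((a, b), c). (a, (b, c))) = A \<Otimes>\<^sub>M (B \<Otimes>\<^sub>M C)"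
proof (rule measure_eqI)
  interpret A: prob_space A by fact
  interpret B: prob_space B by fact
  interpret C: prob_space C by fact
  interpret AB: pair_prob_space A B ..
  interpret BC: pair_prob_space B C ..
  interpret AB_C: pair_prob_space "A \<Otimes>\<^sub>M B" C ..
  interpret A_BC: pair_prob_space A "B \<Otimes>\<^sub>M C" ..
  let ?T = "\<lambda>((a, b), c). (a, (b, c))"
  fix X assume "X \<in> sets (distr ((A \<Otimes>\<^sub>M B) \<Otimes>\<^sub>M C) (A \<Otimes>\<^sub>M (B \<Otimes>\<^sub>M C)) ?T)"
  then have X[measurable]: "X \<in> sets (A \<Otimes>\<^sub>M (B \<Otimes>\<^sub>M C))" by simp
  have T[measurable]: "?T \<in> measurable ((A \<Otimes>\<^sub>M B) \<Otimes>\<^sub>M C) (A \<Otimes>\<^sub>M (B \<Otimes>\<^sub>M C))"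
    unfolding case_prod_beta by measurable
  have "emeasure (distr ((A \<Otimes>\<^sub>M B) \<Otimes>\<^sub>M C) (A \<Otimes>\<^sub>M (B \<Otimes>\<^sub>M C)) ?T) X
      = (\<integral>\<^sup>+w. indicator X w \<partial>(distr ((A \<Otimes>\<^sub>M B) \<Otimes>\<^sub>M C) (A \<Otimes>\<^sub>M (B \<Otimes>\<^sub>M C)) ?T))"
    by simp
  also have "\<dots> = (\<integral>\<^sup>+w. indicator X (?T w) \<partial>((A \<Otimes>\<^sub>M B) \<Otimes>\<^sub>M C))"
    by (rule nn_integral_distr[OF T]) simp
  also have "\<dots> = (\<integral>\<^sup>+ab. \<integral>\<^sup>+c. indicator X (fst ab, (snd ab, c)) \<partial>C \<partial>(A \<Otimes>\<^sub>M B))"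
    by (subst C.nn_integral_fst[symmetric]) (auto simp: case_prod_beta)
  also have "\<dots> = (\<integral>\<^sup>+a. \<integral>\<^sup>+b. \<integral>\<^sup>+c. indicator X (a, (b, c)) \<partial>C \<partial>B \<partial>A)"
    by (subst B.nn_integral_fst[symmetric]) auto
  also have "\<dots> = (\<integral>\<^sup>+a. \<integral>\<^sup>+bc. indicator X (a, bc) \<partial>(B \<Otimes>\<^sub>M C) \<partial>A)"
    by (intro nn_integral_cong, subst C.nn_integral_fst[symmetric]) auto
  also have "\<dots> = (\<integral>\<^sup>+w. indicator X w \<partial>(A \<Otimes>\<^sub>M (B \<Otimes>\<^sub>M C)))"
    by (subst BC.P.nn_integral_fst[symmetric]) auto
  also have "\<dots> = emeasure (A \<Otimes>\<^sub>M (B \<Otimes>\<^sub>M C)) X" by simp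
  finally show "emeasure (distr ((A \<Otimes>\<^sub>M B) \<Otimes>\<^sub>M C) (A \<Otimes>\<^sub>M (B \<Otimes>\<^sub>M C)) ?T) X = emeasure (A \<Otimes>\<^sub>M (B \<Otimes>\<^sub>M C)) X" .
qed simp

section \<open>Reading matrix entries along walks; measurability\<close>

lemma keys_1:
  assumes "k \<in> model_keys 1 n m"
  obtains x y where "x < y" "y < n" "snd k = {x, y}" "Min (snd k) = x" "Max (snd k) = y"
proof -
  obtain x y where "x < n" "y < n" "x \<noteq> y" "snd k = {x, y}"
    using assms by (auto simp: model_keys_def columns_def)
  then show ?thesis
    using that[of x y] that[of y x] by (cases "x < y") (auto simp: insert_commute)
qed

lemma keys_2:
  assumes "k \<in> model_keys 2 n m"
  obtains x y where "x < m" "y < n" "snd k = {x + n, y}" "Min (snd k) = y" "Max (snd k) = x + n"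
proof -
  obtain x y where "n \<le> x" "x < n + m" "y < n" "snd k = {x, y}"
    using assms by (auto simp: model_keys_def columns_def)
  then show ?thesis using that[of "x - n" y] by auto
qed

lemma matrix_entry_measurable:
  assumes e: "e = 1 \<and> n = m \<or> e = 2" and k: "k \<in> model_keys e n m"
  shows "matrix_entry e n k \<in> borel_measurable (mat_space n m \<Otimes>\<^sub>M mat_space n m)"
proof -
  have idx: "Min (snd k) < n \<and> Max (snd k) - (if e = 1 then 0 else n) < m"
    using e
  proof
    assume "e = 1 \<and> n = m"
    moreover from this k have "k \<in> model_keys 1 n m" by simp
    ultimately show ?thesis by (elim keys_1) simp
  next
    assume "e = 2"
    moreover from this k have "k \<in> model_keys 2 n m" by simp
    ultimately show ?thesis by (elim keys_2) simp
  qed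
  show ?thesis
    unfolding matrix_entry_def[abs_def] using idx
    by (cases "fst k") (simp_all add: measurable_mat_entry[OF measurable_fst] measurable_mat_entry[OF measurable_snd])
qed

lemma stat_measurable:
  assumes e: "e = 1 \<and> n = m \<or> e = 2" and J: "3 \<le> J"
  shows "cycle_stat e n m p pre c J \<in> borel_measurable (mat_space n m \<Otimes>\<^sub>M mat_space n m)"
  unfolding cycle_stat_def[abs_def] Let_def
proof (intro borel_measurable_sum borel_measurable_times borel_measurable_const borel_measurable_prod)
  fix ks x k
  assume ks: "ks \<in> block_lists c J" and x: "x \<in> vertex_lists e n m (length (stretch e (pre @ word p ks)))"
    and k: "k \<in> edges (zip (stretch e (pre @ word p ks)) x)"
  have "J \<le> length (word p ks)" using ks length_word_ge[of ks p] by (simp add: block_lists_def)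
  then have "3 \<le> length (pre @ word p ks)" using J by simp
  also have "\<dots> \<le> e * length (pre @ word p ks)" using e by auto
  finally have "3 \<le> length (stretch e (pre @ word p ks))" by (simp only: length_stretch)
  then have "edges (zip (stretch e (pre @ word p ks)) x) \<subseteq> model_keys e n m"
    using e by (intro vertex_lists_cycle(2)[OF _ x]) auto
  then show "matrix_entry e n k \<in> borel_measurable (mat_space n m \<Otimes>\<^sub>M mat_space n m)"
    using k by (intro matrix_entry_measurable[OF e]) auto
qed

lemma estimator_measurable:
  assumes e: "e = 1 \<and> n = m \<or> e = 2"
  shows "estimator e K p n m \<in> borel_measurable (mat_space n m \<Otimes>\<^sub>M mat_space n m)"
\<comment> \<open>At level 0 both sums are empty and the estimator is the constant 0. Any positive
  level is at least 3, so that the closed walks are long enough to be cycles.\<close>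
proof (cases "level e K n m = 0")
  case True
  then show ?thesis by (simp add: estimator_def[abs_def])
next
  case False
  then have J: "3 \<le> level e K n m" using level_ok_level[of e K n m] by (simp add: level_ok_def)
  show ?thesis
    unfolding estimator_def[abs_def] Let_def
    by (intro borel_measurable_divide borel_measurable_sum borel_measurable_times
        borel_measurable_power borel_measurable_const stat_measurable[OF e J])
qed

context spiked_app
begin

text \<open>Choosing \<open>g = real J\<close> identifies \<open>error_const\<close> with the
  constant tested by \<open>list_ok\<close>, whose two inequalities then absorb the error terms of
  \<open>model_stat_moments\<close>.\<close>

lemma stat_moments_distr:
  fixes T :: "'a \<times> 'b \<Rightarrow> rmat \<times> rmat"
  assumes T: "T \<in> measurable (P \<Otimes>\<^sub>M Q) (mat_space n m \<Otimes>\<^sub>M mat_space n m)"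
    and matrix_entry: "\<And>w k. k \<in> model_keys e n m \<Longrightarrow> matrix_entry e n k (T w) = X k w / sqrt m"
    and level_ok: "level_ok e K n m J" and g: "g = real J" and i: "i < J"
  shows "stat_moments (distr (P \<Otimes>\<^sub>M Q) (mat_space n m \<Otimes>\<^sub>M mat_space n m) T) e n m p
    (\<lambda>l. gam l ^ e) \<rho> J (from_nat i)"
proof -
  let ?c = "from_nat i :: nat list" and ?q = "aspect e n m"
  let ?M = "distr (P \<Otimes>\<^sub>M Q) (mat_space n m \<Otimes>\<^sub>M mat_space n m) T"
  have J: "3 \<le> J" and gc: "list_ok e K n m J ?c" using level_ok i by (auto simp: level_ok_def)
  define R where "R = err_const (real J) K (max_len e J ?c) (1 + 1 / ?q)"
  define Hm where "Hm = 2 * block_signal ?c (\<lambda>_. 1) ^ J * (1 + ?q) ^ (1 + J * length ?c)"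
  have q0: "0 < ?q" and m0: "0 < m" and R1: "R \<le> real m" and R2: "R * Hm\<^sup>2 \<le> real m * noise_scale e ?q J ?c"
    and vertex_lists: "\<And>l. l \<le> 1 + J * length ?c \<Longrightarrow> 0 < card (vertex_lists e n m (e * l))"
      "\<And>l. l \<le> 1 + J * length ?c \<Longrightarrow> real m ^ (e * l) \<le> 2 * ?q ^ l * card (vertex_lists e n m (e * l))"
    using gc unfolding list_ok_def Let_def R_def Hm_def by auto
  have nq: "real n \<le> real m / ?q"
    using e q0 by (auto simp: aspect_def)
  have error_const: "error_const (e * (1 + J * length ?c)) (1 + 1 / ?q) = R"
    unfolding R_def max_len_def g[symmetric] by (rule error_const_eq)
  have cn: "0 \<le> block_noise ?c ?q" using q0 by (simp add: block_noise_nonneg)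
  have Rm: "R / m \<le> 1" "R * Hm\<^sup>2 / m \<le> noise_scale e ?q J ?c"
    using R1 R2 m0 by (simp_all add: pos_divide_le_eq mult.commute)
  have *: "integrable ?M (cycle_stat e n m p pre ?c J) \<and> integrable ?M (\<lambda>x. (cycle_stat e n m p pre ?c J x)\<^sup>2) \<and>
      integral\<^sup>L ?M (cycle_stat e n m p pre ?c J) = (gam p ^ e) ^ length pre * block_signal ?c (block_weight (\<lambda>l. gam l ^ e) \<rho> p) ^ J \<and>
      (\<integral>x. (cycle_stat e n m p pre ?c J x)\<^sup>2 \<partial>?M) - ((gam p ^ e) ^ length pre * block_signal ?c (block_weight (\<lambda>l. gam l ^ e) \<rho> p) ^ J)\<^sup>2
        \<le> (1 + 4 * ?q ^ length pre) * noise_scale e ?q J ?c"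
    if pre: "pre = [] \<or> pre = [p]" for pre
  proof -
    note sm = model_stat_moments[where c = ?c, OF J q0 nq pre vertex_lists]
    have st: "cycle_stat e n m p pre ?c J (T w) = model_stat p pre ?c J w" for w
      by (rule cycle_stat_eq_model_stat[OF matrix_entry J])
    have meas: "cycle_stat e n m p pre ?c J \<in> borel_measurable (mat_space n m \<Otimes>\<^sub>M mat_space n m)"
      using stat_measurable[OF _ J] e by blast
    have meas2: "(\<lambda>x. (cycle_stat e n m p pre ?c J x)\<^sup>2) \<in> borel_measurable (mat_space n m \<Otimes>\<^sub>M mat_space n m)"
      using meas by measurable
    have m: "integral\<^sup>L ?M (cycle_stat e n m p pre ?c J) = (gam p ^ e) ^ length pre * block_signal ?c (block_weight (\<lambda>l. gam l ^ e) \<rho> p) ^ J"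
      by (subst integral_distr[OF T meas]) (simp add: st sm(3) power_mult)
    have v: "(\<integral>x. (cycle_stat e n m p pre ?c J x)\<^sup>2 \<partial>?M) - (integral\<^sup>L ?M (cycle_stat e n m p pre ?c J))\<^sup>2
        \<le> (real (max_len e J ?c))\<^sup>2 * (1 + R / m) * (2 * ?q ^ length pre * block_noise ?c ?q ^ J) + R * Hm\<^sup>2 / m"
      unfolding integral_distr[OF T meas] integral_distr[OF T meas2] st
      using sm(4) by (simp only: error_const Hm_def max_len_def)
    also have "\<dots> \<le> (real (max_len e J ?c))\<^sup>2 * (1 + 1) * (2 * ?q ^ length pre * block_noise ?c ?q ^ J) + noise_scale e ?q J ?c"
      using Rm cn q0 by (intro add_mono mult_right_mono mult_left_mono) auto
    also have "\<dots> = (1 + 4 * ?q ^ length pre) * noise_scale e ?q J ?c"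
      by (simp add: noise_scale_def algebra_simps)
    finally show ?thesis
      unfolding m integrable_distr_eq[OF T meas] integrable_distr_eq[OF T meas2] st
      using sm(1,2) by simp
  qed
  show ?thesis unfolding stat_moments_def using *[of "[]"] *[of "[p]"] by simp
qed

end

section \<open>The two models satisfy the locale assumptions\<close>

lemma two_copies_moments:
  fixes R :: "(nat \<times> nat \<Rightarrow> real) measure"
  assumes R: "prob_space R" and i: "integrable R (\<lambda>\<omega>. \<omega> p)" "integrable R (\<lambda>\<omega>. (\<omega> p)\<^sup>2)"
    and v: "(\<integral>\<omega>. \<omega> p \<partial>R) = 0" "(\<integral>\<omega>. (\<omega> p)\<^sup>2 \<partial>R) = v" and c: "c\<^sup>2 * v = 1"
  shows "integrable (R \<Otimes>\<^sub>M R) (\<lambda>w. c * (if b then fst w else snd w) p)"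
    "integrable (R \<Otimes>\<^sub>M R) (\<lambda>w. (c * (if b then fst w else snd w) p)\<^sup>2)"
    "(\<integral>w. c * (if b then fst w else snd w) p \<partial>(R \<Otimes>\<^sub>M R)) = 0"
    "(\<integral>w. (c * (if b then fst w else snd w) p)\<^sup>2 \<partial>(R \<Otimes>\<^sub>M R)) = 1"
  using integrable_fst[OF R R i(1)] integrable_snd[OF R R i(1)] integrable_fst[OF R R i(2)] integrable_snd[OF R R i(2)]
    integral_fst[OF R R i(1)] integral_snd[OF R R i(1)] integral_fst[OF R R i(2)] integral_snd[OF R R i(2)] v c
  by (cases b; simp add: power_mult_distrib)+

lemma
  assumes v: "0 < v" and ij: "i < j" "j < n" and h: "integrable (gau v) h" "h \<in> borel_measurable borel"
  shows integrable_goe: "integrable (goe n v) (\<lambda>\<omega>. h (\<omega> (i, j)) :: real)"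
    and integral_goe: "(\<integral>\<omega>. h (\<omega> (i, j)) \<partial>goe n v) = (\<integral>x. h x \<partial>gau v)"
proof -
  let ?I = "{(i, j). i \<le> j \<and> j < n}" and ?v = "\<lambda>(i, j). if i = j then 2 * v else v"
  have m: "(\<lambda>\<omega>. h (\<omega> (i, j))) \<in> borel_measurable (mat_space n n)"
    using ij by (intro measurable_compose[OF measurable_mat_entry[of "\<lambda>x. x" "mat_space n n" n n i j] h(2)]) auto
  have s: "symmetrize n \<omega> (i, j) = \<omega> (i, j)" for \<omega> using ij by (simp add: symmetrize_def min_def max_def)
  have vp: "0 < ?v p" if "p \<in> ?I" for p using v by (cases p) simp
  have p: "(i, j) \<in> ?I" and hv: "integrable (gau (?v (i, j))) h" using ij h by auto
  note * = integrable_gaussian_array[of ?I ?v "(i, j)" h, OF vp p hv]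
    integral_gaussian_array[of ?I ?v "(i, j)" h, OF vp p hv]
  show "integrable (goe n v) (\<lambda>\<omega>. h (\<omega> (i, j)))"
    unfolding goe_def integrable_distr_eq[OF measurable_symmetrize m] s using *(1) by simp
  show "(\<integral>\<omega>. h (\<omega> (i, j)) \<partial>goe n v) = (\<integral>x. h x \<partial>gau v)"
    unfolding goe_def integral_distr[OF measurable_symmetrize m] s using *(2) ij by simp
qed

text \<open>On the strictly upper triangle \<open>symmetrize\<close> acts as the identity, so
  independence of the underlying array is inherited.\<close>

lemma indep_goe:
  assumes v: "0 < v"
  shows "prob_space.indep_vars (goe n v) (\<lambda>_. borel) (\<lambda>p \<omega>. \<omega> p) {(i, j). i < j \<and> j < n}"
proof -
  let ?I = "{(i, j). i \<le> j \<and> j < n}" and ?v = "\<lambda>(i, j). if i = j then 2 * v else v"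
  let ?G = "gaussian_array ?I ?v"
  have vp: "0 < ?v p" if "p \<in> ?I" for p using v by (cases p) simp
  have G: "prob_space ?G" by (rule prob_space_gaussian_array[OF vp])
  interpret prob_space ?G by (rule G)
  have fin: "finite ?I" by (rule finite_subset[of _ "{..n} \<times> {..n}"]) auto
  have "indep_vars (\<lambda>_. borel) (\<lambda>p \<omega>. \<omega> p) {(i, j). i < j \<and> j < n}"
    by (rule indep_vars_subset[OF indep_gaussian_array[OF vp fin]]) auto
  then have "indep_vars (\<lambda>_. borel) (\<lambda>p \<omega>. symmetrize n \<omega> p) {(i, j). i < j \<and> j < n}"
    by (rule indep_vars_cong[THEN iffD1, rotated -1]) (auto simp: symmetrize_def min_def max_def fun_eq_iff)
  then show ?thesis
    unfolding goe_def
    by (rule indep_vars_distr[OF G measurable_symmetrize])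
      (use measurable_mat_entry[of "\<lambda>x. x"] in auto)
qed

text \<open>The factor \<open>sqrt N\<close> restores unit variance to the coordinates of the spike
  vectors.\<close>

definition coord :: "nat \<Rightarrow> bool \<Rightarrow> nat \<Rightarrow> rvec \<times> rvec \<Rightarrow> real" where
  "coord N l i w = sqrt N * (if l then fst w else snd w) i"

lemma coord_correlate:
  assumes "i < N"
  shows "coord N True i (correlate N \<rho> w) = fst w i"
    "coord N False i (correlate N \<rho> w) = \<rho> * fst w i + sqrt (1 - \<rho>\<^sup>2) * snd w i"
  using assms by (simp_all add: coord_def correlate_def case_prod_beta)

lemma coord_measurable:
  "i < N \<Longrightarrow> coord N l i \<in> borel_measurable (vec_space N \<Otimes>\<^sub>M vec_space N)"
  unfolding coord_def[abs_def]
  by (cases l) (auto intro!: borel_measurable_times measurable_vec_entry[of fst _ N] measurable_vec_entry[of snd _ N])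

lemma indep_coord:
  "prob_space.indep_vars (correlated_pair N \<rho>) (\<lambda>_. borel \<Otimes>\<^sub>M borel)
    (\<lambda>i w. (coord N True i w, coord N False i w)) {..<N}"
proof -
  let ?G = "gaussian_vec N 1"
  have G: "prob_space ?G" by (simp add: prob_space_gaussian_vec)
  interpret prob_space "?G \<Otimes>\<^sub>M ?G" by (rule prob_space_pair[OF G G])
  have ig: "prob_space.indep_vars ?G (\<lambda>_. borel) (\<lambda>i \<omega>. \<omega> i) {..<N}"
    unfolding gaussian_vec_def by (rule indep_gaussian_array) auto
  have "indep_vars (\<lambda>_. borel \<Otimes>\<^sub>M borel) (\<lambda>i w. (\<lambda>(x, y). (x, \<rho> * x + sqrt (1 - \<rho>\<^sup>2) * y)) (fst w i, snd w i)) {..<N}"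
    by (rule indep_vars_compose2[OF indep_pairs[OF G G ig ig]]) measurable
  then have "indep_vars (\<lambda>_. borel \<Otimes>\<^sub>M borel)
      (\<lambda>i w. (coord N True i (correlate N \<rho> w), coord N False i (correlate N \<rho> w))) {..<N}"
    by (rule indep_vars_cong[THEN iffD1, rotated -1]) (auto simp: coord_correlate)
  then show ?thesis
    unfolding correlated_pair_def
    by (rule indep_vars_distr[OF prob_space_pair[OF G G] measurable_correlate])
      (auto intro!: measurable_Pair coord_measurable)
qed

lemma coord_moments:
  assumes i: "i < N" and \<rho>: "\<rho> \<in> {0..1}"
  shows "(\<integral>w. coord N l i w * coord N l i w \<partial>correlated_pair N \<rho>) = 1"
    "(\<integral>w. coord N True i w * coord N False i w \<partial>correlated_pair N \<rho>) = \<rho>"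
    "integrable (correlated_pair N \<rho>) (\<lambda>w. (1 + (coord N True i w)\<^sup>2 + (coord N False i w)\<^sup>2) ^ p)"
    "(\<integral>w. (1 + (coord N True i w)\<^sup>2 + (coord N False i w)\<^sup>2) ^ 4 \<partial>correlated_pair N \<rho>) \<le> Phi_bound"
proof -
  have N0: "0 < real N" using i by simp
  have sq: "sqrt N * x * (sqrt N * y) = real N * (x * y)" for x y :: real by simp
  note cm = correlated_pair_moments[OF \<rho> i i, unfolded case_prod_beta]
  show "(\<integral>w. coord N l i w * coord N l i w \<partial>correlated_pair N \<rho>) = 1"
    unfolding coord_def sq using cm(3,4) N0 by (cases l) simp_all
  show "(\<integral>w. coord N True i w * coord N False i w \<partial>correlated_pair N \<rho>) = \<rho>"
    unfolding coord_def sq using cm(5) N0 by simp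
  have "\<rho>\<^sup>2 + (sqrt (1 - \<rho>\<^sup>2))\<^sup>2 = 1" using \<rho> by (simp add: power_le_one)
  note gp = gauss_pair_integrable[OF i this] gauss_pair_fourth[OF i this]
  have m: "(\<lambda>w. (1 + (coord N True i w)\<^sup>2 + (coord N False i w)\<^sup>2) ^ p) \<in> borel_measurable (vec_space N \<Otimes>\<^sub>M vec_space N)" for p
    using coord_measurable[OF i] by measurable
  show "integrable (correlated_pair N \<rho>) (\<lambda>w. (1 + (coord N True i w)\<^sup>2 + (coord N False i w)\<^sup>2) ^ p)"
    unfolding correlated_pair_def integrable_distr_eq[OF measurable_correlate m] coord_correlate[OF i] by (rule gp(1))
  show "(\<integral>w. (1 + (coord N True i w)\<^sup>2 + (coord N False i w)\<^sup>2) ^ 4 \<partial>correlated_pair N \<rho>) \<le> Phi_bound"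
    unfolding correlated_pair_def integral_distr[OF measurable_correlate m] coord_correlate[OF i] by (rule gp(2))
qed

definition spike_pair :: "real \<Rightarrow> real \<Rightarrow> bool \<Rightarrow> real" where
  "spike_pair \<alpha> \<beta> l = (if l then \<alpha> else \<beta>)"

definition noise_coord :: "nat \<Rightarrow> nat \<Rightarrow> bool \<times> nat set \<Rightarrow> rmat \<times> rmat \<Rightarrow> real" where
  "noise_coord d m k w = sqrt m * (if fst k then fst w else snd w) (Min (snd k), Max (snd k) - d)"

lemma spiked_cswig:
  assumes n: "0 < n" and \<rho>: "\<rho> \<in> {0..1}" and ab: "0 \<le> \<alpha>" "0 \<le> \<beta>" "\<alpha> \<le> g" "\<beta> \<le> g" and g: "1 \<le> g"
  shows "spiked_app (correlated_pair n \<rho>) (goe n (1 / n) \<Otimes>\<^sub>M goe n (1 / n)) (coord n) (noise_coord 0 n)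
    (spike_pair \<alpha> \<beta>) (\<lambda>_. \<rho>) g Phi_bound 1 n n \<rho>"
proof -
  let ?R = "goe n (1 / real n)"
  have v: "0 < 1 / real n" using n by simp
  have R: "prob_space ?R" by (rule prob_space_goe[OF v])
  have e1: "integrable ?R (\<lambda>\<omega>. \<omega> (i, j))" "integrable ?R (\<lambda>\<omega>. (\<omega> (i, j))\<^sup>2)"
    "(\<integral>\<omega>. \<omega> (i, j) \<partial>?R) = 0" "(\<integral>\<omega>. (\<omega> (i, j))\<^sup>2 \<partial>?R) = 1 / real n" if "i < j" "j < n" for i j
    using integrable_goe[OF v that gau_power[OF v, of 1]] integral_goe[OF v that gau_power[OF v, of 1]]
      integrable_goe[OF v that gau_power[OF v, of 2]] integral_goe[OF v that gau_power[OF v, of 2]]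
      gau_moments[OF v] by simp_all
  have c: "(sqrt (real n))\<^sup>2 * (1 / real n) = 1" using n by simp
  have Zm: "integrable (?R \<Otimes>\<^sub>M ?R) (noise_coord 0 n k)" "integrable (?R \<Otimes>\<^sub>M ?R) (\<lambda>w. (noise_coord 0 n k w)\<^sup>2)"
    "(\<integral>w. noise_coord 0 n k w \<partial>(?R \<Otimes>\<^sub>M ?R)) = 0" "(\<integral>w. (noise_coord 0 n k w)\<^sup>2 \<partial>(?R \<Otimes>\<^sub>M ?R)) = 1"
    if k: "k \<in> model_keys 1 n n" for k
  proof -
    obtain x y where xy: "x < y" "y < n" "snd k = {x, y}" "Min (snd k) = x" "Max (snd k) = y"
      using keys_1[OF k] .
    note t = two_copies_moments[OF R e1[OF xy(1,2)] c, of "fst k"]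
    have Z: "noise_coord 0 n k = (\<lambda>w. sqrt (real n) * (if fst k then fst w else snd w) (x, y))"
      by (rule ext) (simp only: noise_coord_def xy(4,5) diff_zero)
    show "integrable (?R \<Otimes>\<^sub>M ?R) (noise_coord 0 n k)" "integrable (?R \<Otimes>\<^sub>M ?R) (\<lambda>w. (noise_coord 0 n k w)\<^sup>2)"
      "(\<integral>w. noise_coord 0 n k w \<partial>(?R \<Otimes>\<^sub>M ?R)) = 0" "(\<integral>w. (noise_coord 0 n k w)\<^sup>2 \<partial>(?R \<Otimes>\<^sub>M ?R)) = 1"
      unfolding Z by (rule t)+
  qed
  have indZ: "prob_space.indep_vars (?R \<Otimes>\<^sub>M ?R) (\<lambda>_. borel) (noise_coord 0 n) (model_keys 1 n n)"
  proof -
    have inj: "inj_on (\<lambda>s. (Min s, Max s - 0)) (snd ` model_keys 1 n n)"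
    proof (rule inj_onI, elim imageE)
      fix s t k k' assume "(Min s, Max s - 0) = (Min t, Max t - 0)" "s = snd k" "k \<in> model_keys 1 n n" "t = snd k'" "k' \<in> model_keys 1 n n"
      then show "s = t" by (elim keys_1) auto
    qed
    have im: "(\<lambda>s. (Min s, Max s - 0)) ` snd ` model_keys 1 n n \<subseteq> {(i, j). i < j \<and> j < n}"
    proof safe
      fix b s assume "(b, s) \<in> model_keys 1 n n"
      then show "Min (snd (b, s)) < Max (snd (b, s)) - 0" "Max (snd (b, s)) - 0 < n" by (elim keys_1; simp)+
    qed
    show ?thesis
      unfolding noise_coord_def[abs_def] by (rule indep_two_copies[OF R indep_goe[OF v] inj im])
  qed
  have V: "{..<n} \<union> columns 1 n n = {..<n}" by (simp add: columns_def)
  show ?thesis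
    unfolding spiked_app_def spiked_def spiked_app_axioms_def spiked_axioms_def V
  proof (intro conjI allI impI)
    show "prob_space (correlated_pair n \<rho>)" by (rule prob_space_correlated_pair)
    show "prob_space (?R \<Otimes>\<^sub>M ?R)" by (rule prob_space_pair[OF R R])
    show "prob_space.indep_vars (correlated_pair n \<rho>) (\<lambda>_. borel \<Otimes>\<^sub>M borel)
      (\<lambda>x \<omega>. (coord n True x \<omega>, coord n False x \<omega>)) {..<n}" by (rule indep_coord)
    show "snd k \<subseteq> {..<n}" if "k \<in> model_keys 1 n n" for k using that by (elim keys_1) auto
  qed (use indZ Zm coord_moments[OF _ \<rho>] n \<rho> ab g Phi_bound_ge_1 in \<open>auto simp: spike_pair_def\<close>)
qed

text \<open>A row vertex carries the pair of entries of \<open>u\<close> and \<open>v\<close>, a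
  column vertex the rescaled pair of entries of \<open>a\<close> and \<open>b\<close>, found at
  index \<open>x - n\<close>.\<close>

lemma spiked_cswish:
  assumes m: "0 < m" and \<rho>: "\<rho> \<in> {0..1}" and ab: "0 \<le> \<alpha>" "0 \<le> \<beta>" "\<alpha> \<le> g" "\<beta> \<le> g" and g: "1 \<le> g"
  shows "spiked_app (correlated_pair m \<rho> \<Otimes>\<^sub>M (gaussian_vec n 1 \<Otimes>\<^sub>M gaussian_vec n 1))
    (gaussian_mat n m (1 / m) \<Otimes>\<^sub>M gaussian_mat n m (1 / m))
    (\<lambda>l x w. if x < n then (if l then fst (snd w) else snd (snd w)) x else coord m l (x - n) (fst w)) (noise_coord n m)
    (spike_pair \<alpha> \<beta>) (\<lambda>x. if x < n then 0 else \<rho>) g Phi_bound 2 n m \<rho>"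
proof -
  let ?R = "gaussian_mat n m (1 / real m)"
  let ?G = "gaussian_vec n 1"
  let ?C = "correlated_pair m \<rho>"
  let ?xi = "\<lambda>l x w. if x < n then (if l then fst (snd w) else snd (snd w)) x else coord m l (x - n) (fst w)"
  have v: "0 < 1 / real m" using m by simp
  have R: "prob_space ?R" by (rule prob_space_gaussian_mat[OF v])
  have G: "prob_space ?G" by (simp add: prob_space_gaussian_vec)
  have GG: "prob_space (?G \<Otimes>\<^sub>M ?G)" by (rule prob_space_pair[OF G G])
  have C: "prob_space ?C" by (rule prob_space_correlated_pair)
  have CG: "prob_space (?C \<Otimes>\<^sub>M (?G \<Otimes>\<^sub>M ?G))" by (rule prob_space_pair[OF C GG])
  have e1: "integrable ?R (\<lambda>\<omega>. \<omega> (i, j))" "integrable ?R (\<lambda>\<omega>. (\<omega> (i, j))\<^sup>2)"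
    "(\<integral>\<omega>. \<omega> (i, j) \<partial>?R) = 0" "(\<integral>\<omega>. (\<omega> (i, j))\<^sup>2 \<partial>?R) = 1 / real m" if "i < n" "j < m" for i j
  proof -
    have p: "(i, j) \<in> {..<n} \<times> {..<m}" using that by simp
    show "integrable ?R (\<lambda>\<omega>. \<omega> (i, j))" "integrable ?R (\<lambda>\<omega>. (\<omega> (i, j))\<^sup>2)"
      "(\<integral>\<omega>. \<omega> (i, j) \<partial>?R) = 0" "(\<integral>\<omega>. (\<omega> (i, j))\<^sup>2 \<partial>?R) = 1 / real m"
      unfolding gaussian_mat_def
      using integrable_gaussian_array[OF v p gau_power[OF v, of 1]] integral_gaussian_array[OF v p gau_power[OF v, of 1]]
        integrable_gaussian_array[OF v p gau_power[OF v, of 2]] integral_gaussian_array[OF v p gau_power[OF v, of 2]]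
        gau_moments[OF v] by simp_all
  qed
  have c: "(sqrt (real m))\<^sup>2 * (1 / real m) = 1" using m by simp
  have Zm: "integrable (?R \<Otimes>\<^sub>M ?R) (noise_coord n m k)" "integrable (?R \<Otimes>\<^sub>M ?R) (\<lambda>w. (noise_coord n m k w)\<^sup>2)"
    "(\<integral>w. noise_coord n m k w \<partial>(?R \<Otimes>\<^sub>M ?R)) = 0" "(\<integral>w. (noise_coord n m k w)\<^sup>2 \<partial>(?R \<Otimes>\<^sub>M ?R)) = 1"
    if k: "k \<in> model_keys 2 n m" for k
  proof -
    obtain x y where xy: "x < m" "y < n" "snd k = {x + n, y}" "Min (snd k) = y" "Max (snd k) = x + n"
      using keys_2[OF k] .
    note t = two_copies_moments[OF R e1[OF xy(2,1)] c, of "fst k"]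
    have Z: "noise_coord n m k = (\<lambda>w. sqrt (real m) * (if fst k then fst w else snd w) (y, x))"
      by (rule ext) (simp only: noise_coord_def xy(4,5) add_diff_cancel_right')
    show "integrable (?R \<Otimes>\<^sub>M ?R) (noise_coord n m k)" "integrable (?R \<Otimes>\<^sub>M ?R) (\<lambda>w. (noise_coord n m k w)\<^sup>2)"
      "(\<integral>w. noise_coord n m k w \<partial>(?R \<Otimes>\<^sub>M ?R)) = 0" "(\<integral>w. (noise_coord n m k w)\<^sup>2 \<partial>(?R \<Otimes>\<^sub>M ?R)) = 1"
      unfolding Z by (rule t)+
  qed
  have indZ: "prob_space.indep_vars (?R \<Otimes>\<^sub>M ?R) (\<lambda>_. borel) (noise_coord n m) (model_keys 2 n m)"
  proof -
    have inj: "inj_on (\<lambda>s. (Min s, Max s - n)) (snd ` model_keys 2 n m)"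
    proof (rule inj_onI, elim imageE)
      fix s t k k' assume "(Min s, Max s - n) = (Min t, Max t - n)" "s = snd k" "k \<in> model_keys 2 n m" "t = snd k'" "k' \<in> model_keys 2 n m"
      then show "s = t" by (elim keys_2) auto
    qed
    have im: "(\<lambda>s. (Min s, Max s - n)) ` snd ` model_keys 2 n m \<subseteq> {..<n} \<times> {..<m}"
    proof safe
      fix b s assume "(b, s) \<in> model_keys 2 n m"
      then show "Min (snd (b, s)) < n" "Max (snd (b, s)) - n < m" by (elim keys_2; simp)+
    qed
    have iR: "prob_space.indep_vars ?R (\<lambda>_. borel) (\<lambda>p \<omega>. \<omega> p) ({..<n} \<times> {..<m})"
      unfolding gaussian_mat_def by (rule indep_gaussian_array) (use v in auto)
    show ?thesis
      unfolding noise_coord_def[abs_def] by (rule indep_two_copies[OF R iR inj im])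
  qed
  have V: "{..<n} \<union> columns 2 n m = {..<n + m}" by (auto simp: columns_def)
  have ind: "prob_space.indep_vars (?C \<Otimes>\<^sub>M (?G \<Otimes>\<^sub>M ?G)) (\<lambda>_. borel \<Otimes>\<^sub>M borel)
      (\<lambda>x \<omega>. (?xi True x \<omega>, ?xi False x \<omega>)) {..<n + m}"
  proof -
    interpret prob_space "?C \<Otimes>\<^sub>M (?G \<Otimes>\<^sub>M ?G)" by (rule CG)
    have 1: "prob_space.indep_vars ?C (\<lambda>_. borel \<Otimes>\<^sub>M borel)
        (\<lambda>x w. (coord m True (x - n) w, coord m False (x - n) w)) {n..<n + m}"
      by (rule indep_vars_reindex[OF C indep_coord]) (auto simp: inj_on_def)
    have ig: "prob_space.indep_vars ?G (\<lambda>_. borel) (\<lambda>i \<omega>. \<omega> i) {..<n}"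
      unfolding gaussian_vec_def by (rule indep_gaussian_array) auto
    have "indep_vars (\<lambda>_. borel \<Otimes>\<^sub>M borel) (\<lambda>x w. if x \<in> {n..<n + m}
        then (coord m True (x - n) (fst w), coord m False (x - n) (fst w))
        else (fst (snd w) x, snd (snd w) x)) ({n..<n + m} \<union> {..<n})"
      by (rule indep_vars_pair_measure[OF C GG 1 indep_pairs[OF G G ig ig]]) auto
    moreover have "{n..<n + m} \<union> {..<n} = {..<n + m}" by auto
    ultimately have "indep_vars (\<lambda>_. borel \<Otimes>\<^sub>M borel) (\<lambda>x w. if x \<in> {n..<n + m}
        then (coord m True (x - n) (fst w), coord m False (x - n) (fst w))
        else (fst (snd w) x, snd (snd w) x)) {..<n + m}" by simp
    then show ?thesis
      by (rule indep_vars_cong[THEN iffD1, rotated -1]) (auto simp: fun_eq_iff)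
  qed
  have gi: "integrable ?G (\<lambda>g. g x * g x)" "(\<integral>g. g x * g x \<partial>?G) = 1"
    "integrable ?G (\<lambda>g. g x)" "(\<integral>g. g x \<partial>?G) = 0" if "x < n" for x
    using gaussian_vec_moments[OF that that] by simp_all
  have gg: "(\<integral>w. (if l then fst w else snd w) x * (if l then fst w else snd w) x \<partial>(?G \<Otimes>\<^sub>M ?G)) = 1"
    "integrable (?G \<Otimes>\<^sub>M ?G) (\<lambda>w. (if l then fst w else snd w) x * (if l then fst w else snd w) x)" if "x < n" for x l
    using integral_fst[OF G G gi(1)[OF that]] integral_snd[OF G G gi(1)[OF that]]
      integrable_fst[OF G G gi(1)[OF that]] integrable_snd[OF G G gi(1)[OF that]] gi(2)[OF that]
    by (cases l; simp)+
  have gx: "(\<integral>w. fst w x * snd w x \<partial>(?G \<Otimes>\<^sub>M ?G)) = 0" "integrable (?G \<Otimes>\<^sub>M ?G) (\<lambda>w. fst w x * snd w x)" if "x < n" for x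
    using integral_pair_product[OF G G gi(3)[OF that] gi(3)[OF that]] gi(4)[OF that] by simp_all
  have gp: "integrable (?G \<Otimes>\<^sub>M ?G) (\<lambda>w. (1 + (fst w x)\<^sup>2 + (snd w x)\<^sup>2) ^ p)"
    "(\<integral>w. (1 + (fst w x)\<^sup>2 + (snd w x)\<^sup>2) ^ 4 \<partial>(?G \<Otimes>\<^sub>M ?G)) \<le> Phi_bound" if "x < n" for x p
    using gauss_pair_integrable[OF that, of 0 1 p] gauss_pair_fourth[OF that, of 0 1] by simp_all
  have snd_int: "(\<integral>w. h (snd w) \<partial>(?C \<Otimes>\<^sub>M (?G \<Otimes>\<^sub>M ?G))) = (\<integral>w. h w \<partial>(?G \<Otimes>\<^sub>M ?G))"
    if "integrable (?G \<Otimes>\<^sub>M ?G) h" for h :: "_ \<Rightarrow> real" by (rule integral_snd[OF C GG that])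
  have fst_int: "(\<integral>w. h (fst w) \<partial>(?C \<Otimes>\<^sub>M (?G \<Otimes>\<^sub>M ?G))) = (\<integral>w. h w \<partial>?C)"
    if "integrable ?C h" for h :: "_ \<Rightarrow> real" by (rule integral_fst[OF C GG that])
  \<comment> \<open>Integrability of these products is what allows \<open>integral_fst\<close> to
    discard the factor of \<open>u\<close> and \<open>v\<close>.\<close>
  have ixx: "integrable ?C (\<lambda>w. coord m l i w * coord m l' i w)" if i: "i < m" for l l' i
  proof (rule Bochner_Integration.integrable_bound[OF coord_moments(3)[OF i \<rho>, of 1]])
    show "(\<lambda>w. coord m l i w * coord m l' i w) \<in> borel_measurable ?C"
      unfolding measurable_cong_sets[OF sets_correlated_pair refl]
      by (intro borel_measurable_times coord_measurable i)
    have ab: "\<bar>a * b\<bar> \<le> 1 + a\<^sup>2 + b\<^sup>2" "\<bar>a * a\<bar> \<le> 1 + a\<^sup>2 + b\<^sup>2" "\<bar>b * b\<bar> \<le> 1 + a\<^sup>2 + b\<^sup>2" for a b :: real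
    proof -
      have "2 * (\<bar>a\<bar> * \<bar>b\<bar>) \<le> a\<^sup>2 + b\<^sup>2"
        using sum_squares_bound[of "\<bar>a\<bar>" "\<bar>b\<bar>"] by (simp add: mult.assoc)
      moreover have "0 \<le> \<bar>a\<bar> * \<bar>b\<bar>" by simp
      ultimately show "\<bar>a * b\<bar> \<le> 1 + a\<^sup>2 + b\<^sup>2" unfolding abs_mult by linarith
    qed (simp_all add: power2_eq_square)
    have "\<bar>coord m l i w * coord m l' i w\<bar> \<le> 1 + (coord m True i w)\<^sup>2 + (coord m False i w)\<^sup>2" for w
    proof -
      note t = ab[where a = "coord m True i w" and b = "coord m False i w"]
        ab(1)[of "coord m True i w" "coord m False i w", unfolded mult.commute[of "coord m True i w" "coord m False i w"]]
      show ?thesis by (cases l; cases l'; simp only: t)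
    qed
    then show "AE w in ?C. norm (coord m l i w * coord m l' i w)
        \<le> norm ((1 + (coord m True i w)\<^sup>2 + (coord m False i w)\<^sup>2) ^ 1)"
      by (intro AE_I2) simp
  qed
  show ?thesis
    unfolding spiked_app_def spiked_def spiked_app_axioms_def spiked_axioms_def V
  proof (intro conjI allI impI)
    show "prob_space (?C \<Otimes>\<^sub>M (?G \<Otimes>\<^sub>M ?G))" by (rule CG)
    show "prob_space (?R \<Otimes>\<^sub>M ?R)" by (rule prob_space_pair[OF R R])
    show "snd k \<subseteq> {..<n + m}" if "k \<in> model_keys 2 n m" for k using that by (elim keys_2) auto
    fix x assume x: "x \<in> {..<n + m}"
    have xm: "x - n < m" if "\<not> x < n" using x that by auto
    show "(\<integral>\<omega>. ?xi l x \<omega> * ?xi l x \<omega> \<partial>(?C \<Otimes>\<^sub>M (?G \<Otimes>\<^sub>M ?G))) = 1" for l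
      using snd_int[OF gg(2)[of x l]] gg(1)[of x l] fst_int[OF ixx[of "x - n" l l]] coord_moments(1)[OF xm \<rho>, of l] xm
      by (cases "x < n") simp_all
    show "(\<integral>\<omega>. ?xi True x \<omega> * ?xi False x \<omega> \<partial>(?C \<Otimes>\<^sub>M (?G \<Otimes>\<^sub>M ?G))) = (if x < n then 0 else \<rho>)"
      using snd_int[OF gx(2)[of x]] gx(1)[of x] fst_int[OF ixx[of "x - n" True False]] coord_moments(2)[OF xm \<rho>] xm
      by (cases "x < n") simp_all
    show "integrable (?C \<Otimes>\<^sub>M (?G \<Otimes>\<^sub>M ?G)) (\<lambda>\<omega>. (1 + (?xi True x \<omega>)\<^sup>2 + (?xi False x \<omega>)\<^sup>2) ^ p)" for p
      using integrable_snd[OF C GG gp(1)[of x p]] integrable_fst[OF C GG coord_moments(3)[OF xm \<rho>, of p]]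
      by (cases "x < n") simp_all
    show "(\<integral>\<omega>. (1 + (?xi True x \<omega>)\<^sup>2 + (?xi False x \<omega>)\<^sup>2) ^ 4 \<partial>(?C \<Otimes>\<^sub>M (?G \<Otimes>\<^sub>M ?G))) \<le> Phi_bound"
      using snd_int[OF gp(1)[of x 4]] gp(2)[of x] fst_int[OF coord_moments(3)[OF xm \<rho>, of 4]] coord_moments(4)[OF xm \<rho>]
      by (cases "x < n") simp_all
  qed (use ind indZ Zm m \<rho> ab g Phi_bound_ge_1 in \<open>auto simp: spike_pair_def columns_def\<close>)
qed

section \<open>Moments under the two laws, and assembly\<close>

lemma cswig_moments:
  assumes n: "0 < n" and \<rho>: "\<rho> \<in> {0..1}" and ab: "0 \<le> \<alpha>" "0 \<le> \<beta>" "\<alpha> \<le> real J" "\<beta> \<le> real J"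
    and level_ok: "level_ok 1 Phi_bound n n J" and i: "i < J"
  shows "stat_moments (cswig n \<alpha> \<beta> \<rho>) 1 n n p (spike_pair \<alpha> \<beta>) \<rho> J (from_nat i)"
proof -
  have J: "1 \<le> real J" using level_ok by (simp add: level_ok_def)
  interpret S: spiked_app "correlated_pair n \<rho>" "goe n (1 / n) \<Otimes>\<^sub>M goe n (1 / n)" "coord n" "noise_coord 0 n"
    "spike_pair \<alpha> \<beta>" "\<lambda>_. \<rho>" "real J" Phi_bound 1 n n \<rho>
    by (rule spiked_cswig[OF n \<rho> ab J])
  let ?T = "\<lambda>((a, b), (Z\<^sub>a, Z\<^sub>b)). (spike n n \<alpha> a a Z\<^sub>a, spike n n \<beta> b b Z\<^sub>b)"
  have T: "?T \<in> measurable (correlated_pair n \<rho> \<Otimes>\<^sub>M (goe n (1 / n) \<Otimes>\<^sub>M goe n (1 / n))) (mat_space n n \<Otimes>\<^sub>M mat_space n n)"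
    unfolding case_prod_beta by (intro measurable_Pair measurable_spike) measurable
  have matrix_entry: "matrix_entry 1 n k (?T w) = S.X k w / sqrt n" if k: "k \<in> model_keys 1 n n" for w k
  proof -
    obtain x y where xy: "x < y" "y < n" "snd k = {x, y}" "Min (snd k) = x" "Max (snd k) = y"
      using keys_1[OF k] .
    have pr: "(\<Prod>z\<in>snd k. coord n (fst k) z (fst w)) = coord n (fst k) x (fst w) * coord n (fst k) y (fst w)"
      unfolding xy(3) using xy(1) by simp
    show ?thesis
      unfolding S.X_def S.signal_def pr matrix_entry_def noise_coord_def xy(4,5) using n xy(1,2)
      by (cases "fst k") (simp_all add: coord_def spike_pair_def spike_def case_prod_beta field_simps)
  qed
  have "(\<lambda>l. spike_pair \<alpha> \<beta> l ^ 1) = spike_pair \<alpha> \<beta>" by simp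
  then show ?thesis
    using S.stat_moments_distr[OF T matrix_entry level_ok refl i, of p] unfolding cswig_def by simp
qed

text \<open>After rescaling by \<open>sqrt m\<close> the signal strength of an entry is the root of
  \<alpha> or \<beta>. Each letter is read twice, so the path weights contain \<alpha> and \<beta>
  themselves.\<close>

lemma cswish_moments:
  assumes \<rho>: "\<rho> \<in> {0..1}" and ab: "0 \<le> \<alpha>" "0 \<le> \<beta>" "\<alpha> \<le> real J" "\<beta> \<le> real J"
    and level_ok: "level_ok 2 Phi_bound n m J" and i: "i < J"
  shows "stat_moments (cswish n m \<alpha> \<beta> \<rho>) 2 n m p (spike_pair \<alpha> \<beta>) \<rho> J (from_nat i)"
proof -
  have J: "1 \<le> real J" using level_ok by (simp add: level_ok_def)
  have m: "0 < m" using level_ok i by (auto simp: level_ok_def list_ok_def Let_def)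
  \<comment> \<open>The locale bounds the roots of the spike strengths, while the hypotheses bound
    the strengths; \<open>J \<ge> 1\<close> bridges the two.\<close>
  have rt: "sqrt x \<le> real J" if "x \<le> real J" for x
  proof -
    have "real J \<le> (real J)\<^sup>2" using J by (rule self_le_power) simp
    then have "x \<le> (real J)\<^sup>2" using that by linarith
    then show ?thesis using J by (intro real_le_lsqrt) auto
  qed
  let ?C = "correlated_pair m \<rho>" and ?G = "gaussian_vec n 1" and ?R = "gaussian_mat n m (1 / m)"
  let ?xi = "\<lambda>l x w. if x < n then (if l then fst (snd w) else snd (snd w)) x else coord m l (x - n) (fst w)"
  interpret S: spiked_app "?C \<Otimes>\<^sub>M (?G \<Otimes>\<^sub>M ?G)" "?R \<Otimes>\<^sub>M ?R" ?xi "noise_coord n m"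
    "spike_pair (sqrt \<alpha>) (sqrt \<beta>)" "\<lambda>x. if x < n then 0 else \<rho>" "real J" Phi_bound 2 n m \<rho>
    by (rule spiked_cswish[OF m \<rho> _ _ _ _ J]) (use ab rt in auto)
  let ?F = "\<lambda>((a, b), ((u, v), (Z\<^sub>a, Z\<^sub>b))).
        (spike n m (sqrt (\<alpha> / real m)) u a Z\<^sub>a, spike n m (sqrt (\<beta> / real m)) v b Z\<^sub>b)"
  let ?A = "\<lambda>((x, y), z). (x, (y, z))"
  let ?T = "?F \<circ> ?A"
  let ?MM = "mat_space n m \<Otimes>\<^sub>M mat_space n m"
  let ?PQ = "(?C \<Otimes>\<^sub>M (?G \<Otimes>\<^sub>M ?G)) \<Otimes>\<^sub>M (?R \<Otimes>\<^sub>M ?R)"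
  have G: "prob_space ?G" and R: "prob_space ?R" and C: "prob_space ?C"
    using m by (simp_all add: prob_space_gaussian_vec prob_space_gaussian_mat prob_space_correlated_pair)
  have F: "?F \<in> measurable (?C \<Otimes>\<^sub>M ((?G \<Otimes>\<^sub>M ?G) \<Otimes>\<^sub>M (?R \<Otimes>\<^sub>M ?R))) ?MM"
    unfolding case_prod_beta by (intro measurable_Pair measurable_spike) measurable
  have A: "?A \<in> measurable ?PQ (?C \<Otimes>\<^sub>M ((?G \<Otimes>\<^sub>M ?G) \<Otimes>\<^sub>M (?R \<Otimes>\<^sub>M ?R)))"
    unfolding case_prod_beta by measurable
  have law: "cswish n m \<alpha> \<beta> \<rho> = distr ?PQ ?MM ?T"
    unfolding cswish_def
    by (subst distr_assoc[OF C prob_space_pair[OF G G] prob_space_pair[OF R R], symmetric])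
      (rule distr_distr[OF F A])
  have T: "?T \<in> measurable ?PQ ?MM" using A F by (rule measurable_comp)
  have matrix_entry: "matrix_entry 2 n k (?T w) = S.X k w / sqrt m" if k: "k \<in> model_keys 2 n m" for w k
  proof -
    obtain x y where xy: "x < m" "y < n" "snd k = {x + n, y}" "Min (snd k) = y" "Max (snd k) = x + n"
      using keys_2[OF k] .
    have pr: "(\<Prod>z\<in>snd k. ?xi (fst k) z (fst w)) = ?xi (fst k) (x + n) (fst w) * ?xi (fst k) y (fst w)"
      unfolding xy(3) using xy(2) by simp
    show ?thesis
      unfolding S.X_def S.signal_def pr matrix_entry_def noise_coord_def xy(4,5) using m xy(1,2)
      by (cases "fst k") (simp_all add: coord_def spike_pair_def spike_def case_prod_beta real_sqrt_divide field_simps)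
  qed
  have eq: "(\<lambda>l. spike_pair (sqrt \<alpha>) (sqrt \<beta>) l ^ 2) = spike_pair \<alpha> \<beta>" using ab by (auto simp: spike_pair_def)
  show ?thesis
    using S.stat_moments_distr[where T = ?T, OF T _ level_ok refl i, of p] matrix_entry unfolding law eq by blast
qed

text \<open>The threshold inequality is symmetric in \<alpha> and \<beta>, so it yields good weights
  for either choice of the estimated label.\<close>

lemma admissible_weights:
  assumes "0 < \<epsilon>" "0 < \<tau>" "admissible \<epsilon> \<tau> \<alpha> \<beta> \<rho>"
  shows "\<exists>c :: nat list. 0 < block_noise c (1 / \<tau>) \<and> block_noise c (1 / \<tau>) < (block_signal c (block_weight (spike_pair \<alpha> \<beta>) \<rho> p))\<^sup>2"
proof -
  note a = admissible_signal[OF assms]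
  show ?thesis
  proof (rule signal_weights[OF assms(2) _ _ a(5)])
    show "0 < spike_pair \<alpha> \<beta> l" "\<tau> * (spike_pair \<alpha> \<beta> l)\<^sup>2 \<le> 1" for l using a by (auto simp: spike_pair_def)
    show "\<tau> * (spike_pair \<alpha> \<beta> (\<not> p))\<^sup>2 = 1 \<or> (1 - \<tau> * (spike_pair \<alpha> \<beta> p)\<^sup>2) * (1 - \<tau> * (spike_pair \<alpha> \<beta> (\<not> p))\<^sup>2)
        < \<rho> ^ 4 * (\<tau> * (spike_pair \<alpha> \<beta> p)\<^sup>2) * (\<tau> * (spike_pair \<alpha> \<beta> (\<not> p))\<^sup>2)"
      using a(7) by (cases p) (auto simp: spike_pair_def mult_ac)
  qed
qed

lemma cswig_consistent:
  assumes eps: "0 < \<epsilon>" and adm: "admissible \<epsilon> 1 \<alpha> \<beta> \<rho>"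
  shows "whp_consistent (\<lambda>n. cswig n \<alpha> \<beta> \<rho>) (\<lambda>n. estimator 1 Phi_bound p n n) (spike_pair \<alpha> \<beta> p)"
proof -
  note a = admissible_signal[OF eps zero_less_one adm]
  obtain c :: "nat list" where c: "0 < block_noise c 1" "block_noise c 1 < (block_signal c (block_weight (spike_pair \<alpha> \<beta>) \<rho> p))\<^sup>2"
    using admissible_weights[OF eps zero_less_one adm, of p] by auto
  show ?thesis
  proof (rule estimator_consistent[where Q = 1 and m = "\<lambda>n. n", OF _ _ _ _ c])
    show "filterlim (\<lambda>n :: nat. n) at_top sequentially" by (rule filterlim_ident)
    show "(\<lambda>n. aspect 1 n n) \<longlonglongrightarrow> 1" by (simp add: aspect_def)
    show "0 \<le> spike_pair \<alpha> \<beta> l" for l using a by (simp add: spike_pair_def)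
    show "prob_space (cswig n \<alpha> \<beta> \<rho>)" if "0 < n" for n using that by (rule prob_space_cswig)
    fix n J i assume level_ok: "level_ok 1 Phi_bound n n J" and le: "\<And>l. spike_pair \<alpha> \<beta> l \<le> real J" and i: "i < J"
    have "0 < n" using level_ok i by (auto simp: level_ok_def list_ok_def Let_def)
    then show "stat_moments (cswig n \<alpha> \<beta> \<rho>) 1 n n p (spike_pair \<alpha> \<beta>) \<rho> J (from_nat i)"
      using a le[of True] le[of False] by (intro cswig_moments level_ok i) (auto simp: spike_pair_def)
  qed (use a in auto)
qed

lemma cswish_consistent:
  fixes m :: "nat \<Rightarrow> nat"
  assumes eps: "0 < \<epsilon>" and tau: "0 < \<tau>" and m: "filterlim m at_top sequentially"
    and lim: "(\<lambda>n. real n / real (m n)) \<longlonglongrightarrow> \<tau>" and adm: "admissible \<epsilon> \<tau> \<alpha> \<beta> \<rho>"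
  shows "whp_consistent (\<lambda>n. cswish n (m n) \<alpha> \<beta> \<rho>) (\<lambda>n. estimator 2 Phi_bound p n (m n)) (spike_pair \<alpha> \<beta> p)"
proof -
  note a = admissible_signal[OF eps tau adm]
  obtain c :: "nat list" where c: "0 < block_noise c (1 / \<tau>)"
    "block_noise c (1 / \<tau>) < (block_signal c (block_weight (spike_pair \<alpha> \<beta>) \<rho> p))\<^sup>2"
    using admissible_weights[OF eps tau adm, of p] by auto
  show ?thesis
  proof (rule estimator_consistent[where Q = "1 / \<tau>" and m = m, OF _ m _ _ c])
    show "(\<lambda>n. aspect 2 n (m n)) \<longlonglongrightarrow> 1 / \<tau>"
      using tendsto_inverse[OF lim] tau by (simp add: aspect_def inverse_eq_divide)
    show "0 \<le> spike_pair \<alpha> \<beta> l" for l using a by (simp add: spike_pair_def)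
    show "prob_space (cswish n (m n) \<alpha> \<beta> \<rho>)" if "0 < m n" for n using that by (rule prob_space_cswish)
    fix n J i assume level_ok: "level_ok 2 Phi_bound n (m n) J" and le: "\<And>l. spike_pair \<alpha> \<beta> l \<le> real J" and i: "i < J"
    show "stat_moments (cswish n (m n) \<alpha> \<beta> \<rho>) 2 n (m n) p (spike_pair \<alpha> \<beta>) \<rho> J (from_nat i)"
      using a le[of True] le[of False] by (intro cswish_moments level_ok i) (auto simp: spike_pair_def)
  qed (use a tau in auto)
qed

theorem theorem1p5:
  fixes \<epsilon> :: real
  assumes "\<epsilon> > 0"
  shows
    "(\<exists>\<alpha>_hat \<beta>_hat :: nat \<Rightarrow> rmat \<times> rmat \<Rightarrow> real.
        (\<forall>n. \<alpha>_hat n \<in> borel_measurable (mat_space n n \<Otimes>\<^sub>M mat_space n n) \<and>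
             \<beta>_hat n \<in> borel_measurable (mat_space n n \<Otimes>\<^sub>M mat_space n n)) \<and>
        (\<forall>\<alpha> \<beta> \<rho>. admissible \<epsilon> 1 \<alpha> \<beta> \<rho> \<longrightarrow>
           whp_consistent (\<lambda>n. cswig n \<alpha> \<beta> \<rho>) \<alpha>_hat \<alpha> \<and>
           whp_consistent (\<lambda>n. cswig n \<alpha> \<beta> \<rho>) \<beta>_hat \<beta>))
     \<and>
     (\<exists>\<alpha>_hat \<beta>_hat :: nat \<Rightarrow> nat \<Rightarrow> rmat \<times> rmat \<Rightarrow> real.
        (\<forall>n m. \<alpha>_hat n m \<in> borel_measurable (mat_space n m \<Otimes>\<^sub>M mat_space n m) \<and>
               \<beta>_hat n m \<in> borel_measurable (mat_space n m \<Otimes>\<^sub>M mat_space n m)) \<and>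
        (\<forall>\<tau> \<alpha> \<beta> \<rho>. \<forall>m :: nat \<Rightarrow> nat.
           \<tau> > 0 \<and> filterlim m at_top sequentially \<and>
           (\<lambda>n. real n / real (m n)) \<longlonglongrightarrow> \<tau> \<and> admissible \<epsilon> \<tau> \<alpha> \<beta> \<rho> \<longrightarrow>
           whp_consistent (\<lambda>n. cswish n (m n) \<alpha> \<beta> \<rho>) (\<lambda>n. \<alpha>_hat n (m n)) \<alpha> \<and>
           whp_consistent (\<lambda>n. cswish n (m n) \<alpha> \<beta> \<rho>) (\<lambda>n. \<beta>_hat n (m n)) \<beta>))"
proof (intro conjI)
  show "\<exists>\<alpha>_hat \<beta>_hat :: nat \<Rightarrow> rmat \<times> rmat \<Rightarrow> real.
        (\<forall>n. \<alpha>_hat n \<in> borel_measurable (mat_space n n \<Otimes>\<^sub>M mat_space n n) \<and>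
             \<beta>_hat n \<in> borel_measurable (mat_space n n \<Otimes>\<^sub>M mat_space n n)) \<and>
        (\<forall>\<alpha> \<beta> \<rho>. admissible \<epsilon> 1 \<alpha> \<beta> \<rho> \<longrightarrow>
           whp_consistent (\<lambda>n. cswig n \<alpha> \<beta> \<rho>) \<alpha>_hat \<alpha> \<and>
           whp_consistent (\<lambda>n. cswig n \<alpha> \<beta> \<rho>) \<beta>_hat \<beta>)"
  proof (intro exI conjI allI impI)
    show "estimator 1 Phi_bound True n n \<in> borel_measurable (mat_space n n \<Otimes>\<^sub>M mat_space n n)"
      "estimator 1 Phi_bound False n n \<in> borel_measurable (mat_space n n \<Otimes>\<^sub>M mat_space n n)" for n
      by (simp_all add: estimator_measurable)
    fix \<alpha> \<beta> \<rho> assume "admissible \<epsilon> 1 \<alpha> \<beta> \<rho>"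
    note * = cswig_consistent[OF assms this]
    show "whp_consistent (\<lambda>n. cswig n \<alpha> \<beta> \<rho>) (\<lambda>n. estimator 1 Phi_bound True n n) \<alpha>"
      "whp_consistent (\<lambda>n. cswig n \<alpha> \<beta> \<rho>) (\<lambda>n. estimator 1 Phi_bound False n n) \<beta>"
      using *[of True] *[of False] by (simp_all add: spike_pair_def)
  qed
  show "\<exists>\<alpha>_hat \<beta>_hat :: nat \<Rightarrow> nat \<Rightarrow> rmat \<times> rmat \<Rightarrow> real.
        (\<forall>n m. \<alpha>_hat n m \<in> borel_measurable (mat_space n m \<Otimes>\<^sub>M mat_space n m) \<and>
               \<beta>_hat n m \<in> borel_measurable (mat_space n m \<Otimes>\<^sub>M mat_space n m)) \<and>
        (\<forall>\<tau> \<alpha> \<beta> \<rho>. \<forall>m :: nat \<Rightarrow> nat.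
           \<tau> > 0 \<and> filterlim m at_top sequentially \<and>
           (\<lambda>n. real n / real (m n)) \<longlonglongrightarrow> \<tau> \<and> admissible \<epsilon> \<tau> \<alpha> \<beta> \<rho> \<longrightarrow>
           whp_consistent (\<lambda>n. cswish n (m n) \<alpha> \<beta> \<rho>) (\<lambda>n. \<alpha>_hat n (m n)) \<alpha> \<and>
           whp_consistent (\<lambda>n. cswish n (m n) \<alpha> \<beta> \<rho>) (\<lambda>n. \<beta>_hat n (m n)) \<beta>)"
  proof (intro exI conjI allI impI)
    show "estimator 2 Phi_bound True n m \<in> borel_measurable (mat_space n m \<Otimes>\<^sub>M mat_space n m)"
      "estimator 2 Phi_bound False n m \<in> borel_measurable (mat_space n m \<Otimes>\<^sub>M mat_space n m)" for n m
      by (simp_all add: estimator_measurable)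
    fix \<tau> \<alpha> \<beta> \<rho> :: real and m :: "nat \<Rightarrow> nat"
    assume "\<tau> > 0 \<and> filterlim m at_top sequentially \<and>
           (\<lambda>n. real n / real (m n)) \<longlonglongrightarrow> \<tau> \<and> admissible \<epsilon> \<tau> \<alpha> \<beta> \<rho>"
    then have "0 < \<tau>" "filterlim m at_top sequentially" "(\<lambda>n. real n / real (m n)) \<longlonglongrightarrow> \<tau>"
      "admissible \<epsilon> \<tau> \<alpha> \<beta> \<rho>" by blast+
    note * = cswish_consistent[OF assms this]
    show "whp_consistent (\<lambda>n. cswish n (m n) \<alpha> \<beta> \<rho>) (\<lambda>n. estimator 2 Phi_bound True n (m n)) \<alpha>"
      "whp_consistent (\<lambda>n. cswish n (m n) \<alpha> \<beta> \<rho>) (\<lambda>n. estimator 2 Phi_bound False n (m n)) \<beta>"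
      using *[of True] *[of False] by (simp_all add: spike_pair_def)
  qed
qed

end
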